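(* $g_{\mathcal{UDG}}(n) = 2^{\Theta(n)}$; that is, there exist constants $c_1, c_2 > 0$ and $n_0$ such that for all $n \geq n_0$, $2^{c_1 n} \leq g_{\mathcal{UDG}}(n) \leq 2^{c_2 n}$.
   Context: The intersection graph of a tuple of sets $(A(v) : v \in V)$ is the graph with vertex set $V$ in which distinct $u,v$ are adjacent iff $A(u)\cap A(v) \neq \emptyset$; the tuple is then said to realize the graph. A unit disk graph is a graph that is (isomorphic to) the intersection graph of finitely many open disks in $\mathbb{R}^2$ all having the same (positive) radius. Let $\mathcal{UDG}(n)$ be the set of unit disk graphs with $n$ vertices. The bit size of an integer $n$ is $\mathrm{bitsize}(n) := 1 + \lceil \log_2(|n|+1)\rceil$, and the bit size of a rational number $q = \frac{n}{m}$, with $n,m$ relatively prime integers ($m\ge 1$), is $\mathrm{bitsize}(q) := \mathrm{bitsize}(n) + \mathrm{bitsize}(m)$. For a unit disk graph $G$, $g_{\mathcal{UDG}}(G)$ denotes the minimum, over all realizations of $G$ by open disks with centers in $\mathbb{Q}^2$ and a common rational radius, of the sum of the bit sizes of all the coordinates of the centers and of the common radius (such realizations exist for every unit disk graph). Let $g_{\mathcal{UDG}}(n) := \max_{G \in \mathcal{UDG}(n)} g_{\mathcal{UDG}}(G)$. *)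

theory Defs
  imports "HOL-Analysis.Analysis"
begin

(* A graph is a pair (vertex set, edge set), the edges being two-element sets of vertices. *)
type_synonym 'v graph = "'v set \<times> 'v set set"

abbreviation verts :: "'v graph \<Rightarrow> 'v set" where "verts G \<equiv> fst G"
abbreviation edges :: "'v graph \<Rightarrow> 'v set set" where "edges G \<equiv> snd G"

definition simple_graph :: "'v graph \<Rightarrow> bool" where
  "simple_graph G \<longleftrightarrow> (\<forall>e\<in>edges G. e \<subseteq> verts G \<and> card e = 2)"

definition graph_iso :: "'v graph \<Rightarrow> 'w graph \<Rightarrow> bool" where
  "graph_iso G H \<longleftrightarrow>
     (\<exists>f. bij_betw f (verts G) (verts H) \<and>
          (\<forall>u\<in>verts G. \<forall>v\<in>verts G. {u, v} \<in> edges G \<longleftrightarrow> {f u, f v} \<in> edges H))"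

definition intersection_graph :: "'v set \<Rightarrow> ('v \<Rightarrow> 'x set) \<Rightarrow> 'v graph" where
  "intersection_graph V A =
     (V, {{u, v} |u v. u \<in> V \<and> v \<in> V \<and> u \<noteq> v \<and> A u \<inter> A v \<noteq> {}})"

definition realizes :: "('v \<Rightarrow> 'x set) \<Rightarrow> 'v graph \<Rightarrow> bool" where
  "realizes A G \<longleftrightarrow> intersection_graph (verts G) A = G"

(* Every finite family of disks can be indexed by a finite set of natural numbers. *)
definition unit_disk_graph :: "'v graph \<Rightarrow> bool" where
  "unit_disk_graph G \<longleftrightarrow>
     simple_graph G \<and>
     (\<exists>(I :: nat set) (c :: nat \<Rightarrow> real^2) (r :: real).
        finite I \<and> r > 0 \<and> graph_iso G (intersection_graph I (\<lambda>i. ball (c i) r)))"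

(* Vertices are drawn from nat, so every isomorphism type of finite graph occurs. *)
definition UDG :: "nat \<Rightarrow> nat graph set" where
  "UDG n = {G. unit_disk_graph G \<and> card (verts G) = n}"

definition bitsize_int :: "int \<Rightarrow> nat" where
  "bitsize_int k = 1 + nat \<lceil>log 2 (real_of_int \<bar>k\<bar> + 1)\<rceil>"

(* quotient_of returns the coprime representation with positive denominator; 0 is 0/1. *)
definition bitsize_rat :: "rat \<Rightarrow> nat" where
  "bitsize_rat q = (case quotient_of q of (k, m) \<Rightarrow> bitsize_int k + bitsize_int m)"

definition rat_disk :: "rat^2 \<Rightarrow> rat \<Rightarrow> (real^2) set" where
  "rat_disk p r = ball (\<chi> i. of_rat (p $ i)) (of_rat r)"

definition realization_size :: "'v set \<Rightarrow> ('v \<Rightarrow> rat^2) \<Rightarrow> rat \<Rightarrow> nat" where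
  "realization_size V c r = (\<Sum>v\<in>V. \<Sum>i\<in>UNIV. bitsize_rat (c v $ i)) + bitsize_rat r"

(* The infimum of a nonempty set of natural numbers is its minimum. *)
definition g_UDG_graph :: "'v graph \<Rightarrow> nat" where
  "g_UDG_graph G =
     Inf {realization_size (verts G) c r |c r.
            r > 0 \<and> realizes (\<lambda>v. rat_disk (c v) r) G}"

(* UDG n is infinite for n > 0, but g_UDG_graph is invariant under isomorphism, so
   the maximum is taken over a finite set of values. *)
definition g_UDG :: "nat \<Rightarrow> nat" where
  "g_UDG n = Max (g_UDG_graph ` UDG n)"

end

theory Submission
  imports Defs
begin

text \<open>
  Upper bound. After rescaling, the realizations of a graph are the solutions in a box of polynomial
  inequalities \<open>s j y > 0\<close> of degree 2 in \<open>O(n)\<close> variables. The supremum \<open>t\<close> of the minimum of all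
  \<open>s j y\<close> is the limit for \<open>\<epsilon> \<rightarrow> 0\<close> of one coordinate of the minimizers of a piecewise polynomial
  penalty function with an added term \<open>\<epsilon>\<^sup>2 / 6 * (\<Sum>i. y i ^ 6)\<close>. In the variables \<open>z = \<epsilon> y\<close> this term makes the
  critical equations monic: each \<open>z i ^ 5\<close> is a polynomial of degree at most 3. Hence all powers of a
  coordinate are combinations of the \<open>5 ^ O(n)\<close> monomials with exponents at most 4, and Siegel's
  pigeonhole argument gives a nonzero integer polynomial with doubly exponential coefficients and
  root \<open>t\<close>. So \<open>t\<close> is at least the inverse of a doubly exponential number, and a near-optimal
  solution can be rounded to a grid. The number of inequalities, of order \<open>n\<^sup>2\<close>, does not enter the
  number of monomials.

  Lower bound. A point in the first but not in the second of two disks of equal radius lies on a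
  known side of the bisector of the centres, so a unit disk graph can prescribe the signs of points
  against lines. Take two of the lines as coordinate axes. If in \<open>a x + b y + c\<close> one term has the
  sign of the sum and the other two have the opposite sign, that term dominates both of the others.
  Chains of such dominations, read logarithmically, force a quantity to double with every constant
  number of added points and lines. After \<open>m\<close> stages some nonzero rational expression in the
  coordinates is at most \<open>2 powr - (2 ^ m)\<close>, which requires \<open>2 ^ m\<close> bits up to a constant factor.
\<close>

section \<open>Integer relations between monomials\<close>

text \<open>Critical equations at an optimum can be degenerate, and then elimination by resultants
  or determinants may return the zero polynomial. Reduction modulo monic equations never divides and
  needs no genericity; nonvanishing comes from counting alone. The resulting relation still contains
  \<epsilon>, but it holds with the same coefficients along a whole sequence with \<epsilon> tending
  to 0, after the set of active constraints has been made constant on a subsequence. As the relevant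
  coordinate z satisfies z / \<epsilon> \<rightarrow> t, the part of lowest total degree in
  \<epsilon> and z survives in the limit, and it is a nonzero polynomial in t. In the lower bound a
  realization is known only through strict signs, and either axis may be stretched freely. So the
  signs of all line coefficients have to be forced first, and the quantity that doubles must not
  change under stretching. The doubling is an inequality form of squaring a length by similar
  triangles. Strictness alone would give no definite start; that comes from one term exceeding the
  sum of two others, which yields a factor 2.\<close>

lemma siegel_pigeonhole:
  fixes A :: "'j \<Rightarrow> 'i \<Rightarrow> int"
  assumes I: "finite I" "I \<noteq> {}" and J: "finite J" and card: "2 * card J \<le> card I"
    and S: "1 \<le> S" "\<And>j i. j \<in> J \<Longrightarrow> i \<in> I \<Longrightarrow> \<bar>A j i\<bar> \<le> S"
  shows "\<exists>x. (\<exists>i\<in>I. x i \<noteq> 0) \<and> (\<forall>i\<in>I. \<bar>x i\<bar> \<le> 2 * int (card I) * S) \<and>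
    (\<forall>j\<in>J. (\<Sum>i\<in>I. A j i * x i) = 0)"
proof -
  \<comment> \<open>The box [0, Q]^I is sent to values between -W and W with 2 W = Q^2, hence to at
    most Q^2 + 1 < (Q + 1)^2 values per equation. With two unknowns per equation the box has more
    points than there are possible images.\<close>
  define Q where "Q = 2 * int (card I) * S"
  have cI: "card I > 0" using I by (simp add: card_gt_0_iff)
  have "0 < Q" using S(1) cI unfolding Q_def by (intro mult_pos_pos) auto
  then have Q1: "Q \<ge> 1" by simp
  define X where "X = (PiE I (\<lambda>_. {0..Q}))"
  define L where "L = (\<lambda>x. restrict (\<lambda>j. \<Sum>i\<in>I. A j i * x i) J)"
  define W where "W = int (card I) * (S * Q)"
  have QW: "2 * W = Q * Q" by (simp add: W_def Q_def)
  have fX: "finite X" using I by (auto simp: X_def intro: finite_PiE)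
  have LX: "L ` X \<subseteq> PiE J (\<lambda>_. {-W..W})"
  proof (rule image_subsetI, unfold L_def, rule restrict_PiE_iff[THEN iffD2], rule ballI)
    fix x j assume x: "x \<in> X" and j: "j \<in> J"
    have "\<bar>\<Sum>i\<in>I. A j i * x i\<bar> \<le> (\<Sum>i\<in>I. \<bar>A j i * x i\<bar>)" by (rule sum_abs)
    also have "\<dots> \<le> (\<Sum>i\<in>I. S * Q)"
    proof (rule sum_mono)
      fix i assume i: "i \<in> I"
      have "x i \<in> {0..Q}" using x i by (auto simp: X_def)
      then show "\<bar>A j i * x i\<bar> \<le> S * Q"
        using S(2)[OF j i] Q1 by (auto simp: abs_mult intro!: mult_mono)
    qed
    also have "\<dots> = W" by (simp add: W_def)
    finally show "(\<Sum>i\<in>I. A j i * x i) \<in> {-W..W}" by auto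
  qed
  have W0: "W \<ge> 0" using S(1) Q1 by (simp add: W_def)
  have cX: "card X = nat (Q + 1) ^ card I" using I by (simp add: X_def card_PiE)
  have cY: "card (PiE J (\<lambda>_. {-W..W})) = nat (Q * Q + 1) ^ card J"
  proof -
    have "W + 1 - (- W) = Q * Q + 1" using QW by simp
    then show ?thesis using J by (simp add: card_PiE)
  qed
  have Q2: "nat (Q + 1) \<ge> 2" using Q1 by linarith
  have less: "nat (Q * Q + 1) ^ card J < nat (Q + 1) ^ card I"
  proof (cases "card J = 0")
    case True
    then show ?thesis using one_less_power[of "nat (Q + 1)" "card I"] Q2 cI by simp
  next
    case False
    have "Q * Q + 1 < (Q + 1) ^ 2" using Q1 by (simp add: power2_eq_square algebra_simps)
    then have "nat (Q * Q + 1) < nat ((Q + 1) ^ 2)" using Q1 by (intro nat_less_eq_zless[THEN iffD2]) auto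
    then have "nat (Q * Q + 1) < nat (Q + 1) ^ 2" using Q1 by (simp add: nat_power_eq)
    then have "nat (Q * Q + 1) ^ card J < (nat (Q + 1) ^ 2) ^ card J"
      using False by (intro power_strict_mono) auto
    also have "\<dots> = nat (Q + 1) ^ (2 * card J)" by (simp add: power_mult)
    also have "\<dots> \<le> nat (Q + 1) ^ card I" using card Q2 by (intro power_increasing) auto
    finally show ?thesis .
  qed
  have "card (L ` X) \<le> card (PiE J (\<lambda>_. {-W..W}))"
    using LX J by (intro card_mono finite_PiE) auto
  then have "card (L ` X) < card X" using less cX cY by simp
  then have "\<not> inj_on L X" using fX by (metis card_image less_irrefl)
  then obtain x y where xy: "x \<in> X" "y \<in> X" "L x = L y" "x \<noteq> y" by (auto simp: inj_on_def)
  have "\<exists>i\<in>I. x i - y i \<noteq> 0"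
  proof (rule ccontr)
    assume "\<not> ?thesis"
    then have "x = y" using xy(1,2) unfolding X_def by (intro PiE_ext[of x I _ y]) auto
    then show False using xy(4) by simp
  qed
  moreover have "\<bar>x i - y i\<bar> \<le> Q" if "i \<in> I" for i
  proof -
    have "x i \<in> {0..Q}" "y i \<in> {0..Q}" using xy that by (auto simp: X_def)
    then show ?thesis by auto
  qed
  moreover have "(\<Sum>i\<in>I. A j i * (x i - y i)) = 0" if "j \<in> J" for j
  proof -
    have "L x j = L y j" using xy by simp
    then show ?thesis using that by (simp add: L_def right_diff_distrib sum_subtractf)
  qed
  ultimately show ?thesis unfolding Q_def[symmetric] by (intro exI[of _ "\<lambda>i. x i - y i"]) simp
qed

text \<open>Cauchy's root bound at the low end: the lowest nonzero coefficient is an integer, so its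
  term is at least t^k0, while for t < 1 / (1 + Q), that is Q t < 1 - t, the geometric series of the
  higher terms stays below this.\<close>

lemma int_poly_root_lower_bound:
  fixes t Q :: real and c :: "nat \<Rightarrow> int"
  assumes root: "(\<Sum>k\<le>K. of_int (c k) * t ^ k) = 0" and nz: "\<exists>k\<le>K. c k \<noteq> 0"
    and Q: "\<And>k. k \<le> K \<Longrightarrow> \<bar>of_int (c k)\<bar> \<le> Q" and t: "0 < t"
  shows "1 / (1 + Q) \<le> t"
proof (rule ccontr)
  assume "\<not> ?thesis"
  then have tQ: "t < 1 / (1 + Q)" by simp
  have Q0: "Q \<ge> 0" using Q[of 0] by simp
  have tQ': "Q * t < 1 - t" using tQ Q0 by (simp add: field_simps)
  define k0 where "k0 = (LEAST k. c k \<noteq> 0)"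
  obtain k1 where k1: "k1 \<le> K" "c k1 \<noteq> 0" using nz by auto
  have k0: "c k0 \<noteq> 0" unfolding k0_def using k1(2) by (rule LeastI)
  have "k0 \<le> k1" unfolding k0_def using k1(2) by (rule Least_le)
  then have k0K: "k0 \<le> K" using k1 by simp
  have least: "c k = 0" if "k < k0" for k
    using not_less_Least[of k "\<lambda>k. c k \<noteq> 0"] that unfolding k0_def by simp
  have t1: "t < 1" using tQ' Q0 t mult_nonneg_nonneg[of Q t] by linarith
  have split: "{..K} = ({..<k0} \<union> {k0}) \<union> {k0<..K}" using k0K by auto
  let ?f = "\<lambda>k. of_int (c k) * t ^ k"
  have "0 = sum ?f {..<k0} + ?f k0 + sum ?f {k0<..K}"
  proof -
    have "sum ?f {..K} = sum ?f ({..<k0} \<union> {k0}) + sum ?f {k0<..K}"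
      unfolding split by (rule sum.union_disjoint) auto
    also have "sum ?f ({..<k0} \<union> {k0}) = sum ?f {..<k0} + sum ?f {k0}"
      by (rule sum.union_disjoint) auto
    finally show ?thesis using root by simp
  qed
  also have "sum ?f {..<k0} = 0" using least by simp
  finally have eq: "\<bar>of_int (c k0) * t ^ k0\<bar> = \<bar>\<Sum>k\<in>{k0<..K}. of_int (c k) * t ^ k\<bar>" by linarith
  have "t ^ k0 * (1 - t) \<le> \<bar>of_int (c k0) * t ^ k0\<bar> * (1 - t)"
    using k0 t t1 by (intro mult_right_mono) (auto simp: abs_mult)
  also have "\<dots> \<le> (\<Sum>k\<in>{k0<..K}. Q * t ^ k) * (1 - t)"
    unfolding eq using t t1 Q
    by (intro mult_right_mono order_trans[OF sum_abs] sum_mono)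
      (auto simp: abs_mult intro!: mult_right_mono)
  also have "\<dots> = Q * ((1 - t) * (\<Sum>k=Suc k0..K. t ^ k))"
    by (simp add: sum_distrib_left[symmetric] atLeastSucAtMost_greaterThanAtMost)
  also have "\<dots> \<le> Q * t ^ Suc k0"
  proof (intro mult_left_mono Q0, cases "k0 = K")
    case False
    then have "(1 - t) * (\<Sum>k=Suc k0..K. t ^ k) = t ^ Suc k0 - t ^ Suc K"
      using k0K by (intro sum_gp_multiplied) simp
    then show "(1 - t) * (\<Sum>k=Suc k0..K. t ^ k) \<le> t ^ Suc k0" using t by simp
  qed (use t in auto)
  also have "\<dots> = t ^ k0 * (Q * t)" by simp
  also have "\<dots> < t ^ k0 * (1 - t)" using tQ' t by (intro mult_strict_left_mono) auto
  finally show False by simp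
qed

section \<open>Polynomials in \<epsilon> and several variables as lists of terms\<close>

type_synonym term_list = "(int \<times> nat \<times> (nat \<Rightarrow> nat)) list"

definition mon :: "nat \<Rightarrow> (nat \<Rightarrow> nat) \<Rightarrow> (nat \<Rightarrow> real) \<Rightarrow> real" where
  "mon M \<gamma> z = (\<Prod>i<M. z i ^ \<gamma> i)"

definition mdeg :: "nat \<Rightarrow> (nat \<Rightarrow> nat) \<Rightarrow> nat" where
  "mdeg M \<gamma> = (\<Sum>i<M. \<gamma> i)"

text \<open>A triple \<open>(a, k, \<gamma>)\<close> stands for a \<epsilon>^k z^\<gamma>. Terms may
  repeat: as like terms are not collected, \<open>tnorm\<close> is exactly additive under append and
  is scaled exactly by \<open>term_mult\<close>. The power of \<epsilon> is kept apart because it is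
  never reduced.\<close>

definition tval :: "nat \<Rightarrow> term_list \<Rightarrow> real \<Rightarrow> (nat \<Rightarrow> real) \<Rightarrow> real" where
  "tval M ts \<epsilon> z = (\<Sum>(a, k, \<gamma>)\<leftarrow>ts. of_int a * \<epsilon> ^ k * mon M \<gamma> z)"

definition tnorm :: "term_list \<Rightarrow> int" where
  "tnorm ts = (\<Sum>(a, k, \<gamma>)\<leftarrow>ts. \<bar>a\<bar>)"

lemma tval_simps [simp]:
  "tval M [] \<epsilon> z = 0"
  "tval M ((a, k, \<gamma>) # ts) \<epsilon> z = of_int a * \<epsilon> ^ k * mon M \<gamma> z + tval M ts \<epsilon> z"
  "tval M (ts @ us) \<epsilon> z = tval M ts \<epsilon> z + tval M us \<epsilon> z"
  by (simp_all add: tval_def)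

lemma tnorm_simps [simp]:
  "tnorm [] = 0" "tnorm ((a, k, \<gamma>) # ts) = \<bar>a\<bar> + tnorm ts" "tnorm (ts @ us) = tnorm ts + tnorm us"
  by (simp_all add: tnorm_def)

lemma tnorm_nonneg: "0 \<le> tnorm ts"
  by (induction ts) auto

lemma mon_add: "mon M (\<lambda>i. \<gamma> i + \<delta> i) z = mon M \<gamma> z * mon M \<delta> z"
  by (simp add: mon_def power_add prod.distrib)

lemma mdeg_add: "mdeg M (\<lambda>i. \<gamma> i + \<delta> i) = mdeg M \<gamma> + mdeg M \<delta>"
  by (simp add: mdeg_def sum.distrib)

definition term_mult :: "int \<Rightarrow> nat \<Rightarrow> (nat \<Rightarrow> nat) \<Rightarrow> term_list \<Rightarrow> term_list" where
  "term_mult a k \<gamma> ts = map (\<lambda>(b, l, \<delta>). (a * b, k + l, \<lambda>i. \<gamma> i + \<delta> i)) ts"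

lemma tval_term_mult:
  "tval M (term_mult a k \<gamma> ts) \<epsilon> z = of_int a * \<epsilon> ^ k * mon M \<gamma> z * tval M ts \<epsilon> z"
  by (induction ts) (auto simp: term_mult_def mon_add power_add algebra_simps)

lemma tnorm_term_mult: "tnorm (term_mult a k \<gamma> ts) = \<bar>a\<bar> * tnorm ts"
  by (induction ts) (auto simp: term_mult_def abs_mult algebra_simps)

text \<open>\<open>PiE\<close> fixes the exponents beyond the first \<open>M\<close>, so a monomial
  has only one exponent vector here and like terms can be collected.\<close>

definition reduced :: "nat \<Rightarrow> (nat \<Rightarrow> nat) set" where
  "reduced M = PiE {..<M} (\<lambda>_. {..4})"

lemma finite_reduced: "finite (reduced M)" and card_reduced: "card (reduced M) = 5 ^ M"
  by (auto simp: reduced_def card_PiE intro!: finite_PiE)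

lemma mon_restrict: "mon M (restrict \<gamma> {..<M}) z = mon M \<gamma> z"
  by (simp add: mon_def)

text \<open>Replacing some z_i^5 by \<open>g i\<close> lowers the total degree by at least one, so
  there are at most \<open>mdeg M \<beta>\<close> rounds, each multiplying the norm by at most
  \<open>S\<close> and adding at most \<open>E\<close> to the power of \<epsilon>. The list is
  chosen before the solution: one rewriting serves all pairs in \<open>Sol\<close>.\<close>

lemma reduce_monomial:
  assumes sol: "\<And>i \<epsilon> z. i < M \<Longrightarrow> (\<epsilon>, z) \<in> Sol \<Longrightarrow> z i ^ 5 = tval M (g i) \<epsilon> z"
    and g: "\<And>i a k \<gamma>. i < M \<Longrightarrow> (a, k, \<gamma>) \<in> set (g i) \<Longrightarrow> k \<le> E \<and> mdeg M \<gamma> \<le> 4"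
    and S: "1 \<le> S" "\<And>i. i < M \<Longrightarrow> tnorm (g i) \<le> S"
  shows "\<exists>ts. (\<forall>(a, k, \<gamma>)\<in>set ts. k \<le> E * mdeg M \<beta> \<and> \<gamma> \<in> reduced M) \<and>
    tnorm ts \<le> S ^ mdeg M \<beta> \<and> (\<forall>(\<epsilon>, z)\<in>Sol. mon M \<beta> z = tval M ts \<epsilon> z)"
proof (induction "mdeg M \<beta>" arbitrary: \<beta> rule: less_induct)
  case less
  show ?case
  proof (cases "\<forall>i<M. \<beta> i \<le> 4")
    case True
    then show ?thesis using S(1)
      by (intro exI[of _ "[(1, 0, restrict \<beta> {..<M})]"]) (auto simp: mon_restrict reduced_def)
  next
    case False
    then obtain i where i: "i < M" "\<beta> i \<ge> 5" by force
    define \<beta>' where "\<beta>' = \<beta>(i := \<beta> i - 5)"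
    have dg: "mdeg M \<beta> = 5 + mdeg M \<beta>'"
      unfolding mdeg_def using i by (simp add: \<beta>'_def sum.remove[of _ i])
    have mn: "mon M \<beta> z = z i ^ 5 * mon M \<beta>' z" for z
      unfolding mon_def using i by (simp add: \<beta>'_def prod.remove[of _ i] flip: power_add)
    \<comment> \<open>The right-hand side \<open>g i\<close> is multiplied by the leftover monomial
      term by term. Each product has degree below that of \<beta>, because 4 < 5, and the outer
      induction reduces it.\<close>
    have aux: "\<exists>us. (\<forall>(a, k, \<gamma>)\<in>set us. k \<le> E * mdeg M \<beta> \<and> \<gamma> \<in> reduced M) \<and>
      tnorm us \<le> tnorm ts * S ^ (mdeg M \<beta> - 1) \<and>
      (\<forall>(\<epsilon>, z)\<in>Sol. tval M ts \<epsilon> z * mon M \<beta>' z = tval M us \<epsilon> z)"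
      if "\<forall>(a, k, \<gamma>)\<in>set ts. k \<le> E \<and> mdeg M \<gamma> \<le> 4" for ts
      using that
    proof (induction ts)
      case Nil
      then show ?case by (intro exI[of _ "[]"]) simp
    next
      case (Cons t ts)
      obtain a k \<gamma> where t: "t = (a, k, \<gamma>)" by (cases t)
      have k: "k \<le> E" "mdeg M \<gamma> \<le> 4" using Cons.prems t by auto
      obtain us where us: "\<forall>(a, k, \<gamma>)\<in>set us. k \<le> E * mdeg M \<beta> \<and> \<gamma> \<in> reduced M"
        "tnorm us \<le> tnorm ts * S ^ (mdeg M \<beta> - 1)"
        "\<forall>(\<epsilon>, z)\<in>Sol. tval M ts \<epsilon> z * mon M \<beta>' z = tval M us \<epsilon> z"
        using Cons.IH Cons.prems by auto
      define \<delta> where "\<delta> = (\<lambda>i. \<gamma> i + \<beta>' i)"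
      have dd: "mdeg M \<delta> \<le> mdeg M \<beta> - 1" "mdeg M \<delta> < mdeg M \<beta>"
        using k dg by (auto simp: \<delta>_def mdeg_add)
      obtain vs where vs: "\<forall>(a, k, \<gamma>)\<in>set vs. k \<le> E * mdeg M \<delta> \<and> \<gamma> \<in> reduced M"
        "tnorm vs \<le> S ^ mdeg M \<delta>" "\<forall>(\<epsilon>, z)\<in>Sol. mon M \<delta> z = tval M vs \<epsilon> z"
        using less.hyps[OF dd(2)] by blast
      define ws where "ws = map (\<lambda>(b, l, \<delta>). (a * b, k + l, \<delta>)) vs"
      have ws: "tval M ws \<epsilon> z = of_int a * \<epsilon> ^ k * tval M vs \<epsilon> z" for \<epsilon> z
        unfolding ws_def by (induction vs) (auto simp: power_add algebra_simps)
      have nws: "tnorm ws = \<bar>a\<bar> * tnorm vs"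
        unfolding ws_def by (induction vs) (auto simp: abs_mult algebra_simps)
      have "tnorm vs \<le> S ^ (mdeg M \<beta> - 1)"
        using vs(2) power_increasing[OF dd(1) S(1)] by linarith
      then have nws': "tnorm ws \<le> \<bar>a\<bar> * S ^ (mdeg M \<beta> - 1)"
        unfolding nws by (intro mult_left_mono) auto
      have "k + l \<le> E * mdeg M \<beta>" if "l \<le> E * mdeg M \<delta>" for l
      proof -
        have "k + l \<le> E * (mdeg M \<delta> + 1)" using k that by simp
        also have "\<dots> \<le> E * mdeg M \<beta>" using dd(2) by (intro mult_le_mono2) simp
        finally show ?thesis .
      qed
      then have "\<forall>(a, k, \<gamma>)\<in>set (ws @ us). k \<le> E * mdeg M \<beta> \<and> \<gamma> \<in> reduced M"
        using us(1) vs(1) unfolding ws_def by fastforce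
      moreover have "tnorm (ws @ us) \<le> tnorm (t # ts) * S ^ (mdeg M \<beta> - 1)"
        using nws' us(2) by (simp add: t algebra_simps)
      moreover have "\<forall>(\<epsilon>, z)\<in>Sol. tval M (t # ts) \<epsilon> z * mon M \<beta>' z = tval M (ws @ us) \<epsilon> z"
      proof (clarify)
        fix \<epsilon> z assume sz: "(\<epsilon>, z) \<in> Sol"
        have "mon M \<gamma> z * mon M \<beta>' z = tval M vs \<epsilon> z"
          using vs(3) sz by (auto simp: \<delta>_def mon_add)
        then show "tval M (t # ts) \<epsilon> z * mon M \<beta>' z = tval M (ws @ us) \<epsilon> z"
          using us(3) sz by (auto simp: t ws algebra_simps)
      qed
      ultimately show ?case by blast
    qed
    obtain us where us: "\<forall>(a, k, \<gamma>)\<in>set us. k \<le> E * mdeg M \<beta> \<and> \<gamma> \<in> reduced M"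
      "tnorm us \<le> tnorm (g i) * S ^ (mdeg M \<beta> - 1)"
      "\<forall>(\<epsilon>, z)\<in>Sol. tval M (g i) \<epsilon> z * mon M \<beta>' z = tval M us \<epsilon> z"
      using aux[of "g i"] g i by fast
    have "tnorm (g i) * S ^ (mdeg M \<beta> - 1) \<le> S * S ^ (mdeg M \<beta> - 1)"
      using S i by (intro mult_right_mono) auto
    also have "\<dots> = S ^ mdeg M \<beta>" using dg by (simp flip: power_Suc)
    finally have "tnorm us \<le> S ^ mdeg M \<beta>" using us(2) by simp
    then show ?thesis using us(1,3) sol[OF i(1)] by (intro exI[of _ us]) (auto simp: mn)
  qed
qed

definition tcoeff :: "term_list \<Rightarrow> (nat \<Rightarrow> nat) \<Rightarrow> nat \<Rightarrow> int" where
  "tcoeff ts \<alpha> e = (\<Sum>(a, k, \<gamma>)\<leftarrow>ts. if k = e \<and> \<gamma> = \<alpha> then a else 0)"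

lemma tcoeff_le: "\<bar>tcoeff ts \<alpha> e\<bar> \<le> tnorm ts"
  by (induction ts) (auto simp: tcoeff_def)

lemma tcoeff_eq_0:
  assumes "\<forall>(a, k, \<gamma>)\<in>set ts. k \<le> E" "E < e"
  shows "tcoeff ts \<alpha> e = 0"
  using assms by (induction ts) (auto simp: tcoeff_def)

lemma tval_eq_sum_tcoeff:
  assumes "finite R" "\<forall>(a, k, \<gamma>)\<in>set ts. k \<le> E \<and> \<gamma> \<in> R"
  shows "tval M ts \<epsilon> z = (\<Sum>\<alpha>\<in>R. \<Sum>e\<le>E. of_int (tcoeff ts \<alpha> e) * \<epsilon> ^ e * mon M \<alpha> z)"
  using assms(2)
proof (induction ts)
  case Nil
  then show ?case by (simp add: tcoeff_def)
next
  case (Cons t ts)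
  obtain a k \<gamma> where t: "t = (a, k, \<gamma>)" by (cases t)
  have k: "k \<le> E" "\<gamma> \<in> R" using Cons.prems t by auto
  have "(\<Sum>\<alpha>\<in>R. \<Sum>e\<le>E. of_int (if k = e \<and> \<gamma> = \<alpha> then a else 0) * \<epsilon> ^ e * mon M \<alpha> z)
      = (\<Sum>\<alpha>\<in>R. \<Sum>e\<le>E. if e = k then if \<alpha> = \<gamma> then of_int a * \<epsilon> ^ k * mon M \<gamma> z else 0 else 0)"
    by (intro sum.cong refl) auto
  also have "\<dots> = of_int a * \<epsilon> ^ k * mon M \<gamma> z" using k assms(1) by simp
  finally have *: "(\<Sum>\<alpha>\<in>R. \<Sum>e\<le>E. of_int (if k = e \<and> \<gamma> = \<alpha> then a else 0) * \<epsilon> ^ e * mon M \<alpha> z)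
    = of_int a * \<epsilon> ^ k * mon M \<gamma> z" .
  have "tcoeff (t # ts) \<alpha> e = (if k = e \<and> \<gamma> = \<alpha> then a else 0) + tcoeff ts \<alpha> e" for \<alpha> e
    by (simp add: tcoeff_def t)
  then show ?case using Cons
    by (simp only: of_int_add distrib_right sum.distrib *) (simp add: t)
qed

text \<open>Writes \<epsilon>^f times a polynomial over a range of exponents that does not depend on
  f, so that all products \<epsilon>^f z_\<tau>^k are expressed in the same coordinates of one
  linear system.\<close>

lemma sum_shift_eq:
  fixes c :: "nat \<Rightarrow> int" and \<epsilon> :: real
  assumes c: "\<And>e. E < e \<Longrightarrow> c e = 0" and f: "f \<le> E"
  shows "(\<Sum>s\<le>2 * E. of_int (if f \<le> s then c (s - f) else 0) * \<epsilon> ^ s)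
    = \<epsilon> ^ f * (\<Sum>e\<le>E. of_int (c e) * \<epsilon> ^ e)"
proof -
  have "\<epsilon> ^ f * (\<Sum>e\<le>E. of_int (c e) * \<epsilon> ^ e) = (\<Sum>e\<le>E. of_int (c e) * \<epsilon> ^ (e + f))"
    by (simp add: sum_distrib_left power_add algebra_simps)
  also have "\<dots> = (\<Sum>s\<in>(\<lambda>e. e + f) ` {..E}. of_int (c (s - f)) * \<epsilon> ^ s)"
    by (simp add: sum.reindex inj_on_def)
  also have "\<dots> = (\<Sum>s\<le>2 * E. of_int (if f \<le> s then c (s - f) else 0) * \<epsilon> ^ s)"
  proof (rule sum.mono_neutral_cong_left)
    show "\<forall>i\<in>{..2 * E} - (\<lambda>e. e + f) ` {..E}.
      real_of_int (if f \<le> i then c (i - f) else 0) * \<epsilon> ^ i = 0"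
    proof
      fix i assume i: "i \<in> {..2 * E} - (\<lambda>e. e + f) ` {..E}"
      show "real_of_int (if f \<le> i then c (i - f) else 0) * \<epsilon> ^ i = 0"
      proof (cases "f \<le> i")
        case True
        then have "i = (i - f) + f" by simp
        then have "\<not> i - f \<le> E" using i by auto
        then show ?thesis using c by simp
      qed simp
    qed
  qed (use f in auto)
  finally show ?thesis by simp
qed

text \<open>The products \<epsilon>^f z_\<tau>^k with k \<le> K and f \<le> 4 K lie in the span of
  the reduced monomials times powers of \<epsilon>, which has less than half as many dimensions.
  Siegel's lemma gives an integer relation valid for every n; its lowest homogeneous part becomes a
  polynomial equation for t.\<close>

lemma limit_root_bound:
  fixes g :: "nat \<Rightarrow> term_list" and S :: int and M \<tau> :: nat
  defines "K \<equiv> 4 * 5 ^ M"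
  assumes sol: "\<And>i n. i < M \<Longrightarrow> z n i ^ 5 = tval M (g i) (\<epsilon> n) (z n)"
    and g: "\<And>i a k \<gamma>. i < M \<Longrightarrow> (a, k, \<gamma>) \<in> set (g i) \<Longrightarrow> k \<le> 4 \<and> mdeg M \<gamma> \<le> 4"
    and S: "1 \<le> S" "\<And>i. i < M \<Longrightarrow> tnorm (g i) \<le> S"
    and \<epsilon>: "\<And>n. 0 < \<epsilon> n" "\<epsilon> \<longlonglongrightarrow> 0" and \<tau>: "\<tau> < M"
    and lim: "(\<lambda>n. z n \<tau> / \<epsilon> n) \<longlonglongrightarrow> t" and t: "0 < t"
  shows "1 / (1 + 2 * real ((K + 1) * (4 * K + 1)) * of_int (S ^ K)) \<le> t"
proof -
  define E where "E = 4 * K"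
  define R where "R = reduced M"
  have finR: "finite R" and cR: "card R = 5 ^ M" by (simp_all add: R_def finite_reduced card_reduced)
  define Sol where "Sol = range (\<lambda>n. (\<epsilon> n, z n))"
  define \<beta> where "\<beta> k = (\<lambda>i. if i = \<tau> then k else 0)" for k :: nat
  have b: "mdeg M (\<beta> k) = k" "mon M (\<beta> k) y = y \<tau> ^ k" for k y
    using \<tau> by (simp_all add: mdeg_def mon_def \<beta>_def if_distrib cong: if_cong)
  define P where "P k us \<longleftrightarrow> (\<forall>(a, l, \<gamma>)\<in>set us. l \<le> 4 * k \<and> \<gamma> \<in> R) \<and>
    tnorm us \<le> S ^ k \<and> (\<forall>(\<epsilon>, z)\<in>Sol. z \<tau> ^ k = tval M us \<epsilon> z)" for k us
  have sol': "y i ^ 5 = tval M (g i) e y" if "i < M" "(e, y) \<in> Sol" for i e y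
    using sol that by (auto simp: Sol_def)
  have "\<exists>us. P k us" for k
    using reduce_monomial[OF sol' g S, where \<beta> = "\<beta> k"] unfolding b P_def R_def by simp
  then have "\<exists>ts. \<forall>k. P k (ts k)" by (intro choice allI)
  then obtain ts where "\<And>k. P k (ts k)" by blast
  then have ts: "\<And>k. \<forall>(a, l, \<gamma>)\<in>set (ts k). l \<le> 4 * k \<and> \<gamma> \<in> R"
    "\<And>k. tnorm (ts k) \<le> S ^ k" "\<And>k. \<forall>(\<epsilon>, z)\<in>Sol. z \<tau> ^ k = tval M (ts k) \<epsilon> z"
    unfolding P_def by simp_all
  have tsE: "\<forall>(a, l, \<gamma>)\<in>set (ts k). l \<le> E \<and> \<gamma> \<in> R" if "k \<le> K" for k
    using ts(1)[of k] that unfolding E_def by fastforce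
  define A where "A = (\<lambda>(\<alpha>, s) (k, f). if f \<le> s then tcoeff (ts k) \<alpha> (s - f) else 0)"
  define I where "I = {..K} \<times> {..E}"
  define J where "J = R \<times> {..2 * E}"
  have cI: "card I = (K + 1) * (4 * K + 1)" by (simp add: I_def E_def)
  \<comment> \<open>Since 5^M = K / 4 there are (K / 4)(8 K + 1) equations for (K + 1)(4 K + 1)
    unknowns; this is the reason for the 4 in K. The powers of \<epsilon> reach 2 E: up to E = 4 K
    from reducing z_\<tau>^k and up to E from the shift f.\<close>
  have "2 * card J \<le> card I"
  proof -
    have "4 * (2 * card J) = 2 * K * (8 * K + 1)"
      using cR by (simp add: J_def E_def K_def card_cartesian_product)
    also have "\<dots> \<le> 4 * card I" unfolding cI by (simp add: algebra_simps)
    finally show ?thesis by simp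
  qed
  moreover have "\<bar>A j i\<bar> \<le> S ^ K" if "j \<in> J" "i \<in> I" for j i
  proof -
    obtain \<alpha> s where j: "j = (\<alpha>, s)" by (cases j)
    obtain k f where i: "i = (k, f)" by (cases i)
    have "S ^ k \<le> S ^ K" using that S(1) by (intro power_increasing) (auto simp: I_def i)
    then show ?thesis using tcoeff_le[of "ts k" \<alpha> "s - f"] ts(2)[of k] S(1) by (auto simp: A_def i j)
  qed
  moreover have "1 \<le> S ^ K" using S(1) by simp
  ultimately obtain q where q: "\<exists>i\<in>I. q i \<noteq> 0" "\<forall>i\<in>I. \<bar>q i\<bar> \<le> 2 * int (card I) * S ^ K"
    "\<forall>j\<in>J. (\<Sum>i\<in>I. A j i * q i) = 0"
    using siegel_pigeonhole[of I J "S ^ K" A] finR by (auto simp: I_def J_def)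
  have rel: "(\<Sum>(k, f)\<in>I. of_int (q (k, f)) * e ^ f * y \<tau> ^ k) = 0" if ey: "(e, y) \<in> Sol" for e y
  proof -
    have "(\<Sum>(k, f)\<in>I. of_int (q (k, f)) * e ^ f * y \<tau> ^ k)
      = (\<Sum>(k, f)\<in>I. \<Sum>\<alpha>\<in>R. \<Sum>s\<le>2 * E.
          of_int (A (\<alpha>, s) (k, f) * q (k, f)) * (e ^ s * mon M \<alpha> y))"
    proof (rule sum.cong[OF refl], clarify)
      fix k f assume "(k, f) \<in> I"
      then have kf: "k \<le> K" "f \<le> E" by (auto simp: I_def)
      have "y \<tau> ^ k = tval M (ts k) e y" using ts(3)[of k] ey by auto
      also have "\<dots> = (\<Sum>\<alpha>\<in>R. \<Sum>l\<le>E. of_int (tcoeff (ts k) \<alpha> l) * e ^ l * mon M \<alpha> y)"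
        by (rule tval_eq_sum_tcoeff[OF finR tsE[OF kf(1)]])
      finally have "y \<tau> ^ k = (\<Sum>\<alpha>\<in>R. \<Sum>l\<le>E. of_int (tcoeff (ts k) \<alpha> l) * e ^ l * mon M \<alpha> y)" .
      then have "of_int (q (k, f)) * e ^ f * y \<tau> ^ k
        = (\<Sum>\<alpha>\<in>R. of_int (q (k, f)) * mon M \<alpha> y *
            (e ^ f * (\<Sum>l\<le>E. of_int (tcoeff (ts k) \<alpha> l) * e ^ l)))"
        by (simp add: sum_distrib_left sum_distrib_right algebra_simps)
      also have "\<dots> = (\<Sum>\<alpha>\<in>R. of_int (q (k, f)) * mon M \<alpha> y *
            (\<Sum>s\<le>2 * E. of_int (A (\<alpha>, s) (k, f)) * e ^ s))"
      proof (intro sum.cong refl arg_cong2[of _ _ _ _ "(*)"])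
        fix \<alpha> assume "\<alpha> \<in> R"
        have "tcoeff (ts k) \<alpha> l = 0" if "E < l" for l
          using tcoeff_eq_0[of "ts k" E l \<alpha>] tsE[OF kf(1)] that by fastforce
        with sum_shift_eq[of E "tcoeff (ts k) \<alpha>" f e] kf(2)
        show "e ^ f * (\<Sum>l\<le>E. of_int (tcoeff (ts k) \<alpha> l) * e ^ l)
          = (\<Sum>s\<le>2 * E. of_int (A (\<alpha>, s) (k, f)) * e ^ s)"
          by (simp add: A_def)
      qed
      finally show "of_int (q (k, f)) * e ^ f * y \<tau> ^ k = (\<Sum>\<alpha>\<in>R. \<Sum>s\<le>2 * E.
          of_int (A (\<alpha>, s) (k, f) * q (k, f)) * (e ^ s * mon M \<alpha> y))"
        by (simp add: sum_distrib_left algebra_simps)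
    qed
    also have "\<dots> = (\<Sum>\<alpha>\<in>R. \<Sum>s\<le>2 * E. \<Sum>(k, f)\<in>I.
          of_int (A (\<alpha>, s) (k, f) * q (k, f)) * (e ^ s * mon M \<alpha> y))"
      unfolding case_prod_unfold
      by (subst sum.swap, intro sum.cong refl, rule sum.swap)
    also have "\<dots> = (\<Sum>\<alpha>\<in>R. \<Sum>s\<le>2 * E. of_int (\<Sum>i\<in>I. A (\<alpha>, s) i * q i) * (e ^ s * mon M \<alpha> y))"
      unfolding case_prod_unfold by (simp add: sum_distrib_right)
    also have "\<dots> = 0" using q(3) by (simp add: J_def)
    finally show ?thesis .
  qed
  \<comment> \<open>The lowest total degree in the relation. After substituting z n \<tau> =
    \<epsilon> n * T n and dividing by \<epsilon>^s, only the terms with f + k = s remain in the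
    limit. Among these each k occurs with a single f, so nothing cancels.\<close>
  define s where "s = (LEAST s. \<exists>(k, f)\<in>I. f + k = s \<and> q (k, f) \<noteq> 0)"
  have exs: "\<exists>s. \<exists>(k, f)\<in>I. f + k = s \<and> q (k, f) \<noteq> 0" using q(1) by auto
  have s: "\<exists>(k, f)\<in>I. f + k = s \<and> q (k, f) \<noteq> 0"
    unfolding s_def using exs by (rule LeastI_ex)
  have s_least: "q (k, f) = 0" if "(k, f) \<in> I" "f + k < s" for k f
    using not_less_Least[of "f + k" "\<lambda>s. \<exists>(k, f)\<in>I. f + k = s \<and> q (k, f) \<noteq> 0"] that
    unfolding s_def by auto
  define T where "T n = z n \<tau> / \<epsilon> n" for n
  have Z: "z n \<tau> = \<epsilon> n * T n" for n using \<epsilon>(1)[of n] by (simp add: T_def)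
  have zero: "(\<Sum>(k, f)\<in>I. of_int (q (k, f)) * \<epsilon> n ^ (f + k - s) * T n ^ k) = 0" for n
  proof -
    have "\<epsilon> n ^ s * (\<Sum>(k, f)\<in>I. of_int (q (k, f)) * \<epsilon> n ^ (f + k - s) * T n ^ k)
      = (\<Sum>(k, f)\<in>I. of_int (q (k, f)) * \<epsilon> n ^ f * z n \<tau> ^ k)"
      unfolding sum_distrib_left
    proof (rule sum.cong[OF refl], clarify)
      fix k f assume kf: "(k, f) \<in> I"
      show "\<epsilon> n ^ s * (of_int (q (k, f)) * \<epsilon> n ^ (f + k - s) * T n ^ k)
        = of_int (q (k, f)) * \<epsilon> n ^ f * z n \<tau> ^ k"
      proof (cases "f + k < s")
        case True
        then show ?thesis using s_least[OF kf] by simp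
      next
        case False
        then have "\<epsilon> n ^ s * \<epsilon> n ^ (f + k - s) = \<epsilon> n ^ f * \<epsilon> n ^ k"
          by (simp flip: power_add)
        then show ?thesis by (simp add: Z power_mult_distrib algebra_simps)
      qed
    qed
    also have "\<dots> = 0" by (rule rel) (simp add: Sol_def)
    finally show ?thesis using \<epsilon>(1)[of n] by simp
  qed
  have "(\<lambda>n. \<Sum>(k, f)\<in>I. of_int (q (k, f)) * \<epsilon> n ^ (f + k - s) * T n ^ k)
    \<longlonglongrightarrow> (\<Sum>(k, f)\<in>I. of_int (q (k, f)) * 0 ^ (f + k - s) * t ^ k)"
    unfolding case_prod_unfold using lim \<epsilon>(2)
    by (auto intro!: tendsto_intros simp: T_def[abs_def])
  then have "(\<Sum>(k, f)\<in>I. of_int (q (k, f)) * 0 ^ (f + k - s) * t ^ k) = 0"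
    by (simp add: zero LIMSEQ_const_iff)
  \<comment> \<open>By truncated subtraction the terms with f + k < s carry the factor 0^0 = 1 as
    well; they vanish because \<open>q\<close> is 0 there.\<close>
  moreover have "(\<Sum>(k, f)\<in>I. of_int (q (k, f)) * 0 ^ (f + k - s) * t ^ k)
    = (\<Sum>(k, f)\<in>I. if f + k = s then of_int (q (k, f)) * t ^ k else 0)"
    using s_least by (intro sum.cong refl) (auto simp: power_0_left dest: le_neq_implies_less)
  moreover have "\<dots> = (\<Sum>k\<le>K. of_int (if k \<le> s \<and> s - k \<le> E then q (k, s - k) else 0) * t ^ k)"
  proof -
    have "(\<Sum>(k, f)\<in>I. if f + k = s then of_int (q (k, f)) * t ^ k else 0)
      = (\<Sum>k\<le>K. \<Sum>f\<le>E. if f + k = s then of_int (q (k, f)) * t ^ k else 0)"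
      unfolding I_def by (rule sum.cartesian_product[symmetric])
    also have "\<dots> = (\<Sum>k\<le>K. \<Sum>f\<le>E. if f = s - k then
        (if k \<le> s then of_int (q (k, s - k)) * t ^ k else 0) else 0)"
      by (intro sum.cong refl) auto
    also have "\<dots> = (\<Sum>k\<le>K. of_int (if k \<le> s \<and> s - k \<le> E then q (k, s - k) else 0) * t ^ k)"
      by (intro sum.cong refl) auto
    finally show ?thesis .
  qed
  ultimately have root: "(\<Sum>k\<le>K. of_int (if k \<le> s \<and> s - k \<le> E then q (k, s - k) else 0) * t ^ k) = 0"
    by simp
  have "1 / (1 + of_int (2 * int (card I) * S ^ K)) \<le> t"
  proof (rule int_poly_root_lower_bound[OF root _ _ t])
    obtain k f where "(k, f) \<in> I" "f + k = s" "q (k, f) \<noteq> 0" using s by auto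
    then show "\<exists>k\<le>K. (if k \<le> s \<and> s - k \<le> E then q (k, s - k) else 0) \<noteq> 0"
      by (intro exI[of _ k]) (auto simp: I_def)
    fix k assume "k \<le> K"
    have "\<bar>q (k, s - k)\<bar> \<le> 2 * int (card I) * S ^ K" if "s - k \<le> E"
      using q(2) \<open>k \<le> K\<close> that by (auto simp: I_def)
    moreover have "0 \<le> 2 * int (card I) * S ^ K" using S(1) by simp
    ultimately have "\<bar>if k \<le> s \<and> s - k \<le> E then q (k, s - k) else 0\<bar> \<le> 2 * int (card I) * S ^ K"
      by auto
    then show "\<bar>real_of_int (if k \<le> s \<and> s - k \<le> E then q (k, s - k) else 0)\<bar>
      \<le> real_of_int (2 * int (card I) * S ^ K)"
      unfolding of_int_abs[symmetric] of_int_le_iff .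
  qed
  then show ?thesis by (simp add: cI mult.assoc)
qed

section \<open>Degree and norm bounds for integer polynomial functions, by closure rules\<close>

definition int_poly_fun :: "nat \<Rightarrow> nat \<Rightarrow> nat \<Rightarrow> int \<Rightarrow> (real \<Rightarrow> (nat \<Rightarrow> real) \<Rightarrow> real) \<Rightarrow> bool" where
  "int_poly_fun M d e N F \<longleftrightarrow> (\<exists>ts. (\<forall>(a, k, \<gamma>)\<in>set ts. k \<le> e \<and> mdeg M \<gamma> \<le> d) \<and>
    tnorm ts \<le> N \<and> (\<forall>\<epsilon> z. F \<epsilon> z = tval M ts \<epsilon> z))"

lemma int_poly_funI:
  assumes "\<And>a k \<gamma>. (a, k, \<gamma>) \<in> set ts \<Longrightarrow> k \<le> e \<and> mdeg M \<gamma> \<le> d" "tnorm ts \<le> N"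
    "\<And>\<epsilon> z. F \<epsilon> z = tval M ts \<epsilon> z"
  shows "int_poly_fun M d e N F"
  unfolding int_poly_fun_def using assms by (intro exI[of _ ts]) auto

lemma int_poly_funE:
  assumes "int_poly_fun M d e N F"
  obtains ts where "\<And>a k \<gamma>. (a, k, \<gamma>) \<in> set ts \<Longrightarrow> k \<le> e \<and> mdeg M \<gamma> \<le> d" "tnorm ts \<le> N"
    "\<And>\<epsilon> z. F \<epsilon> z = tval M ts \<epsilon> z"
  using assms unfolding int_poly_fun_def by fast

lemma int_poly_fun_mono:
  assumes "int_poly_fun M d e N F" "d \<le> d'" "e \<le> e'" "N \<le> N'"
  shows "int_poly_fun M d' e' N' F"
proof -
  obtain ts where "\<And>a k \<gamma>. (a, k, \<gamma>) \<in> set ts \<Longrightarrow> k \<le> e \<and> mdeg M \<gamma> \<le> d" "tnorm ts \<le> N"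
    "\<And>\<epsilon> z. F \<epsilon> z = tval M ts \<epsilon> z"
    using assms(1) by (rule int_poly_funE) blast
  then show ?thesis using assms(2-) by (intro int_poly_funI[of ts]) fastforce+
qed

lemma int_poly_fun_const: "int_poly_fun M 0 0 \<bar>c\<bar> (\<lambda>_ _. of_int c)"
  by (intro int_poly_funI[of "[(c, 0, \<lambda>_. 0)]"]) (auto simp: mon_def mdeg_def)

lemma int_poly_fun_eps: "int_poly_fun M 0 1 1 (\<lambda>\<epsilon> _. \<epsilon>)"
  by (intro int_poly_funI[of "[(1, 1, \<lambda>_. 0)]"]) (auto simp: mon_def mdeg_def)

lemma int_poly_fun_var: "i < M \<Longrightarrow> int_poly_fun M 1 0 1 (\<lambda>_ z. z i)"
  by (intro int_poly_funI[of "[(1, 0, \<lambda>j. if j = i then 1 else 0)]"])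
    (auto simp: mon_def mdeg_def if_distrib cong: if_cong)

lemma int_poly_fun_add:
  assumes "int_poly_fun M d e N F" "int_poly_fun M d e N' G"
  shows "int_poly_fun M d e (N + N') (\<lambda>\<epsilon> z. F \<epsilon> z + G \<epsilon> z)"
proof -
  obtain ts where ts: "\<And>a k \<gamma>. (a, k, \<gamma>) \<in> set ts \<Longrightarrow> k \<le> e \<and> mdeg M \<gamma> \<le> d" "tnorm ts \<le> N"
    "\<And>\<epsilon> z. F \<epsilon> z = tval M ts \<epsilon> z"
    using assms(1) by (rule int_poly_funE) blast
  obtain us where us: "\<And>a k \<gamma>. (a, k, \<gamma>) \<in> set us \<Longrightarrow> k \<le> e \<and> mdeg M \<gamma> \<le> d" "tnorm us \<le> N'"
    "\<And>\<epsilon> z. G \<epsilon> z = tval M us \<epsilon> z"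
    using assms(2) by (rule int_poly_funE) blast
  show ?thesis using ts us by (intro int_poly_funI[of "ts @ us"]) auto
qed

lemma int_poly_fun_mult:
  assumes "int_poly_fun M d e N F" "int_poly_fun M d' e' N' G"
  shows "int_poly_fun M (d + d') (e + e') (N * N') (\<lambda>\<epsilon> z. F \<epsilon> z * G \<epsilon> z)"
proof -
  obtain ts where ts: "\<And>a k \<gamma>. (a, k, \<gamma>) \<in> set ts \<Longrightarrow> k \<le> e \<and> mdeg M \<gamma> \<le> d" "tnorm ts \<le> N"
    "\<And>\<epsilon> z. F \<epsilon> z = tval M ts \<epsilon> z"
    using assms(1) by (rule int_poly_funE) blast
  obtain us where us: "\<And>a k \<gamma>. (a, k, \<gamma>) \<in> set us \<Longrightarrow> k \<le> e' \<and> mdeg M \<gamma> \<le> d'" "tnorm us \<le> N'"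
    "\<And>\<epsilon> z. G \<epsilon> z = tval M us \<epsilon> z"
    using assms(2) by (rule int_poly_funE) blast
  have "int_poly_fun M (d + d') (e + e') (tnorm ts * tnorm us) (\<lambda>\<epsilon> z. tval M ts \<epsilon> z * tval M us \<epsilon> z)"
    using ts(1)
  proof (induction ts)
    case Nil
    then show ?case by (intro int_poly_funI[of "[]"]) auto
  next
    case (Cons t ts)
    obtain a k \<gamma> where t: "t = (a, k, \<gamma>)" by (cases t)
    have k: "k \<le> e" "mdeg M \<gamma> \<le> d" using Cons.prems[of a k \<gamma>] t by auto
    have "int_poly_fun M (d + d') (e + e') (tnorm (term_mult a k \<gamma> us)) (tval M (term_mult a k \<gamma> us))"
    proof (intro int_poly_funI[of "term_mult a k \<gamma> us"])
      fix b l \<delta> assume "(b, l, \<delta>) \<in> set (term_mult a k \<gamma> us)"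
      then obtain b' l' \<delta>' where "(b', l', \<delta>') \<in> set us" "l = k + l'" "\<delta> = (\<lambda>i. \<gamma> i + \<delta>' i)"
        unfolding term_mult_def by auto
      then show "l \<le> e + e' \<and> mdeg M \<delta> \<le> d + d'" using k us(1)[of b' l' \<delta>'] by (auto simp: mdeg_add)
    qed auto
    moreover have "int_poly_fun M (d + d') (e + e') (tnorm ts * tnorm us)
        (\<lambda>\<epsilon> z. tval M ts \<epsilon> z * tval M us \<epsilon> z)"
      using Cons.prems by (intro Cons.IH) auto
    ultimately have "int_poly_fun M (d + d') (e + e')
        (tnorm (term_mult a k \<gamma> us) + tnorm ts * tnorm us)
        (\<lambda>\<epsilon> z. tval M (term_mult a k \<gamma> us) \<epsilon> z + tval M ts \<epsilon> z * tval M us \<epsilon> z)"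
      by (rule int_poly_fun_add)
    then show ?case by (simp add: t tval_term_mult tnorm_term_mult algebra_simps)
  qed
  moreover have "tnorm ts * tnorm us \<le> N * N'"
    using ts(2) us(2) tnorm_nonneg[of ts] tnorm_nonneg[of us] by (intro mult_mono) auto
  ultimately show ?thesis unfolding ts(3) us(3) by (auto intro: int_poly_fun_mono)
qed

lemma int_poly_fun_uminus:
  assumes "int_poly_fun M d e N F"
  shows "int_poly_fun M d e N (\<lambda>\<epsilon> z. - F \<epsilon> z)"
  using int_poly_fun_mult[OF int_poly_fun_const[of M "-1"] assms] by simp

lemma int_poly_fun_diff:
  assumes "int_poly_fun M d e N F" "int_poly_fun M d e N' G"
  shows "int_poly_fun M d e (N + N') (\<lambda>\<epsilon> z. F \<epsilon> z - G \<epsilon> z)"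
  using int_poly_fun_add[OF assms(1) int_poly_fun_uminus[OF assms(2)]] by simp

lemma int_poly_fun_sum:
  assumes "finite J" "\<And>j. j \<in> J \<Longrightarrow> int_poly_fun M d e N (F j)"
  shows "int_poly_fun M d e (int (card J) * N) (\<lambda>\<epsilon> z. \<Sum>j\<in>J. F j \<epsilon> z)"
  using assms
proof (induction J rule: finite_induct)
  case empty
  then show ?case by (auto intro!: int_poly_funI[of "[]"])
next
  case (insert x J)
  then have "int_poly_fun M d e (N + int (card J) * N) (\<lambda>\<epsilon> z. F x \<epsilon> z + (\<Sum>j\<in>J. F j \<epsilon> z))"
    by (intro int_poly_fun_add) auto
  then show ?case using insert.hyps by (simp add: algebra_simps)
qed

lemma mon_cong: "(\<And>i. i < M \<Longrightarrow> y i = z i) \<Longrightarrow> mon M \<gamma> y = mon M \<gamma> z"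
  by (simp add: mon_def)

lemma tval_cong: "(\<And>i. i < M \<Longrightarrow> y i = z i) \<Longrightarrow> tval M ts \<epsilon> y = tval M ts \<epsilon> z"
  using mon_cong[of M y z] by (induction ts) auto

lemma int_poly_fun_cong:
  assumes "int_poly_fun M d e N F" "\<And>i. i < M \<Longrightarrow> y i = z i"
  shows "F \<epsilon> y = F \<epsilon> z"
proof -
  obtain ts where "\<And>\<epsilon> z. F \<epsilon> z = tval M ts \<epsilon> z" using assms(1) by (rule int_poly_funE) blast
  then show ?thesis using tval_cong[of M y z ts \<epsilon>] assms(2) by simp
qed

lemma int_poly_fun_Suc:
  assumes "int_poly_fun M d e N F"
  shows "int_poly_fun (Suc M) d e N F"
proof -
  obtain ts where ts: "\<And>a k \<gamma>. (a, k, \<gamma>) \<in> set ts \<Longrightarrow> k \<le> e \<and> mdeg M \<gamma> \<le> d" "tnorm ts \<le> N"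
    "\<And>\<epsilon> z. F \<epsilon> z = tval M ts \<epsilon> z"
    using assms(1) by (rule int_poly_funE) blast
  \<comment> \<open>In \<open>M\<close> variables the exponent at index \<open>M\<close> is
    arbitrary; it must be reset before \<open>M\<close> becomes a variable, which will be the
    margin.\<close>
  define us where "us = map (\<lambda>(a, k, \<gamma>). (a, k, \<gamma>(M := 0))) ts"
  have "mdeg (Suc M) (\<gamma>(M := 0)) = mdeg M \<gamma>" for \<gamma> by (simp add: mdeg_def)
  moreover have "mon (Suc M) (\<gamma>(M := 0)) z = mon M \<gamma> z" for \<gamma> z by (simp add: mon_def)
  then have "tval (Suc M) us \<epsilon> z = tval M ts \<epsilon> z" for \<epsilon> z
    unfolding us_def by (induction ts) auto
  moreover have "tnorm us = tnorm ts" unfolding us_def by (induction ts) auto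
  ultimately show ?thesis using ts by (intro int_poly_funI[of us]) (auto simp: us_def)
qed

lemma continuous_on_int_poly_fun:
  assumes "int_poly_fun M d e N F"
  shows "continuous_on A (F \<epsilon>)"
proof -
  obtain ts where ts: "\<And>\<epsilon> z. F \<epsilon> z = tval M ts \<epsilon> z"
    using assms(1) by (rule int_poly_funE) blast
  have m: "continuous_on A (mon M \<gamma>)" for \<gamma>
    unfolding mon_def
    by (intro continuous_intros continuous_on_subset[OF continuous_on_product_coordinates]) auto
  have "continuous_on A (tval M ts \<epsilon>)"
  proof (induction ts)
    case (Cons t ts)
    obtain a k \<gamma> where t: "t = (a, k, \<gamma>)" by (cases t)
    show ?case unfolding t tval_simps by (intro continuous_intros m Cons)
  qed simp
  then show ?thesis by (simp add: ts)
qed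

lemma mon_has_derivative:
  assumes "i < M"
  shows "((\<lambda>h. mon M \<gamma> (z(i := h))) has_real_derivative
    of_nat (\<gamma> i) * mon M (\<gamma>(i := \<gamma> i - 1)) z) (at (z i))"
proof -
  define P where "P = (\<Prod>j\<in>{..<M} - {i}. z j ^ \<gamma> j)"
  have "mon M \<gamma> (z(i := h)) = h ^ \<gamma> i * P" for h
    using assms by (simp add: mon_def P_def prod.remove[of _ i])
  moreover have "mon M (\<gamma>(i := \<gamma> i - 1)) z = z i ^ (\<gamma> i - 1) * P"
    using assms by (simp add: mon_def P_def prod.remove[of _ i])
  ultimately show ?thesis by (auto intro!: derivative_eq_intros)
qed

lemma int_poly_fun_deriv:
  assumes "int_poly_fun M d e N F" "i < M"
  obtains F' where "int_poly_fun M (d - 1) e (int d * N) F'"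
    "\<And>\<epsilon> z. ((\<lambda>h. F \<epsilon> (z(i := h))) has_real_derivative F' \<epsilon> z) (at (z i))"
proof -
  obtain ts where ts: "\<And>a k \<gamma>. (a, k, \<gamma>) \<in> set ts \<Longrightarrow> k \<le> e \<and> mdeg M \<gamma> \<le> d" "tnorm ts \<le> N"
    "\<And>\<epsilon> z. F \<epsilon> z = tval M ts \<epsilon> z"
    using assms(1) by (rule int_poly_funE) blast
  \<comment> \<open>If \<gamma> i = 0 the coefficient of the differentiated term is 0 and any
    monomial would do; the constant one keeps the degree bound \<open>d - 1\<close>.\<close>
  define D where "D \<gamma> = (if \<gamma> i = 0 then (\<lambda>_. 0) else \<gamma>(i := \<gamma> i - 1))" for \<gamma> :: "nat \<Rightarrow> nat"
  define us where "us = map (\<lambda>(a, k, \<gamma>). (a * int (\<gamma> i), k, D \<gamma>)) ts"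
  have le: "\<gamma> i \<le> mdeg M \<gamma>" for \<gamma> using assms(2) by (simp add: mdeg_def member_le_sum)
  have dD: "mdeg M (D \<gamma>) \<le> mdeg M \<gamma> - 1" for \<gamma>
  proof (cases "\<gamma> i = 0")
    case True
    then show ?thesis by (simp add: D_def mdeg_def)
  next
    case False
    then show ?thesis using assms(2) by (simp add: D_def mdeg_def sum.remove[of _ i])
  qed
  have "((\<lambda>h. tval M ts \<epsilon> (z(i := h))) has_real_derivative tval M us \<epsilon> z) (at (z i))" for \<epsilon> z
    unfolding us_def
  proof (induction ts)
    case (Cons t ts)
    obtain a k \<gamma> where t: "t = (a, k, \<gamma>)" by (cases t)
    have "of_nat (\<gamma> i) * mon M (\<gamma>(i := \<gamma> i - 1)) z = of_nat (\<gamma> i) * mon M (D \<gamma>) z"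
      by (simp add: D_def)
    with mon_has_derivative[OF assms(2), of \<gamma> z]
    have "((\<lambda>h. mon M \<gamma> (z(i := h))) has_real_derivative of_nat (\<gamma> i) * mon M (D \<gamma>) z) (at (z i))"
      by (simp only:)
    from DERIV_add[OF DERIV_cmult[OF this, of "of_int a * \<epsilon> ^ k"] Cons] show ?case
      by (simp add: t algebra_simps del: fun_upd_apply)
  qed simp
  moreover have "int_poly_fun M (d - 1) e (int d * N) (tval M us)"
  proof (rule int_poly_funI[of us])
    fix a k \<gamma> assume "(a, k, \<gamma>) \<in> set us"
    then obtain b \<delta> where *: "(b, k, \<delta>) \<in> set ts" "\<gamma> = D \<delta>" unfolding us_def by auto
    then show "k \<le> e \<and> mdeg M \<gamma> \<le> d - 1"
      using ts(1)[OF *(1)] dD[of \<delta>] by (auto intro: order_trans)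
  next
    have "tnorm us \<le> int d * tnorm ts" using ts(1) unfolding us_def
    proof (induction ts)
      case (Cons t ts)
      obtain a k \<gamma> where t: "t = (a, k, \<gamma>)" by (cases t)
      have "\<gamma> i \<le> d" using Cons.prems[of a k \<gamma>] le[of \<gamma>] by (auto simp: t)
      then have "\<bar>a\<bar> * int (\<gamma> i) \<le> \<bar>a\<bar> * int d" by (intro mult_left_mono) auto
      moreover have "tnorm (map (\<lambda>(a, k, \<gamma>). (a * int (\<gamma> i), k, D \<gamma>)) ts) \<le> int d * tnorm ts"
        using Cons.prems by (intro Cons.IH) auto
      ultimately show ?case by (simp add: t abs_mult algebra_simps)
    qed simp
    also have "\<dots> \<le> int d * N" using ts(2) by (intro mult_left_mono) auto
    finally show "tnorm us \<le> int d * N" .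
  qed simp
  ultimately show thesis using that[of "tval M us"] by (simp add: ts(3))
qed

text \<open>Degree at most 3 lets \<open>\<epsilon>\<^sup>3\<close> clear the denominators after substituting \<open>y = z / \<epsilon>\<close>.\<close>

lemma int_poly_fun_rescale:
  assumes "int_poly_fun M 3 1 S F"
  obtains ts where "\<And>a k \<gamma>. (a, k, \<gamma>) \<in> set ts \<Longrightarrow> k \<le> 4 \<and> mdeg M \<gamma> \<le> 4" "tnorm ts \<le> S"
    "\<And>\<epsilon> y. \<epsilon> ^ 3 * F \<epsilon> y = tval M ts \<epsilon> (\<lambda>i. \<epsilon> * y i)"
proof -
  obtain ts where ts: "\<And>a k \<gamma>. (a, k, \<gamma>) \<in> set ts \<Longrightarrow> k \<le> 1 \<and> mdeg M \<gamma> \<le> 3" "tnorm ts \<le> S"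
    "\<And>\<epsilon> z. F \<epsilon> z = tval M ts \<epsilon> z"
    using assms(1) by (rule int_poly_funE) blast
  define us where "us = map (\<lambda>(a, k, \<gamma>). (a, k + (3 - mdeg M \<gamma>), \<gamma>)) ts"
  have "mon M \<gamma> (\<lambda>i. \<epsilon> * y i) = \<epsilon> ^ mdeg M \<gamma> * mon M \<gamma> y" for \<gamma> \<epsilon> y
    by (simp add: mon_def mdeg_def power_mult_distrib prod.distrib power_sum)
  note m = this
  have "\<epsilon> ^ 3 * tval M ts \<epsilon> y = tval M us \<epsilon> (\<lambda>i. \<epsilon> * y i)" for \<epsilon> y
    using ts(1) unfolding us_def
  proof (induction ts)
    case (Cons t ts)
    obtain a k \<gamma> where t: "t = (a, k, \<gamma>)" by (cases t)
    have "mdeg M \<gamma> \<le> 3" using Cons.prems[of a k \<gamma>] by (auto simp: t)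
    then have "\<epsilon> ^ 3 = \<epsilon> ^ (3 - mdeg M \<gamma>) * \<epsilon> ^ mdeg M \<gamma>" by (simp flip: power_add)
    then have "\<epsilon> ^ 3 * (of_int a * \<epsilon> ^ k * mon M \<gamma> y)
      = of_int a * \<epsilon> ^ (k + (3 - mdeg M \<gamma>)) * mon M \<gamma> (\<lambda>i. \<epsilon> * y i)"
      by (simp add: m power_add)
    moreover have "\<epsilon> ^ 3 * tval M ts \<epsilon> y
      = tval M (map (\<lambda>(a, k, \<gamma>). (a, k + (3 - mdeg M \<gamma>), \<gamma>)) ts) \<epsilon> (\<lambda>i. \<epsilon> * y i)"
      using Cons.prems by (intro Cons.IH) auto
    ultimately show ?case by (simp only: t tval_simps list.map prod.case distrib_left)
  qed simp
  moreover have "tnorm us = tnorm ts" unfolding us_def by (induction ts) auto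
  moreover have "k \<le> 4 \<and> mdeg M \<gamma> \<le> 4" if "(a, k, \<gamma>) \<in> set us" for a k \<gamma>
    using that ts(1) unfolding us_def by fastforce
  ultimately show thesis using that[of us] ts(2) by (simp add: ts(3))
qed

text \<open>Squaring removes the kink of the hinge, so the penalty has a vanishing gradient at its
  minimizers even where a constraint is just becoming active.\<close>

lemma has_real_derivative_max_0_square:
  assumes "(f has_real_derivative f') (at x)"
  shows "((\<lambda>h. (max 0 (f h))\<^sup>2) has_real_derivative 2 * max 0 (f x) * f') (at x)"
proof -
  have "((\<lambda>v. (max 0 v)\<^sup>2) has_real_derivative 2 * max 0 u) (at u)" for u :: real
  proof (cases u "0 :: real" rule: linorder_cases)
    case less
    have "eventually (\<lambda>v. v < 0) (nhds u)" using eventually_nhds_in_open[of "{..<0}" u] less by simp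
    then have "eventually (\<lambda>v. (max 0 v)\<^sup>2 = (0 :: real)) (nhds u)" by eventually_elim auto
    from DERIV_cong_ev[OF refl this refl] show ?thesis using less by simp
  next
    case greater
    have "eventually (\<lambda>v. v > 0) (nhds u)" using eventually_nhds_in_open[of "{0<..}" u] greater by simp
    then have "eventually (\<lambda>v. (max 0 v)\<^sup>2 = v\<^sup>2) (nhds u)" by eventually_elim auto
    from DERIV_cong_ev[OF refl this refl] show ?thesis using greater
      by (auto intro!: derivative_eq_intros)
  next
    case equal
    have "(\<lambda>h. (max 0 h)\<^sup>2 / h) \<midarrow>0\<rightarrow> (0 :: real)"
    proof (rule Lim_null_comparison)
      show "eventually (\<lambda>h. norm ((max 0 h)\<^sup>2 / h) \<le> \<bar>h\<bar>) (at (0 :: real))"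
        by (intro always_eventually) (auto simp: max_def power2_eq_square)
      show "((\<lambda>h. \<bar>h\<bar>) \<longlongrightarrow> 0) (at (0 :: real))" by (auto intro!: tendsto_eq_intros)
    qed
    then show ?thesis using equal by (simp add: DERIV_def)
  qed
  from DERIV_chain2[OF this assms] show ?thesis by simp
qed

section \<open>The margin of a system of quadratic inequalities\<close>

text \<open>Coordinate \<open>M\<close> is the claimed margin, and a hinge punishes a claim above
  the value of a constraint. The weights 1, \<epsilon>, \<epsilon>^2 of hinges, reward and sextic
  term make the claim converge to the supremum of the margin. Six is the least even exponent above
  the degree 4 of the squared hinges; 1/6 cancels on differentiation, and \<epsilon>^2 matches the
  degree gap 5 - 3, so that rescaling makes the equations monic.\<close>

definition penalty :: "nat \<Rightarrow> 'j set \<Rightarrow> ('j \<Rightarrow> (nat \<Rightarrow> real) \<Rightarrow> real) \<Rightarrow> real \<Rightarrow> (nat \<Rightarrow> real) \<Rightarrow> real" where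
  "penalty M J s \<epsilon> y = (\<Sum>j\<in>J. (max 0 (y M - s j y))\<^sup>2) - \<epsilon> * y M + \<epsilon>\<^sup>2 / 6 * (\<Sum>i\<le>M. y i ^ 6)"

text \<open>Half of the sextic coefficient 1/6 pays for the reward; the other half remains for
  coercivity. From u = 12 / \<epsilon> + 1 on the sextic term wins, and before that \<epsilon> u is
  below 12 + \<epsilon>.\<close>

lemma sextic_minus_linear_lower_bound:
  fixes \<epsilon> u :: real
  assumes "0 < \<epsilon>"
  shows "- (12 + \<epsilon>) \<le> \<epsilon>\<^sup>2 / 12 * u ^ 6 - \<epsilon> * u"
proof -
  have nn: "0 \<le> \<epsilon>\<^sup>2 / 12 * u ^ 6" by simp
  consider "u \<le> 0" | "0 < u" "u < 12 / \<epsilon> + 1" | "12 / \<epsilon> + 1 \<le> u" by linarith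
  then show ?thesis
  proof cases
    case 1
    then have "\<epsilon> * u \<le> 0" using assms by (simp add: mult_nonneg_nonpos)
    then show ?thesis using nn assms by linarith
  next
    case 2
    have "\<epsilon> * u \<le> \<epsilon> * (12 / \<epsilon> + 1)" using 2 assms by (intro mult_left_mono) auto
    also have "\<dots> = 12 + \<epsilon>" using assms by (simp add: field_simps)
    finally show ?thesis using nn by linarith
  next
    case 3
    have u1: "1 \<le> u" using 3 assms by (smt (verit) divide_pos_pos)
    then have "u ^ 1 \<le> u ^ 5" by (intro power_increasing) auto
    then have "12 / \<epsilon> \<le> u ^ 5" using 3 by simp
    then have "12 \<le> \<epsilon> * u ^ 5" using assms by (simp add: field_simps)
    then have "\<epsilon> * u * 12 \<le> \<epsilon> * u * (\<epsilon> * u ^ 5)" using u1 assms by (intro mult_left_mono) auto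
    then have "\<epsilon> * u \<le> \<epsilon>\<^sup>2 / 12 * u ^ 6" by (simp add: power2_eq_square eval_nat_numeral algebra_simps)
    then show ?thesis using assms by linarith
  qed
qed

lemma penalty_minimizer:
  fixes s :: "'j \<Rightarrow> (nat \<Rightarrow> real) \<Rightarrow> real"
  assumes J: "finite J" and s: "\<And>j. j \<in> J \<Longrightarrow> int_poly_fun M 2 0 N (\<lambda>_. s j)" and \<epsilon>: "0 < \<epsilon>"
  obtains y where "\<And>w. penalty M J s \<epsilon> y \<le> penalty M J s \<epsilon> w"
proof -
  define \<Phi> where "\<Phi> = penalty M J s \<epsilon>"
  have cong: "\<Phi> w = \<Phi> w'" if "\<And>i. i \<le> M \<Longrightarrow> w i = w' i" for w w'
  proof -
    have "s j w = s j w'" if "j \<in> J" for j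
      using int_poly_fun_cong[OF s[OF that], of w w'] \<open>\<And>i. i \<le> M \<Longrightarrow> w i = w' i\<close> by simp
    moreover have "(\<Sum>i\<le>M. w i ^ 6) = (\<Sum>i\<le>M. w' i ^ 6)" using that by (intro sum.cong) auto
    ultimately show ?thesis using that[of M] by (simp add: \<Phi>_def penalty_def)
  qed
  have cont: "continuous_on A \<Phi>" for A
    unfolding \<Phi>_def penalty_def
    by (intro continuous_intros continuous_on_subset[OF continuous_on_product_coordinates]
        continuous_on_int_poly_fun[OF s]) auto
  define \<phi> where "\<phi> = \<Phi> (\<lambda>_. 0)"
  have \<phi>0: "0 \<le> \<phi>" by (simp add: \<phi>_def \<Phi>_def penalty_def sum_nonneg)
  \<comment> \<open>Chosen so that \<epsilon>^2 / 12 * R \<ge> \<phi> + 13 + \<epsilon>, which beats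
    the value \<phi> at 0 by 1 after the possible loss 12 + \<epsilon>. The summand 1 gives R \<ge>
    1, so |w i| > R implies w i ^ 6 \<ge> R.\<close>
  define R where "R = 1 + 12 / \<epsilon>\<^sup>2 * (\<phi> + 13 + \<epsilon>)"
  have R: "1 \<le> R" using \<phi>0 \<epsilon> by (simp add: R_def)
  have far: "\<phi> < \<Phi> w" if "i \<le> M" "R < \<bar>w i\<bar>" for w i
  proof -
    have "R ^ 1 \<le> \<bar>w i\<bar> ^ 1" using that by simp
    also have "\<dots> \<le> \<bar>w i\<bar> ^ 6" using that R by (intro power_increasing) auto
    finally have "R \<le> w i ^ 6" by (simp add: power_even_abs)
    moreover have "w i ^ 6 \<le> (\<Sum>i\<le>M. w i ^ 6)"
      using that(1) by (intro member_le_sum) auto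
    ultimately have "\<epsilon>\<^sup>2 / 12 * R \<le> \<epsilon>\<^sup>2 / 12 * (\<Sum>i\<le>M. w i ^ 6)" by (intro mult_left_mono) auto
    moreover have "\<epsilon>\<^sup>2 / 12 * R \<ge> \<phi> + 13 + \<epsilon>" using \<epsilon> by (simp add: R_def field_simps)
    moreover have "\<epsilon>\<^sup>2 / 12 * w M ^ 6 \<le> \<epsilon>\<^sup>2 / 12 * (\<Sum>i\<le>M. w i ^ 6)"
      by (intro mult_left_mono member_le_sum) auto
    moreover have "0 \<le> (\<Sum>j\<in>J. (max 0 (w M - s j w))\<^sup>2)" by (simp add: sum_nonneg)
    ultimately show ?thesis
      using sextic_minus_linear_lower_bound[OF \<epsilon>, of "w M"] unfolding \<Phi>_def penalty_def by linarith
  qed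
  \<comment> \<open>The function space has infinitely many coordinates, so a bounded region in the
    first ones is not compact. The penalty sees only those up to \<open>M\<close>; the others are
    pinned to 0.\<close>
  define B where "B = PiE UNIV (\<lambda>i. if i \<le> M then {-R..R} else {0})"
  have "compact B"
    unfolding B_def compactin_euclidean_iff[symmetric] euclidean_product_topology[symmetric]
    by (subst compactin_PiE) (auto simp: compactin_euclidean_iff)
  moreover have "(\<lambda>_. 0) \<in> B" using R by (auto simp: B_def)
  ultimately obtain y where y: "y \<in> B" "\<And>w. w \<in> B \<Longrightarrow> \<Phi> y \<le> \<Phi> w"
    using continuous_attains_inf[OF _ _ cont, of B] by blast
  have "\<Phi> y \<le> \<Phi> w" for w
  proof (cases "\<exists>i\<le>M. R < \<bar>w i\<bar>")
    case True
    then show ?thesis using far y(2)[OF \<open>(\<lambda>_. 0) \<in> B\<close>] unfolding \<phi>_def by fastforce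
  next
    case False
    define w' where "w' i = (if i \<le> M then w i else 0)" for i
    have "w' \<in> B" using False by (auto simp: B_def w'_def not_less abs_le_iff)
    moreover have "\<Phi> w' = \<Phi> w" by (rule cong) (simp add: w'_def)
    ultimately show ?thesis using y(2) by metis
  qed
  then show thesis using that unfolding \<Phi>_def by blast
qed

text \<open>At a minimizer the gradient of the penalty vanishes. The active constraints enter it
  polynomially, so there each \<open>y i ^ 5\<close> is a polynomial of degree 3 in the coordinates.\<close>

lemma penalty_critical_equations:
  fixes s :: "'j \<Rightarrow> (nat \<Rightarrow> real) \<Rightarrow> real"
  assumes J: "finite J" and s: "\<And>j. j \<in> J \<Longrightarrow> int_poly_fun M 2 0 N (\<lambda>_. s j)"
    and J': "J' \<subseteq> J" and N: "0 \<le> N" and i: "i \<le> M"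
  shows "\<exists>G. int_poly_fun (Suc M) 3 1 (1 + 4 * int (card J) * (1 + N)\<^sup>2) G \<and>
    (\<forall>\<epsilon> y. (\<forall>w. penalty M J s \<epsilon> y \<le> penalty M J s \<epsilon> w) \<longrightarrow> {j\<in>J. s j y < y M} = J' \<longrightarrow>
      \<epsilon>\<^sup>2 * y i ^ 5 = G \<epsilon> y)"
proof -
  have i': "i < Suc M" using i by simp
  have f: "int_poly_fun (Suc M) 2 0 (1 + N) (\<lambda>_ y. y M - s j y)" if "j \<in> J" for j
    by (intro int_poly_fun_diff int_poly_fun_Suc[OF s[OF that]])
      (auto intro: int_poly_fun_mono[OF int_poly_fun_var])
  have "\<exists>D. int_poly_fun (Suc M) 1 0 (2 * (1 + N)) D \<and>
    (\<forall>\<epsilon> y. ((\<lambda>h. (y(i := h)) M - s j (y(i := h))) has_real_derivative D \<epsilon> y) (at (y i)))"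
    if "j \<in> J" for j
    using int_poly_fun_deriv[OF f[OF that] i'] by (auto simp del: fun_upd_apply) metis
  then obtain D where D: "\<And>j. j \<in> J \<Longrightarrow> int_poly_fun (Suc M) 1 0 (2 * (1 + N)) (D j)"
    "\<And>j \<epsilon> y. j \<in> J \<Longrightarrow>
      ((\<lambda>h. (y(i := h)) M - s j (y(i := h))) has_real_derivative D j \<epsilon> y) (at (y i))"
    by metis
  define \<delta> :: int where "\<delta> = (if i = M then 1 else 0)"
  define G where "G \<epsilon> y = of_int \<delta> * \<epsilon> - (\<Sum>j\<in>J'. of_int 2 * ((y M - s j y) * D j \<epsilon> y))" for \<epsilon> y
  have "int_poly_fun (Suc M) 3 0 (2 * ((1 + N) * (2 * (1 + N))))
    (\<lambda>\<epsilon> y. of_int 2 * ((y M - s j y) * D j \<epsilon> y))" if "j \<in> J'" for j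
    using int_poly_fun_mult[OF int_poly_fun_const[of "Suc M" 2] int_poly_fun_mult[OF f D(1)], of j] that J'
    by auto
  then have "int_poly_fun (Suc M) 3 0 (int (card J') * (2 * ((1 + N) * (2 * (1 + N)))))
    (\<lambda>\<epsilon> y. \<Sum>j\<in>J'. of_int 2 * ((y M - s j y) * D j \<epsilon> y))"
    using finite_subset[OF J' J] by (intro int_poly_fun_sum) auto
  moreover have "int (card J') * (2 * ((1 + N) * (2 * (1 + N)))) \<le> 4 * int (card J) * (1 + N)\<^sup>2"
  proof -
    have "int (card J') \<le> int (card J)" using card_mono[OF J J'] by simp
    then have "int (card J') * (4 * (1 + N)\<^sup>2) \<le> int (card J) * (4 * (1 + N)\<^sup>2)"
      by (intro mult_right_mono) auto
    then show ?thesis by (simp add: power2_eq_square algebra_simps)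
  qed
  ultimately have sm: "int_poly_fun (Suc M) 3 1 (4 * int (card J) * (1 + N)\<^sup>2)
    (\<lambda>\<epsilon> y. \<Sum>j\<in>J'. of_int 2 * ((y M - s j y) * D j \<epsilon> y))"
    by (auto intro: int_poly_fun_mono)
  have "int_poly_fun (Suc M) (0 + 0) (0 + 1) (\<bar>\<delta>\<bar> * 1) (\<lambda>\<epsilon> y. of_int \<delta> * \<epsilon>)"
    by (intro int_poly_fun_mult int_poly_fun_const int_poly_fun_eps)
  then have "int_poly_fun (Suc M) 3 1 1 (\<lambda>\<epsilon> y. of_int \<delta> * \<epsilon>)"
    by (rule int_poly_fun_mono) (auto simp: \<delta>_def)
  from int_poly_fun_diff[OF this sm]
  have "int_poly_fun (Suc M) 3 1 (1 + 4 * int (card J) * (1 + N)\<^sup>2) G"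
    by (simp only: G_def[abs_def])
  moreover have "\<epsilon>\<^sup>2 * y i ^ 5 = G \<epsilon> y"
    if min: "\<And>w. penalty M J s \<epsilon> y \<le> penalty M J s \<epsilon> w" and act: "{j\<in>J. s j y < y M} = J'" for \<epsilon> y
  proof -
    define P where "P h = (\<Sum>l\<le>M. (y(i := h)) l ^ 6)" for h
    have "P = (\<lambda>h. h ^ 6 + (\<Sum>l\<in>{..M} - {i}. y l ^ 6))"
      using i by (simp add: P_def fun_eq_iff sum.remove[of "{..M}" i])
    then have dP: "(P has_real_derivative 6 * y i ^ 5) (at (y i))"
      by (auto intro!: derivative_eq_intros)
    have dM: "((\<lambda>h. (y(i := h)) M) has_real_derivative of_int \<delta>) (at (y i))"
      by (auto simp: \<delta>_def intro!: derivative_eq_intros)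
    have "((\<lambda>h. penalty M J s \<epsilon> (y(i := h))) has_real_derivative
      (\<Sum>j\<in>J. 2 * max 0 ((y(i := y i)) M - s j (y(i := y i))) * D j \<epsilon> y)
        - \<epsilon> * of_int \<delta> + \<epsilon>\<^sup>2 / 6 * (6 * y i ^ 5)) (at (y i))"
      unfolding penalty_def P_def[symmetric]
      by (intro DERIV_add DERIV_diff DERIV_sum DERIV_cmult has_real_derivative_max_0_square D(2) dM dP)
    then have "(\<Sum>j\<in>J. 2 * max 0 (y M - s j y) * D j \<epsilon> y) - \<epsilon> * of_int \<delta> + \<epsilon>\<^sup>2 / 6 * (6 * y i ^ 5) = 0"
      using min by (intro DERIV_local_min[where d = 1]) auto
    moreover have "(\<Sum>j\<in>J. 2 * max 0 (y M - s j y) * D j \<epsilon> y)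
      = (\<Sum>j\<in>J'. of_int 2 * ((y M - s j y) * D j \<epsilon> y))"
      unfolding act[symmetric] using J by (intro sum.mono_neutral_cong_right) (auto simp: max_def)
    ultimately have "\<epsilon>\<^sup>2 * y i ^ 5 = \<epsilon> * of_int \<delta> - (\<Sum>j\<in>J'. of_int 2 * ((y M - s j y) * D j \<epsilon> y))"
      by simp
    then show ?thesis by (simp only: G_def mult.commute[of "of_int \<delta>"])
  qed
  ultimately show ?thesis by blast
qed

text \<open>The supremum \<open>t\<close> of the margins is the limit of \<open>y n M\<close> for
  penalty minimizers \<open>y n\<close>, and along a subsequence with constant active set the
  rescaled minimizers meet the hypotheses of \<open>limit_root_bound\<close>. The constraint
  \<open>j0\<close> keeps \<open>t\<close> finite and \<open>y0\<close> makes it positive; the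
  margin is an additional variable, hence \<open>Suc M\<close> in \<open>K\<close>.\<close>

lemma margin_lower_bound:
  fixes s :: "'j \<Rightarrow> (nat \<Rightarrow> real) \<Rightarrow> real" and J :: "'j set" and M :: nat and N :: int
  defines "K \<equiv> 4 * 5 ^ Suc M"
  defines "Q \<equiv> 2 * real ((K + 1) * (4 * K + 1)) * of_int ((1 + 4 * int (card J) * (1 + N)\<^sup>2) ^ K)"
  assumes J: "finite J" and s: "\<And>j. j \<in> J \<Longrightarrow> int_poly_fun M 2 0 N (\<lambda>_. s j)" and N: "0 \<le> N"
    and bdd: "j0 \<in> J" "\<And>y. s j0 y \<le> 1" and feas: "\<And>j. j \<in> J \<Longrightarrow> 0 < s j y0"
  shows "\<exists>y. \<forall>j\<in>J. 1 / (2 * (1 + Q)) \<le> s j y"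
proof -
  define S where "S = 1 + 4 * int (card J) * (1 + N)\<^sup>2"
  have S1: "1 \<le> S" by (simp add: S_def)
  define T where "T = {t. \<exists>y. \<forall>j\<in>J. t \<le> s j y}"
  have T1: "t \<le> 1" if "t \<in> T" for t using that bdd unfolding T_def by (auto intro: order_trans)
  then have bddT: "bdd_above T" by (auto simp: bdd_above_def)
  define t0 where "t0 = Min ((\<lambda>j. s j y0) ` J)"
  have "(\<lambda>j. s j y0) ` J \<noteq> {}" using bdd(1) by auto
  then have t0: "0 < t0" "t0 \<in> T" using J feas by (auto simp: t0_def T_def intro!: exI[of _ y0])
  define t where "t = Sup T"
  have tT: "t' \<le> t" if "t' \<in> T" for t' using that bddT by (auto simp: t_def intro: cSup_upper)
  have tpos: "0 < t" using tT[OF t0(2)] t0(1) by linarith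
  define \<epsilon> where "\<epsilon> n = inverse (real (Suc n))" for n
  have \<epsilon>: "0 < \<epsilon> n" "\<epsilon> n \<le> 1" for n by (auto simp: \<epsilon>_def field_simps)
  have \<epsilon>0: "\<epsilon> \<longlonglongrightarrow> 0" unfolding \<epsilon>_def by (rule LIMSEQ_inverse_real_of_nat)
  have "\<exists>y. \<forall>w. penalty M J s (\<epsilon> n) y \<le> penalty M J s (\<epsilon> n) w" for n
    by (rule penalty_minimizer[where s = s, OF J s \<epsilon>(1)]) auto
  then have "\<exists>y. \<forall>n w. penalty M J s (\<epsilon> n) (y n) \<le> penalty M J s (\<epsilon> n) w"
    by (intro choice allI)
  then obtain y where y: "\<And>n w. penalty M J s (\<epsilon> n) (y n) \<le> penalty M J s (\<epsilon> n) w" by blast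
  \<comment> \<open>Comparison with a point of margin \<open>t'\<close> that also claims
    \<open>t'\<close>: all its hinges are zero, so only the reward and a term of order \<epsilon>^2
    remain.\<close>
  have upper: "\<exists>C\<ge>0. \<forall>n. (\<Sum>j\<in>J. (max 0 (y n M - s j (y n)))\<^sup>2) - \<epsilon> n * y n M
      \<le> - \<epsilon> n * t' + (\<epsilon> n)\<^sup>2 * C" if t': "t' \<in> T" for t'
  proof -
    obtain p where p: "\<And>j. j \<in> J \<Longrightarrow> t' \<le> s j p" using t' by (auto simp: T_def)
    define w where "w = p(M := t')"
    have "s j w = s j p" if "j \<in> J" for j
      using int_poly_fun_cong[OF s[OF that], of w p] by (simp add: w_def)
    then have zero: "(\<Sum>j\<in>J. (max 0 (w M - s j w))\<^sup>2) = 0"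
      using p by (intro sum.neutral) (auto simp: w_def)
    define C where "C = (\<Sum>i\<le>M. w i ^ 6) / 6"
    have "(\<Sum>j\<in>J. (max 0 (y n M - s j (y n)))\<^sup>2) - \<epsilon> n * y n M \<le> - \<epsilon> n * t' + (\<epsilon> n)\<^sup>2 * C" for n
    proof -
      have "0 \<le> (\<epsilon> n)\<^sup>2 / 6 * (\<Sum>i\<le>M. y n i ^ 6)" by (simp add: sum_nonneg)
      then show ?thesis using y[of n w] zero unfolding penalty_def C_def by (simp add: w_def)
    qed
    moreover have "0 \<le> C" by (simp add: C_def sum_nonneg)
    ultimately show ?thesis by blast
  qed
  have below: "\<exists>j\<in>J. s j w \<le> t" for w
  proof (rule ccontr)
    assume "\<not> ?thesis"
    then have gt: "\<And>j. j \<in> J \<Longrightarrow> t < s j w" by force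
    have "Min ((\<lambda>j. s j w) ` J) \<in> T" using J by (auto simp: T_def intro!: exI[of _ w])
    moreover have "(\<lambda>j. s j w) ` J \<noteq> {}" using bdd(1) by auto
    then have "t < Min ((\<lambda>j. s j w) ` J)" using J gt by simp
    ultimately show False using tT by force
  qed
  have lim: "(\<lambda>n. y n M) \<longlonglongrightarrow> t"
  proof -
    obtain C0 where C0: "0 \<le> C0" "\<And>n. (\<Sum>j\<in>J. (max 0 (y n M - s j (y n)))\<^sup>2) - \<epsilon> n * y n M
      \<le> - \<epsilon> n * t0 + (\<epsilon> n)\<^sup>2 * C0" using upper[OF t0(2)] by blast
    define c where "c = t - t0 + C0"
    have c0: "0 \<le> c" using tT[OF t0(2)] C0(1) by (simp add: c_def)
    \<comment> \<open>Some constraint is at most \<open>t\<close> at \<open>y n\<close>, so its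
      hinge is at least x = y n M - t. Comparison with \<open>t0\<close> gives x (x - \<epsilon>)
      \<le> \<epsilon> c, which fails once x - \<epsilon> exceeds the square root of \<epsilon>
      c.\<close>
    have up: "y n M \<le> t + (\<epsilon> n + sqrt (\<epsilon> n * c))" for n
    proof (rule ccontr)
      assume "\<not> ?thesis"
      then have gt: "\<epsilon> n + sqrt (\<epsilon> n * c) < y n M - t" by simp
      have sq: "0 \<le> sqrt (\<epsilon> n * c)" using \<epsilon>(1)[of n] c0 by simp
      define x where "x = y n M - t"
      have x: "0 < x" "sqrt (\<epsilon> n * c) < x - \<epsilon> n" "sqrt (\<epsilon> n * c) < x"
        using gt sq \<epsilon>(1)[of n] unfolding x_def by linarith+
      obtain j where j: "j \<in> J" "s j (y n) \<le> t" using below by blast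
      have "x\<^sup>2 \<le> (max 0 (y n M - s j (y n)))\<^sup>2"
        using x(1) j(2) by (intro power_mono) (auto simp: x_def)
      also have "\<dots> \<le> (\<Sum>j\<in>J. (max 0 (y n M - s j (y n)))\<^sup>2)"
        using J j(1) by (intro member_le_sum) auto
      also have "\<dots> \<le> \<epsilon> n * x + \<epsilon> n * (t - t0) + \<epsilon> n * (\<epsilon> n * C0)"
        using C0(2)[of n] by (simp add: x_def power2_eq_square algebra_simps)
      also have "\<dots> \<le> \<epsilon> n * x + \<epsilon> n * (t - t0) + \<epsilon> n * (1 * C0)"
        using \<epsilon>[of n] C0(1) by (intro add_mono mult_left_mono mult_right_mono) auto
      also have "\<dots> = \<epsilon> n * x + \<epsilon> n * c" by (simp add: c_def algebra_simps)
      finally have "x * (x - \<epsilon> n) \<le> \<epsilon> n * c" by (simp add: power2_eq_square algebra_simps)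
      moreover have "sqrt (\<epsilon> n * c) * sqrt (\<epsilon> n * c) < x * (x - \<epsilon> n)"
        using x sq by (intro mult_strict_mono') auto
      moreover have "sqrt (\<epsilon> n * c) * sqrt (\<epsilon> n * c) = \<epsilon> n * c"
        using \<epsilon>(1)[of n] c0 by simp
      ultimately show False by linarith
    qed
    have upl: "(\<lambda>n. t + (\<epsilon> n + sqrt (\<epsilon> n * c))) \<longlonglongrightarrow> t"
      using \<epsilon>0 by (auto intro!: tendsto_eq_intros)
    show ?thesis
    proof (rule LIMSEQ_I)
      fix r :: real assume r: "0 < r"
      obtain t' where t': "t' \<in> T" "t - r / 2 < t'"
        using less_cSup_iff[of T "t - r / 2"] t0(2) bddT r unfolding t_def by auto
      obtain C where C: "0 \<le> C" "\<And>n. (\<Sum>j\<in>J. (max 0 (y n M - s j (y n)))\<^sup>2) - \<epsilon> n * y n M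
        \<le> - \<epsilon> n * t' + (\<epsilon> n)\<^sup>2 * C" using upper[OF t'(1)] by blast
      have low: "t' - \<epsilon> n * C \<le> y n M" for n
      proof -
        have "0 \<le> (\<Sum>j\<in>J. (max 0 (y n M - s j (y n)))\<^sup>2)" by (simp add: sum_nonneg)
        then have "\<epsilon> n * (t' - \<epsilon> n * C) \<le> \<epsilon> n * y n M"
          using C(2)[of n] by (simp add: power2_eq_square algebra_simps)
        then show ?thesis using \<epsilon>(1)[of n] by simp
      qed
      have "(\<lambda>n. \<epsilon> n * C) \<longlonglongrightarrow> 0" using \<epsilon>0 by (auto intro!: tendsto_eq_intros)
      then have "eventually (\<lambda>n. \<epsilon> n * C < r / 2) sequentially" using r by (intro order_tendstoD) auto
      moreover have "eventually (\<lambda>n. t + (\<epsilon> n + sqrt (\<epsilon> n * c)) < t + r) sequentially"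
        using order_tendstoD(2)[OF upl, of "t + r"] r by simp
      ultimately have "eventually (\<lambda>n. norm (y n M - t) < r) sequentially"
      proof eventually_elim
        case (elim n)
        then show ?case using low[of n] up[of n] t'(2) unfolding real_norm_def by linarith
      qed
      then show "\<exists>no. \<forall>n\<ge>no. norm (y n M - t) < r" by (simp add: eventually_sequentially)
    qed
  qed
  \<comment> \<open>The polynomial equations of a minimizer depend on its active set. There are
    finitely many such sets, so one of them occurs for infinitely many n.\<close>
  define act where "act n = {j\<in>J. s j (y n) < y n M}" for n
  have "finite (act ` UNIV)" using J by (rule finite_subset[rotated, OF finite_Pow_iff[THEN iffD2]]) (auto simp: act_def)
  then obtain n0 where "infinite {n. act n = act n0}"
    using pigeonhole_infinite[of "UNIV :: nat set" act] by auto
  then obtain r :: "nat \<Rightarrow> nat" where r: "strict_mono r" "\<forall>n. r n \<in> {n. act n = act n0}"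
    using infinite_enumerate by blast
  have act_r: "act (r n) = act n0" for n using r(2) by auto
  have "\<exists>us. (\<forall>(a, k, \<gamma>)\<in>set us. k \<le> 4 \<and> mdeg (Suc M) \<gamma> \<le> 4) \<and> tnorm us \<le> S \<and>
    (\<forall>n. (\<epsilon> (r n) * y (r n) i) ^ 5 = tval (Suc M) us (\<epsilon> (r n)) (\<lambda>l. \<epsilon> (r n) * y (r n) l))"
    if i: "i < Suc M" for i
  proof -
    have iM: "i \<le> M" and sub: "act n0 \<subseteq> J" using i by (auto simp: act_def)
    obtain G where G: "int_poly_fun (Suc M) 3 1 S G"
      "\<And>\<epsilon> y. (\<And>w. penalty M J s \<epsilon> y \<le> penalty M J s \<epsilon> w) \<Longrightarrow> {j\<in>J. s j y < y M} = act n0 \<Longrightarrow>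
      \<epsilon>\<^sup>2 * y i ^ 5 = G \<epsilon> y"
      unfolding S_def using penalty_critical_equations[where s = s, OF J s sub N iM] by blast
    obtain us where us: "\<And>a k \<gamma>. (a, k, \<gamma>) \<in> set us \<Longrightarrow> k \<le> 4 \<and> mdeg (Suc M) \<gamma> \<le> 4" "tnorm us \<le> S"
      "\<And>\<epsilon> y. \<epsilon> ^ 3 * G \<epsilon> y = tval (Suc M) us \<epsilon> (\<lambda>i. \<epsilon> * y i)"
      by (rule int_poly_fun_rescale[OF G(1)]) blast
    have "(\<epsilon> (r n) * y (r n) i) ^ 5 = tval (Suc M) us (\<epsilon> (r n)) (\<lambda>l. \<epsilon> (r n) * y (r n) l)" for n
    proof -
      have "(\<epsilon> (r n))\<^sup>2 * y (r n) i ^ 5 = G (\<epsilon> (r n)) (y (r n))"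
        using y act_r[of n] by (intro G(2)) (auto simp: act_def)
      then have "\<epsilon> (r n) ^ 3 * ((\<epsilon> (r n))\<^sup>2 * y (r n) i ^ 5) = tval (Suc M) us (\<epsilon> (r n)) (\<lambda>l. \<epsilon> (r n) * y (r n) l)"
        using us(3) by simp
      moreover have "\<epsilon> (r n) ^ 3 * ((\<epsilon> (r n))\<^sup>2 * y (r n) i ^ 5) = (\<epsilon> (r n) * y (r n) i) ^ 5"
        by (simp add: power_mult_distrib eval_nat_numeral)
      ultimately show ?thesis by simp
    qed
    then show ?thesis using us(1,2) by (intro exI[of _ us]) auto
  qed
  then obtain g where g: "\<And>i. i < Suc M \<Longrightarrow> (\<forall>(a, k, \<gamma>)\<in>set (g i). k \<le> 4 \<and> mdeg (Suc M) \<gamma> \<le> 4) \<and>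
    tnorm (g i) \<le> S \<and>
    (\<forall>n. (\<epsilon> (r n) * y (r n) i) ^ 5 = tval (Suc M) (g i) (\<epsilon> (r n)) (\<lambda>l. \<epsilon> (r n) * y (r n) l))"
    by metis
  have "1 / (1 + Q) \<le> t"
    unfolding Q_def K_def S_def[symmetric]
  proof (rule limit_root_bound[where z = "\<lambda>n l. \<epsilon> (r n) * y (r n) l" and \<epsilon> = "\<lambda>n. \<epsilon> (r n)" and g = g and \<tau> = M])
    show "(\<lambda>n. \<epsilon> (r n)) \<longlonglongrightarrow> 0" using LIMSEQ_subseq_LIMSEQ[OF \<epsilon>0 r(1)] by (simp add: o_def)
    have "(\<lambda>n. y (r n) M) \<longlonglongrightarrow> t" using LIMSEQ_subseq_LIMSEQ[OF lim r(1)] by (simp add: o_def)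
    moreover have "\<epsilon> (r n) * y (r n) M / \<epsilon> (r n) = y (r n) M" for n using \<epsilon>(1)[of "r n"] by simp
    ultimately show "(\<lambda>n. \<epsilon> (r n) * y (r n) M / \<epsilon> (r n)) \<longlonglongrightarrow> t" by simp
  qed (use g S1 \<epsilon>(1) tpos in fastforce)+
  moreover have "0 \<le> Q" unfolding Q_def S_def[symmetric] using S1 by simp
  \<comment> \<open>The supremum need not be attained; halving the bound leaves room for an actual
    point.\<close>
  ultimately have "1 / (2 * (1 + Q)) < t" using tpos by (simp add: field_simps)
  then obtain t' where "t' \<in> T" "1 / (2 * (1 + Q)) < t'"
    using less_cSup_iff[of T "1 / (2 * (1 + Q))"] t0(2) bddT unfolding t_def by auto
  then show ?thesis unfolding T_def by (auto intro: order_trans[OF less_imp_le])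
qed

section \<open>Upper bound for unit disk graphs\<close>

lemma balls_intersect_iff:
  fixes c d :: "'a :: real_normed_vector"
  assumes "0 < r"
  shows "ball c r \<inter> ball d r \<noteq> {} \<longleftrightarrow> dist c d < 2 * r"
proof
  assume "ball c r \<inter> ball d r \<noteq> {}"
  then obtain x where "dist c x < r" "dist d x < r" by auto
  then show "dist c d < 2 * r" using dist_triangle2[of c d x] by linarith
next
  assume "dist c d < 2 * r"
  then have "dist c (midpoint c d) < r" "dist d (midpoint c d) < r"
    by (simp_all add: dist_midpoint dist_commute)
  then show "ball c r \<inter> ball d r \<noteq> {}" by auto
qed

lemma realizes_balls_iff:
  fixes c :: "'v \<Rightarrow> 'a :: real_normed_vector"
  assumes G: "simple_graph G" and r: "0 < r"
  shows "realizes (\<lambda>v. ball (c v) r) G \<longleftrightarrow>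
    (\<forall>u\<in>verts G. \<forall>v\<in>verts G. u \<noteq> v \<longrightarrow> ({u, v} \<in> edges G \<longleftrightarrow> dist (c u) (c v) < 2 * r))"
    (is "_ \<longleftrightarrow> ?R")
proof -
  let ?E = "{{u, v} |u v. u \<in> verts G \<and> v \<in> verts G \<and> u \<noteq> v \<and> dist (c u) (c v) < 2 * r}"
  have "realizes (\<lambda>v. ball (c v) r) G \<longleftrightarrow> ?E = edges G"
    unfolding realizes_def intersection_graph_def balls_intersect_iff[OF r] by (cases G) auto
  also have "\<dots> \<longleftrightarrow> ?R"
  proof
    assume E: "?E = edges G"
    show ?R unfolding E[symmetric] by (auto simp: doubleton_eq_iff dist_commute)
  next
    assume R: ?R
    show "?E = edges G"
    proof
      show "?E \<subseteq> edges G" using R by auto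
      show "edges G \<subseteq> ?E"
      proof
        fix e assume e: "e \<in> edges G"
        then have "e \<subseteq> verts G" "card e = 2" using G by (auto simp: simple_graph_def)
        then obtain u v where "e = {u, v}" "u \<noteq> v" "u \<in> verts G" "v \<in> verts G"
          by (auto simp: card_2_iff)
        then show "e \<in> ?E" using R e by blast
      qed
    qed
  qed
  finally show ?thesis .
qed

lemma edge_intersection_graph_balls_iff:
  fixes c :: "'v \<Rightarrow> 'a :: real_normed_vector"
  assumes "0 < r"
  shows "{u, v} \<in> edges (intersection_graph I (\<lambda>i. ball (c i) r)) \<longleftrightarrow>
    u \<in> I \<and> v \<in> I \<and> u \<noteq> v \<and> dist (c u) (c v) < 2 * r"
proof
  assume "{u, v} \<in> edges (intersection_graph I (\<lambda>i. ball (c i) r))"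
  then obtain u' v' where "{u, v} = {u', v'}" "u' \<in> I" "v' \<in> I" "u' \<noteq> v'" "dist (c u') (c v') < 2 * r"
    unfolding intersection_graph_def balls_intersect_iff[OF assms] by auto
  then show "u \<in> I \<and> v \<in> I \<and> u \<noteq> v \<and> dist (c u) (c v) < 2 * r"
    using dist_commute[of "c u" "c v"] by (auto simp: doubleton_eq_iff)
next
  assume "u \<in> I \<and> v \<in> I \<and> u \<noteq> v \<and> dist (c u) (c v) < 2 * r"
  then show "{u, v} \<in> edges (intersection_graph I (\<lambda>i. ball (c i) r))"
    unfolding intersection_graph_def balls_intersect_iff[OF assms] by auto
qed

text \<open>Pulls the disks back along the isomorphism, so that afterwards a realization is a
  placement of the vertices themselves.\<close>

lemma unit_disk_graph_iff:
  fixes G :: "'v graph"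
  assumes "finite (verts G)"
  shows "unit_disk_graph G \<longleftrightarrow> simple_graph G \<and>
    (\<exists>(c :: 'v \<Rightarrow> real^2) r. 0 < r \<and> realizes (\<lambda>v. ball (c v) r) G)"
proof (intro iffI conjI)
  assume U: "unit_disk_graph G"
  then show simple: "simple_graph G" by (simp add: unit_disk_graph_def)
  from U obtain I :: "nat set" and c :: "nat \<Rightarrow> real^2" and r where
    r: "0 < r" and iso: "graph_iso G (intersection_graph I (\<lambda>i. ball (c i) r))"
    unfolding unit_disk_graph_def by blast
  from iso obtain f where f: "bij_betw f (verts G) I"
    "\<And>u v. u \<in> verts G \<Longrightarrow> v \<in> verts G \<Longrightarrow> {u, v} \<in> edges G \<longleftrightarrow>
      {f u, f v} \<in> edges (intersection_graph I (\<lambda>i. ball (c i) r))"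
    unfolding graph_iso_def intersection_graph_def by auto
  have "realizes (\<lambda>v. ball (c (f v)) r) G"
    unfolding realizes_balls_iff[OF simple r]
  proof (intro ballI impI)
    fix u v assume uv: "u \<in> verts G" "v \<in> verts G" "u \<noteq> v"
    then have "f u \<noteq> f v" "f u \<in> I" "f v \<in> I"
      using f(1) by (auto simp: bij_betw_def inj_on_def)
    then show "{u, v} \<in> edges G \<longleftrightarrow> dist (c (f u)) (c (f v)) < 2 * r"
      unfolding f(2)[OF uv(1,2)] edge_intersection_graph_balls_iff[OF r] by simp
  qed
  then show "\<exists>(c :: 'v \<Rightarrow> real^2) r. 0 < r \<and> realizes (\<lambda>v. ball (c v) r) G"
    using r by (intro exI[of _ "\<lambda>v. c (f v)"] exI[of _ r]) simp
next
  assume R: "simple_graph G \<and> (\<exists>(c :: 'v \<Rightarrow> real^2) r. 0 < r \<and> realizes (\<lambda>v. ball (c v) r) G)"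
  then have simple: "simple_graph G" by simp
  from R obtain c :: "'v \<Rightarrow> real^2" and r where r: "0 < r" and re: "realizes (\<lambda>v. ball (c v) r) G"
    by blast
  obtain f where f: "bij_betw f (verts G) {..<card (verts G)}"
    using ex_bij_betw_finite_nat[OF assms] by (auto simp: atLeast0LessThan)
  define g where "g = inv_into (verts G) f"
  have gf: "g (f v) = v" if "v \<in> verts G" for v
    using f that by (simp add: g_def bij_betw_def)
  define I where "I = {..<card (verts G)}"
  have "graph_iso G (intersection_graph I (\<lambda>i. ball (c (g i)) r))"
    unfolding graph_iso_def
  proof (intro exI[of _ f] conjI ballI)
    show "bij_betw f (verts G) (verts (intersection_graph I (\<lambda>i. ball (c (g i)) r)))"
      using f by (simp add: intersection_graph_def I_def)
    fix u v assume uv: "u \<in> verts G" "v \<in> verts G"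
    then have fuv: "f u \<in> I" "f v \<in> I" "f u = f v \<longleftrightarrow> u = v"
      using f by (auto simp: I_def bij_betw_def inj_on_def)
    show "{u, v} \<in> edges G \<longleftrightarrow> {f u, f v} \<in> edges (intersection_graph I (\<lambda>i. ball (c (g i)) r))"
    proof (cases "u = v")
      case True
      have "{v, v} \<notin> edges G" using simple by (auto simp: simple_graph_def)
      then show ?thesis using True unfolding edge_intersection_graph_balls_iff[OF r] by simp
    next
      case False
      then have "{u, v} \<in> edges G \<longleftrightarrow> dist (c u) (c v) < 2 * r"
        using re uv unfolding realizes_balls_iff[OF simple r] by blast
      then show ?thesis using False fuv gf uv
        unfolding edge_intersection_graph_balls_iff[OF r] by simp
    qed
  qed
  then show "unit_disk_graph G" unfolding unit_disk_graph_def
    using simple r by (intro conjI exI[of _ I] exI[of _ "\<lambda>i. c (g i)"] exI[of _ r]) (auto simp: I_def)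
qed

section \<open>Bit sizes of bounded fractions\<close>

lemma bitsize_int_le:
  assumes "\<bar>k\<bar> < 2 ^ B"
  shows "bitsize_int k \<le> 1 + B"
proof -
  have "\<bar>k\<bar> + 1 \<le> 2 ^ B" using assms by simp
  then have "real_of_int (\<bar>k\<bar> + 1) \<le> real_of_int (2 ^ B)" by (simp only: of_int_le_iff)
  then have "real_of_int \<bar>k\<bar> + 1 \<le> 2 ^ B" by simp
  then have "log 2 (real_of_int \<bar>k\<bar> + 1) \<le> log 2 (2 ^ B)"
    by (subst log_le_cancel_iff) auto
  then have "log 2 (real_of_int \<bar>k\<bar> + 1) \<le> real B" by simp
  then show ?thesis unfolding bitsize_int_def by (simp add: ceiling_le_iff nat_le_iff)
qed

text \<open>Cancelling can only shrink numerator and denominator, so a common grid denominator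
  bounds the size of every coordinate.\<close>

lemma bitsize_rat_le:
  assumes "\<bar>k\<bar> < 2 ^ B" "0 < d" "d < 2 ^ B"
  shows "bitsize_rat (of_int k / of_int d) \<le> 2 * (1 + B)"
proof -
  obtain a b where q: "quotient_of (of_int k / of_int d) = (a, b)" by fastforce
  have b: "0 < b" "coprime a b" using quotient_of_denom_pos[OF q] quotient_of_coprime[OF q] by auto
  have "of_int k / of_int d = (of_int a / of_int b :: rat)" by (rule quotient_of_div[OF q])
  then have "of_int (k * b) = (of_int (a * d) :: rat)" using b assms by (simp add: field_simps)
  then have eq: "k * b = a * d" by (simp only: of_int_eq_iff)
  have "b dvd d" using eq b(2) by (metis coprime_commute coprime_dvd_mult_right_iff dvd_triv_right)
  then have bd: "b \<le> d" using assms(2) by (simp add: zdvd_imp_le)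
  have "\<bar>a\<bar> * b \<le> \<bar>a\<bar> * d" using bd by (intro mult_left_mono) auto
  also have "\<dots> = \<bar>k\<bar> * b" using eq b(1) assms(2) by (metis abs_mult abs_of_pos)
  finally have "\<bar>a\<bar> \<le> \<bar>k\<bar>" using b(1) by simp
  then have "bitsize_int a \<le> 1 + B" using assms by (intro bitsize_int_le) simp
  moreover have "bitsize_int b \<le> 1 + B" using assms bd b by (intro bitsize_int_le) simp
  ultimately show ?thesis by (simp add: bitsize_rat_def q)
qed

section \<open>Realizations as solutions of quadratic inequalities, and their rounding\<close>

lemma abs_square_diff_le:
  fixes u v :: real
  assumes "\<bar>u - v\<bar> \<le> e" "\<bar>u\<bar> \<le> m" "\<bar>v\<bar> \<le> m"
  shows "\<bar>u\<^sup>2 - v\<^sup>2\<bar> \<le> e * (2 * m)"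
proof -
  have "\<bar>u\<^sup>2 - v\<^sup>2\<bar> = \<bar>u - v\<bar> * \<bar>u + v\<bar>"
    by (simp add: power2_eq_square square_diff_square_factored abs_mult mult.commute)
  also have "\<dots> \<le> e * (2 * m)" using assms by (intro mult_mono) auto
  finally show ?thesis .
qed

text \<open>Coordinates are numbered so that \<open>y (2 * a)\<close>, \<open>y (2 * a + 1)\<close> is the centre of disk \<open>a\<close>
  and \<open>y (2 * n)\<close> is the common diameter.\<close>

definition sqdist :: "(nat \<Rightarrow> real) \<Rightarrow> nat \<Rightarrow> nat \<Rightarrow> real" where
  "sqdist y a b = (y (2 * a) - y (2 * b))\<^sup>2 + (y (2 * a + 1) - y (2 * b + 1))\<^sup>2"

text \<open>Non-edges are strict too, although a realization only needs distance at least the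
  diameter there. The constraints \<open>Inr i\<close> with i \<le> 2 n confine the solutions to a
  box and bound the margin by 1, as \<open>margin_lower_bound\<close> requires; the extra index 2 n
  + 1 keeps the diameter away from 0.\<close>

definition disk_constraint ::
    "nat \<Rightarrow> (nat \<Rightarrow> nat \<Rightarrow> bool) \<Rightarrow> nat \<times> nat + nat \<Rightarrow> (nat \<Rightarrow> real) \<Rightarrow> real" where
  "disk_constraint n E j y = (case j of
     Inl (a, b) \<Rightarrow> if E a b then (y (2 * n))\<^sup>2 - sqdist y a b else sqdist y a b - (y (2 * n))\<^sup>2
   | Inr i \<Rightarrow> if i \<le> 2 * n then 1 - (y i)\<^sup>2 else (y (2 * n))\<^sup>2)"

definition disk_index :: "nat \<Rightarrow> (nat \<times> nat + nat) set" where
  "disk_index n = Inl ` {(a, b). a < n \<and> b < n \<and> a \<noteq> b} \<union> Inr ` {..2 * n + 1}"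

lemma finite_disk_index: "finite (disk_index n)"
  and card_disk_index: "card (disk_index n) \<le> n * n + (2 * n + 2)"
proof -
  have sub: "{(a, b). a < n \<and> b < n \<and> a \<noteq> b} \<subseteq> {..<n} \<times> {..<n}" by auto
  then have fin: "finite {(a, b). a < n \<and> b < n \<and> a \<noteq> b}" by (rule finite_subset) simp
  then show "finite (disk_index n)" by (simp add: disk_index_def)
  have "card (disk_index n) \<le> card (Inl ` {(a, b). a < n \<and> b < n \<and> a \<noteq> b} :: (nat \<times> nat + nat) set)
      + card (Inr ` {..2 * n + 1} :: (nat \<times> nat + nat) set)"
    unfolding disk_index_def by (rule card_Un_le)
  also have "\<dots> \<le> card ({..<n} \<times> {..<n}) + (2 * n + 2)"
    using card_mono[OF _ sub] by (simp add: card_image)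
  finally show "card (disk_index n) \<le> n * n + (2 * n + 2)" by (simp add: card_cartesian_product)
qed

text \<open>The norm 9 comes from the pair constraints: a squared difference has norm (1 + 1)^2 = 4,
  two of them make 8, and the squared diameter adds 1.\<close>

lemma int_poly_fun_disk_constraint:
  assumes "j \<in> disk_index n"
  shows "int_poly_fun (2 * n + 1) 2 0 9 (\<lambda>_. disk_constraint n E j)"
proof -
  let ?M = "2 * n + 1"
  have v: "int_poly_fun ?M 1 0 1 (\<lambda>_ y. y i)" if "i \<le> 2 * n" for i
    using that by (intro int_poly_fun_var) simp
  have sq: "int_poly_fun ?M 2 0 1 (\<lambda>_ y. (y i)\<^sup>2)" if "i \<le> 2 * n" for i
    using int_poly_fun_mult[OF v[OF that] v[OF that]] by (simp add: power2_eq_square numeral_2_eq_2)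
  have dsq: "int_poly_fun ?M 2 0 4 (\<lambda>_ y. (y i - y k)\<^sup>2)" if "i \<le> 2 * n" "k \<le> 2 * n" for i k
    using int_poly_fun_mult[OF int_poly_fun_diff[OF v v] int_poly_fun_diff[OF v v], of i k i k] that
    by (simp add: power2_eq_square numeral_2_eq_2)
  have sd: "int_poly_fun ?M 2 0 8 (\<lambda>_ y. sqdist y a b)" if "a < n" "b < n" for a b
    using int_poly_fun_add[OF dsq dsq, of "2 * a" "2 * b" "2 * a + 1" "2 * b + 1"] that
    by (simp add: sqdist_def)
  have "int_poly_fun ?M 0 0 1 (\<lambda>_ y. 1)" using int_poly_fun_const[of ?M 1] by simp
  then have one: "int_poly_fun ?M 2 0 1 (\<lambda>_ y. 1)" by (rule int_poly_fun_mono) auto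
  show ?thesis
  proof (cases j)
    case (Inl p)
    then obtain a b where p: "p = (a, b)" "a < n" "b < n" using assms by (auto simp: disk_index_def)
    show ?thesis
      using int_poly_fun_diff[OF sq sd, of "2 * n" a b] int_poly_fun_diff[OF sd sq, of a b "2 * n"] p Inl
      by (cases "E a b") (simp_all add: disk_constraint_def[abs_def])
  next
    case (Inr i)
    show ?thesis
    proof (cases "i \<le> 2 * n")
      case True
      have "int_poly_fun ?M 2 0 9 (\<lambda>_ y. 1 - (y i)\<^sup>2)"
        by (rule int_poly_fun_mono[OF int_poly_fun_diff[OF one sq[OF True]]]) auto
      with Inr True show ?thesis by (simp add: disk_constraint_def[abs_def])
    next
      case False
      have "int_poly_fun ?M 2 0 9 (\<lambda>_ y. (y (2 * n))\<^sup>2)"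
        by (rule int_poly_fun_mono[OF sq]) auto
      with Inr False show ?thesis by (simp add: disk_constraint_def[abs_def])
    qed
  qed
qed

text \<open>This is 40 (1 + Q), with Q from \<open>margin_lower_bound\<close> for 2 n + 1
  coordinates and the margin, and with norm bound 9, so that 4 (1 + 9)^2 = 400. As 40 = 2 * 20, the
  guaranteed margin 1 / (2 (1 + Q)) equals 20 steps of the grid of width
  \<open>1 / margin_denom n\<close>.\<close>

definition margin_denom :: "nat \<Rightarrow> nat" where
  "margin_denom n = 40 * (1 + 2 * ((4 * 5 ^ (2 * n + 2) + 1) * (16 * 5 ^ (2 * n + 2) + 1)) *
     (1 + 400 * card (disk_index n)) ^ (4 * 5 ^ (2 * n + 2)))"

lemma disk_constraints_margin:
  assumes "\<And>j. j \<in> disk_index n \<Longrightarrow> 0 < disk_constraint n E j y0"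
  shows "\<exists>y. \<forall>j\<in>disk_index n. 20 / real (margin_denom n) \<le> disk_constraint n E j y"
proof -
  have "\<exists>y. \<forall>j\<in>disk_index n. 1 / (2 * (1 + 2 * real ((4 * 5 ^ Suc (2 * n + 1) + 1) *
      (4 * (4 * 5 ^ Suc (2 * n + 1)) + 1)) *
      of_int ((1 + 4 * int (card (disk_index n)) * (1 + 9)\<^sup>2) ^ (4 * 5 ^ Suc (2 * n + 1)))))
      \<le> disk_constraint n E j y"
    by (rule margin_lower_bound[where s = "disk_constraint n E" and ?j0.0 = "Inr 0" and ?y0.0 = y0,
          OF finite_disk_index int_poly_fun_disk_constraint])
      (use assms in \<open>auto simp: disk_index_def disk_constraint_def\<close>)
  moreover define q where "q = 2 * ((4 * 5 ^ (2 * n + 2) + 1) * (16 * 5 ^ (2 * n + 2) + 1)) *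
     (1 + 400 * card (disk_index n)) ^ (4 * 5 ^ (2 * n + 2))"
  have "2 * real ((4 * 5 ^ Suc (2 * n + 1) + 1) * (4 * (4 * 5 ^ Suc (2 * n + 1)) + 1)) *
      of_int ((1 + 4 * int (card (disk_index n)) * (1 + 9)\<^sup>2) ^ (4 * 5 ^ Suc (2 * n + 1))) = real q"
    by (simp add: q_def power2_eq_square distrib_right)
  moreover have "margin_denom n = 40 * (1 + q)" by (simp only: margin_denom_def q_def)
  then have "1 / (2 * (1 + real q)) = 20 / real (margin_denom n)" by (simp add: field_simps)
  ultimately show ?thesis by simp
qed

lemma dist_real2_square:
  fixes x y :: "real^2"
  shows "(dist x y)\<^sup>2 = (x $ 1 - y $ 1)\<^sup>2 + (x $ 2 - y $ 2)\<^sup>2"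
  by (simp add: dist_vec_def L2_set_def sum_2 dist_real_def)

text \<open>A non-edge may lie at distance exactly \<open>r\<close>, which is the diameter here.
  Shrinking the diameter to a value between the longest edge and \<open>r\<close> makes all
  conditions strict without changing the graph; division by \<open>m\<close> moves everything into
  the box.\<close>

lemma disk_constraints_feasible:
  fixes c :: "nat \<Rightarrow> real^2"
  assumes r: "0 < r" and E: "\<And>a b. a < n \<Longrightarrow> b < n \<Longrightarrow> a \<noteq> b \<Longrightarrow> E a b \<longleftrightarrow> dist (c a) (c b) < r"
  obtains y where "\<And>j. j \<in> disk_index n \<Longrightarrow> 0 < disk_constraint n E j y"
proof -
  define A where "A = insert 0 ((\<lambda>(a, b). dist (c a) (c b)) ` {(a, b). a < n \<and> b < n \<and> dist (c a) (c b) < r})"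
  have "{(a, b). a < n \<and> b < n \<and> dist (c a) (c b) < r} \<subseteq> {..<n} \<times> {..<n}" by auto
  then have "finite {(a, b). a < n \<and> b < n \<and> dist (c a) (c b) < r}" by (rule finite_subset) simp
  then have A: "finite A" "A \<noteq> {}" unfolding A_def by auto
  have "Max A < r" using A r by (auto simp: A_def)
  then obtain \<rho> where \<rho>: "Max A < \<rho>" "\<rho> < r" using dense by blast
  then have less_\<rho>: "x < \<rho>" if "x \<in> A" for x using Max_ge[OF A(1) that] by linarith
  have \<rho>0: "0 < \<rho>" using less_\<rho> by (simp add: A_def)
  define m where "m = 1 + \<rho> + (\<Sum>a<n. \<bar>c a $ 1\<bar> + \<bar>c a $ 2\<bar>)"
  have m0: "0 < m" using \<rho>0 by (simp add: m_def add_pos_nonneg sum_nonneg)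
  have m: "\<rho> < m" "\<And>a. a < n \<Longrightarrow> \<bar>c a $ 1\<bar> < m" "\<And>a. a < n \<Longrightarrow> \<bar>c a $ 2\<bar> < m"
  proof -
    show "\<rho> < m" by (simp add: m_def add_pos_nonneg sum_nonneg)
    fix a assume "a < n"
    then have "\<bar>c a $ 1\<bar> + \<bar>c a $ 2\<bar> \<le> (\<Sum>a<n. \<bar>c a $ 1\<bar> + \<bar>c a $ 2\<bar>)"
      by (intro member_le_sum) auto
    then show "\<bar>c a $ 1\<bar> < m" "\<bar>c a $ 2\<bar> < m" using \<rho>0 unfolding m_def by linarith+
  qed
  define y where "y k = (if k = 2 * n then \<rho> else c (k div 2) $ (if even k then 1 else 2)) / m" for k
  have sq: "sqdist y a b = (dist (c a) (c b) / m)\<^sup>2" if "a < n" "b < n" for a b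
    using that by (simp add: sqdist_def y_def power_divide dist_real2_square
        flip: diff_divide_distrib add_divide_distrib)
  have yn: "y (2 * n) = \<rho> / m" by (simp add: y_def)
  have y1: "\<bar>y k\<bar> < 1" if "k \<le> 2 * n" for k
  proof (cases "k = 2 * n")
    case True
    then show ?thesis using m(1) m0 \<rho>0 by (simp add: y_def)
  next
    case False
    then have "k div 2 < n" using that by auto
    then show ?thesis using m(2,3)[of "k div 2"] m0 False by (simp add: y_def)
  qed
  have "0 < disk_constraint n E j y" if j: "j \<in> disk_index n" for j
  proof (cases j)
    case (Inl p)
    then obtain a b where p: "p = (a, b)" "a < n" "b < n" "a \<noteq> b" using j by (auto simp: disk_index_def)
    show ?thesis
    proof (cases "E a b")
      case True
      then have "dist (c a) (c b) \<in> A" using p E by (force simp: A_def)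
      from less_\<rho>[OF this] have "dist (c a) (c b) / m < \<rho> / m" using m0 by (simp add: divide_strict_right_mono)
      then have "(dist (c a) (c b) / m)\<^sup>2 < (\<rho> / m)\<^sup>2" using m0 by (intro power_strict_mono) auto
      then show ?thesis using Inl p True by (simp add: disk_constraint_def sq yn)
    next
      case False
      then have "\<rho> < dist (c a) (c b)" using p E \<rho> by force
      then have "\<rho> / m < dist (c a) (c b) / m" using m0 by (simp add: divide_strict_right_mono)
      then have "(\<rho> / m)\<^sup>2 < (dist (c a) (c b) / m)\<^sup>2" using m0 \<rho>0 by (intro power_strict_mono) auto
      then show ?thesis using Inl p False by (simp add: disk_constraint_def sq yn)
    qed
  next
    case (Inr i)
    have "(y i)\<^sup>2 < 1" if "i \<le> 2 * n" using y1[OF that] by (simp add: abs_square_less_1)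
    then show ?thesis using Inr m0 \<rho>0 by (auto simp: disk_constraint_def yn)
  qed
  then show thesis by (rule that)
qed

text \<open>Rounding down to multiples of 1 / D changes a squared distance by at most 16 / D and the
  squared diameter by at most 2 / D, because all coordinates stay in [-1, 1]. The margin 20 / D
  exceeds the total of 18 / D.\<close>

lemma disk_constraints_grid_point:
  assumes y: "\<And>j. j \<in> disk_index n \<Longrightarrow> 20 / real D \<le> disk_constraint n E j y" and D: "0 < D"
  obtains k :: "nat \<Rightarrow> int" where "\<And>i. i \<le> 2 * n \<Longrightarrow> \<bar>k i\<bar> \<le> int D" "k (2 * n) \<noteq> 0"
    "\<And>a b. a < n \<Longrightarrow> b < n \<Longrightarrow> a \<noteq> b \<Longrightarrow> E a b \<longleftrightarrow>
      sqdist (\<lambda>i. of_int (k i) / real D) a b < (of_int (k (2 * n)) / real D)\<^sup>2"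
proof -
  define k where "k i = \<lfloor>y i * real D\<rfloor>" for i
  define z where "z i = of_int (k i) / real D" for i
  have D0: "0 < 20 / real D" using D by simp
  have y1: "\<bar>y i\<bar> \<le> 1" if "i \<le> 2 * n" for i
  proof -
    have "20 / real D \<le> 1 - (y i)\<^sup>2"
      using y[of "Inr i"] that by (auto simp: disk_index_def disk_constraint_def)
    then have "(y i)\<^sup>2 \<le> 1" using D0 by linarith
    then show ?thesis by (simp add: abs_square_le_1)
  qed
  have z: "z i \<le> y i" "y i \<le> z i + 1 / real D" for i
  proof -
    have "of_int (k i) \<le> y i * real D" "y i * real D \<le> of_int (k i) + 1"
      unfolding k_def by linarith+
    then show "z i \<le> y i" "y i \<le> z i + 1 / real D" using D by (simp_all add: z_def field_simps)
  qed
  have k1: "\<bar>k i\<bar> \<le> int D" if "i \<le> 2 * n" for i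
  proof -
    have "- 1 * real D \<le> y i * real D" "y i * real D \<le> 1 * real D"
      using y1[OF that] by (intro mult_right_mono; simp)+
    then have *: "of_int (- int D) \<le> y i * real D" "y i * real D < of_int (int D) + 1" by simp_all
    have "- int D \<le> k i" unfolding k_def using *(1) by (subst le_floor_iff)
    moreover have "k i \<le> int D" unfolding k_def using *(2) by (subst floor_le_iff)
    ultimately show ?thesis by simp
  qed
  have z1: "\<bar>z i\<bar> \<le> 1" if "i \<le> 2 * n" for i
  proof -
    have "\<bar>real_of_int (k i)\<bar> \<le> real D"
      using k1[OF that] by (metis of_int_abs of_int_le_iff of_int_of_nat_eq)
    then show ?thesis using D by (simp add: z_def)
  qed
  have zy: "\<bar>z i - y i\<bar> \<le> 1 / real D" for i using z[of i] by linarith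
  have rho: "\<bar>(z (2 * n))\<^sup>2 - (y (2 * n))\<^sup>2\<bar> \<le> 2 / real D"
    using abs_square_diff_le[OF zy, of "2 * n" 1] y1 z1 by simp
  have diff: "\<bar>(z i - z l)\<^sup>2 - (y i - y l)\<^sup>2\<bar> \<le> 8 / real D" if "i \<le> 2 * n" "l \<le> 2 * n" for i l
  proof -
    have "\<bar>(z i - z l) - (y i - y l)\<bar> \<le> 2 / real D" using z[of i] z[of l] by (simp add: field_simps)
    from abs_square_diff_le[OF this, of 2] show ?thesis
      using y1[OF that(1)] y1[OF that(2)] z1[OF that(1)] z1[OF that(2)] by simp
  qed
  have sd: "\<bar>sqdist z a b - sqdist y a b\<bar> \<le> 16 / real D" if "a < n" "b < n" for a b
  proof -
    have "\<bar>sqdist z a b - sqdist y a b\<bar> \<le> 8 / real D + 8 / real D"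
      using diff[of "2 * a" "2 * b"] diff[of "2 * a + 1" "2 * b + 1"] that unfolding sqdist_def by linarith
    then show ?thesis by simp
  qed
  have "E a b \<longleftrightarrow> sqdist z a b < (z (2 * n))\<^sup>2" if "a < n" "b < n" "a \<noteq> b" for a b
  proof -
    have "20 / real D \<le> disk_constraint n E (Inl (a, b)) y" using that by (intro y) (auto simp: disk_index_def)
    moreover have "20 / real D = 16 / real D + 2 / real D + 2 / real D" by simp
    moreover have "0 < 2 / real D" using D by simp
    ultimately show ?thesis using sd[OF that(1,2)] rho unfolding disk_constraint_def sum.case prod.case
      by (cases "E a b"; simp only: if_True if_False simp_thms; linarith)
  qed
  moreover have "k (2 * n) \<noteq> 0"
  proof -
    have "20 / real D \<le> (y (2 * n))\<^sup>2"
      using y[of "Inr (2 * n + 1)"] by (auto simp: disk_index_def disk_constraint_def)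
    moreover have "2 / real D < 20 / real D" using D by (simp add: divide_strict_right_mono)
    ultimately have "(z (2 * n))\<^sup>2 \<noteq> 0" using rho by auto
    then show ?thesis by (auto simp: z_def)
  qed
  ultimately show thesis using k1 by (intro that[of k]) (auto simp: z_def[abs_def])
qed

lemma unit_disk_graph_rational_realization:
  fixes G :: "'v graph"
  assumes G: "unit_disk_graph G" "finite (verts G)" and B: "2 * margin_denom (card (verts G)) < 2 ^ B"
  shows "\<exists>c r. 0 < r \<and> realizes (\<lambda>v. rat_disk (c v) r) G \<and>
    realization_size (verts G) c r \<le> (2 * card (verts G) + 1) * (2 * (1 + B))"
proof -
  define n where "n = card (verts G)"
  define D where "D = margin_denom n"
  have D0: "0 < D" by (simp add: D_def margin_denom_def)
  have simple: "simple_graph G" using G by (simp add: unit_disk_graph_def)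
  obtain q :: "'v \<Rightarrow> real^2" and r where r: "0 < r" "realizes (\<lambda>v. ball (q v) r) G"
    using G unit_disk_graph_iff by blast
  obtain f where f: "bij_betw f (verts G) {..<n}"
    using ex_bij_betw_finite_nat[OF G(2)] by (auto simp: atLeast0LessThan n_def)
  define g where "g = inv_into (verts G) f"
  have gf: "g (f v) = v" "f v < n" if "v \<in> verts G" for v
    using f that by (auto simp: g_def bij_betw_def)
  have g: "g a \<in> verts G" if "a < n" for a
    using bij_betw_inv_into[OF f] that by (auto simp: g_def bij_betw_def)
  have g_inj: "g a \<noteq> g b" if "a < n" "b < n" "a \<noteq> b" for a b
    using bij_betw_inv_into[OF f] that by (auto simp: g_def bij_betw_def inj_on_def)
  define E where "E a b \<longleftrightarrow> {g a, g b} \<in> edges G" for a b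
  have "E a b \<longleftrightarrow> dist (q (g a)) (q (g b)) < 2 * r" if "a < n" "b < n" "a \<noteq> b" for a b
    using r(2) g g_inj that unfolding realizes_balls_iff[OF simple r(1)] E_def by blast
  from disk_constraints_feasible[of "2 * r" n E "\<lambda>a. q (g a)", OF _ this] r(1)
  obtain y0 where "\<And>j. j \<in> disk_index n \<Longrightarrow> 0 < disk_constraint n E j y0" by auto
  from disk_constraints_margin[OF this] obtain y where
    "\<And>j. j \<in> disk_index n \<Longrightarrow> 20 / real D \<le> disk_constraint n E j y" unfolding D_def by blast
  from disk_constraints_grid_point[OF this D0] obtain k :: "nat \<Rightarrow> int" where
    k: "\<And>i. i \<le> 2 * n \<Longrightarrow> \<bar>k i\<bar> \<le> int D" "k (2 * n) \<noteq> 0"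
    "\<And>a b. a < n \<Longrightarrow> b < n \<Longrightarrow> a \<noteq> b \<Longrightarrow> E a b \<longleftrightarrow>
      sqdist (\<lambda>i. of_int (k i) / real D) a b < (of_int (k (2 * n)) / real D)\<^sup>2"
    by blast
  define c :: "'v \<Rightarrow> rat^2" where
    "c v = (\<chi> i. of_int (k (2 * f v + (if i = 1 then 0 else 1))) / of_int (int D))" for v
  \<comment> \<open>Only the square of coordinate 2 n is constrained, so it may be negative. The
    radius is half its absolute value, which puts 2 D into the denominator and explains the factor 2
    in the hypothesis on \<open>B\<close>.\<close>
  define \<rho> :: rat where "\<rho> = of_int \<bar>k (2 * n)\<bar> / of_int (2 * int D)"
  have \<rho>: "0 < \<rho>" using k(2) D0 by (simp add: \<rho>_def)
  have rho: "2 * of_rat \<rho> = \<bar>of_int (k (2 * n)) / real D\<bar>"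
    by (simp add: \<rho>_def of_rat_divide of_rat_mult del: of_int_abs) simp
  have "realizes (\<lambda>v. rat_disk (c v) \<rho>) G"
    unfolding rat_disk_def
  proof (subst realizes_balls_iff[OF simple], (simp add: \<rho>; fail), intro ballI impI)
    fix u v assume uv: "u \<in> verts G" "v \<in> verts G" "u \<noteq> v"
    let ?c = "\<lambda>v. (\<chi> i. of_rat (c v $ i)) :: real^2"
    have "f u \<noteq> f v" using gf uv by metis
    then have "{u, v} \<in> edges G \<longleftrightarrow>
        sqdist (\<lambda>i. of_int (k i) / real D) (f u) (f v) < (of_int (k (2 * n)) / real D)\<^sup>2"
      using k(3)[of "f u" "f v"] gf uv by (simp add: E_def)
    also have "sqdist (\<lambda>i. of_int (k i) / real D) (f u) (f v) = (dist (?c u) (?c v))\<^sup>2"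
      by (simp add: dist_real2_square sqdist_def c_def of_rat_divide)
    also have "(of_int (k (2 * n)) / real D)\<^sup>2 = (2 * of_rat \<rho>)\<^sup>2"
      unfolding rho by (simp only: power2_abs)
    also have "(dist (?c u) (?c v))\<^sup>2 < (2 * of_rat \<rho>)\<^sup>2 \<longleftrightarrow> dist (?c u) (?c v) < 2 * of_rat \<rho>"
      using \<rho> power_mono_iff[of "2 * of_rat \<rho>" "dist (?c u) (?c v)" 2] by (simp flip: not_le)
    finally show "{u, v} \<in> edges G \<longleftrightarrow> dist (?c u) (?c v) < 2 * of_rat \<rho>" .
  qed
  moreover have "realization_size (verts G) c \<rho> \<le> (2 * n + 1) * (2 * (1 + B))"
  proof -
    have "int (2 * D) < int (2 ^ B)" using B by (simp only: of_nat_less_iff D_def n_def)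
    then have B': "2 * int D < 2 ^ B" by simp
    have "bitsize_rat (c v $ i) \<le> 2 * (1 + B)" if "v \<in> verts G" for v i
    proof -
      have "\<bar>k (2 * f v + (if i = 1 then 0 else 1))\<bar> \<le> int D" using gf(2)[OF that] by (intro k(1)) auto
      then show ?thesis using B' D0 unfolding c_def vec_lambda_beta by (intro bitsize_rat_le) linarith+
    qed
    then have "(\<Sum>v\<in>verts G. \<Sum>i\<in>UNIV. bitsize_rat (c v $ i)) \<le> (\<Sum>v\<in>verts G. \<Sum>i\<in>(UNIV :: 2 set). 2 * (1 + B))"
      by (intro sum_mono) auto
    also have "\<dots> = 2 * n * (2 * (1 + B))" by (simp add: n_def)
    finally have "(\<Sum>v\<in>verts G. \<Sum>i\<in>UNIV. bitsize_rat (c v $ i)) \<le> 2 * n * (2 * (1 + B))" .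
    moreover have "bitsize_rat \<rho> \<le> 2 * (1 + B)"
      unfolding \<rho>_def using k(1)[of "2 * n"] B' D0 by (intro bitsize_rat_le) auto
    ultimately show ?thesis unfolding realization_size_def by simp
  qed
  ultimately show ?thesis using \<rho> unfolding n_def by blast
qed

text \<open>The exponent combines 4 * 5^(2 n + 2) = 100 * 25^n factors of at most 2^(11 + 2 n) each,
  the bounds 2^(7 + 5 n) and 2^(9 + 5 n) for the two linear factors, and 2^8 for the constants. The
  number of constraints affects only the base, where n^2 \<le> 4^n is used.\<close>

lemma margin_denom_less:
  assumes n: "1 \<le> n"
  shows "2 * margin_denom n < 2 ^ (24 + 10 * n + (11 + 2 * n) * (100 * 25 ^ n))"
proof -
  have p25: "(25::nat) ^ n \<le> 2 ^ (5 * n)"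
    using power_mono[of "25::nat" "2 ^ 5" n] by (simp add: power_mult)
  have p1: "(1::nat) \<le> 25 ^ n" by simp
  have K: "5 ^ (2 * n + 2) = 25 * (25::nat) ^ n" by (simp add: power_mult power_add)
  have "n \<le> 2 ^ n" by (rule less_imp_le[OF less_exp])
  then have "n * n \<le> 2 ^ n * 2 ^ n" by (rule mult_le_mono) fact
  then have nn: "n * n \<le> 4 ^ n" by (simp flip: power_mult_distrib)
  have "n \<le> n * n" "1 \<le> n * n" using n by auto
  then have "1 + 400 * card (disk_index n) \<le> 1 + 2000 * 4 ^ n"
    using card_disk_index[of n] nn by linarith
  also have "\<dots> \<le> 2048 * 4 ^ n" using one_le_power[of "4::nat" n] by linarith
  also have "\<dots> = 2 ^ (11 + 2 * n)" by (simp add: power_add power_mult)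
  finally have S: "(1 + 400 * card (disk_index n)) ^ (4 * 5 ^ (2 * n + 2)) \<le> (2 ^ (11 + 2 * n)) ^ (100 * 25 ^ n)"
    unfolding K by (simp add: power_mono)
  have A: "4 * 5 ^ (2 * n + 2) + 1 \<le> (2::nat) ^ (7 + 5 * n)"
  proof -
    have "(2::nat) ^ (7 + 5 * n) = 128 * 2 ^ (5 * n)" by (simp add: power_add)
    then show ?thesis unfolding K using p25 p1 by linarith
  qed
  have A': "16 * 5 ^ (2 * n + 2) + 1 \<le> (2::nat) ^ (9 + 5 * n)"
  proof -
    have "(2::nat) ^ (9 + 5 * n) = 512 * 2 ^ (5 * n)" by (simp add: power_add)
    then show ?thesis unfolding K using p25 p1 by linarith
  qed
  define Z :: nat where "Z = 2 ^ (16 + 10 * n) * (2 ^ (11 + 2 * n)) ^ (100 * 25 ^ n)"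
  have "(4 * 5 ^ (2 * n + 2) + 1) * (16 * 5 ^ (2 * n + 2) + 1) \<le> (2::nat) ^ (7 + 5 * n) * 2 ^ (9 + 5 * n)"
    by (intro mult_le_mono A A')
  also have "\<dots> = 2 ^ (16 + 10 * n)" by (simp flip: power_add)
  finally have AA: "(4 * 5 ^ (2 * n + 2) + 1) * (16 * 5 ^ (2 * n + 2) + 1) \<le> (2::nat) ^ (16 + 10 * n)" .
  define X where "X = (4 * 5 ^ (2 * n + 2) + 1) * (16 * 5 ^ (2 * n + 2) + 1) *
     (1 + 400 * card (disk_index n)) ^ (4 * 5 ^ (2 * n + 2))"
  have "X \<le> Z" unfolding X_def Z_def using AA S by (rule mult_le_mono)
  moreover have "margin_denom n = 40 * (1 + 2 * X)" by (simp only: margin_denom_def X_def mult.assoc)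
  ultimately have "2 * margin_denom n \<le> 80 + 160 * Z" by simp
  also have "\<dots> < 256 * Z"
  proof -
    have "1 \<le> Z" by (simp add: Z_def)
    then show ?thesis by linarith
  qed
  also have "256 * Z = 2 ^ (24 + 10 * n + (11 + 2 * n) * (100 * 25 ^ n))"
    unfolding Z_def power_mult[symmetric] by (simp add: power_add)
  finally show ?thesis .
qed

lemma unit_disk_graph_small_realization:
  assumes n: "1 \<le> n" and G: "G \<in> UDG n"
  shows "\<exists>c r. 0 < r \<and> realizes (\<lambda>v. rat_disk (c v) r) G \<and> realization_size (verts G) c r \<le> 2 ^ (20 * n)"
proof -
  let ?B = "24 + 10 * n + (11 + 2 * n) * (100 * 25 ^ n)"
  have c: "card (verts G) = n" and u: "unit_disk_graph G" using G by (auto simp: UDG_def)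
  then have fin: "finite (verts G)" using n by (intro card_ge_0_finite) simp
  obtain c r where cr: "0 < r" "realizes (\<lambda>v. rat_disk (c v) r) G"
    "realization_size (verts G) c r \<le> (2 * n + 1) * (2 * (1 + ?B))"
    using unit_disk_graph_rational_realization[OF u fin, of ?B] margin_denom_less[OF n] unfolding c by blast
  have "n \<le> 2 ^ n" by (rule less_imp_le[OF less_exp])
  then have "n * n \<le> 2 ^ n * 2 ^ n" by (rule mult_le_mono) fact
  then have nn: "n * n \<le> 4 ^ n" by (simp flip: power_mult_distrib)
  have p1: "(1::nat) \<le> 25 ^ n" by simp
  have "1 + ?B \<le> 35 * n * 25 ^ n + (11 * n + 2 * n) * (100 * 25 ^ n)"
  proof -
    have "1 + (24 + 10 * n) \<le> 35 * n * 1" using n by simp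
    also have "\<dots> \<le> 35 * n * 25 ^ n" by (intro mult_le_mono2 p1)
    finally have "1 + (24 + 10 * n) \<le> 35 * n * 25 ^ n" .
    moreover have "(11 + 2 * n) * (100 * 25 ^ n) \<le> (11 * n + 2 * n) * (100 * 25 ^ n)"
      using n by (intro mult_le_mono1) simp
    ultimately show ?thesis by linarith
  qed
  also have "\<dots> = 1335 * n * 25 ^ n" by simp
  finally have "(2 * n + 1) * (2 * (1 + ?B)) \<le> (3 * n) * (2 * (1335 * n * 25 ^ n))"
    using n by (intro mult_le_mono) auto
  also have "\<dots> = 8010 * ((n * n) * 25 ^ n)" by simp
  also have "\<dots> \<le> 8010 * (4 ^ n * 25 ^ n)" by (intro mult_le_mono2 mult_le_mono1 nn)
  also have "\<dots> = 8010 * 100 ^ n" by (simp flip: power_mult_distrib)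
  \<comment> \<open>The constant 20 is 13 + 7: 2^13 covers 8010, and 2^7 covers 100 = 4 * 25, the 4
    again from n^2 \<le> 4^n.\<close>
  also have "\<dots> \<le> (2 ^ 13) ^ n * (2 ^ 7) ^ n"
  proof (rule mult_le_mono)
    have "(8010::nat) \<le> (2 ^ 13) ^ 1" by simp
    also have "\<dots> \<le> (2 ^ 13) ^ n" using n by (intro power_increasing) auto
    finally show "(8010::nat) \<le> (2 ^ 13) ^ n" .
    show "(100::nat) ^ n \<le> (2 ^ 7) ^ n" by (rule power_mono) auto
  qed
  also have "\<dots> = 2 ^ (20 * n)" by (simp only: power_mult_distrib[symmetric] power_add[symmetric] power_mult[symmetric]) simp
  finally show ?thesis using cr by (meson le_trans)
qed

lemma g_UDG_graph_le:
  assumes "1 \<le> n" "G \<in> UDG n"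
  shows "g_UDG_graph G \<le> 2 ^ (20 * n)"
proof -
  obtain c r where "0 < r" "realizes (\<lambda>v. rat_disk (c v) r) G" "realization_size (verts G) c r \<le> 2 ^ (20 * n)"
    using unit_disk_graph_small_realization[OF assms] by blast
  then show ?thesis unfolding g_UDG_graph_def by (intro cInf_lower2) auto
qed

text \<open>The infimum of an empty set would carry no information, so a bound for all realizations
  passes to it only because a rational realization exists; the upper bound supplies one.\<close>

lemma g_UDG_graph_ge:
  assumes "1 \<le> n" "G \<in> UDG n"
    and "\<And>c r. 0 < r \<Longrightarrow> realizes (\<lambda>v. rat_disk (c v) r) G \<Longrightarrow> b \<le> realization_size (verts G) c r"
  shows "b \<le> g_UDG_graph G"
  unfolding g_UDG_graph_def
  using unit_disk_graph_small_realization[OF assms(1,2)] assms(3) by (intro cInf_greatest) blast+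

text \<open>Makes \<open>Max\<close> meaningful. The uniform upper bound suffices; isomorphism types
  need not be counted.\<close>

lemma finite_g_UDG_graph_image:
  assumes "1 \<le> n"
  shows "finite (g_UDG_graph ` UDG n)"
  by (rule finite_subset[of _ "{..2 ^ (20 * n)}"]) (use g_UDG_graph_le[OF assms] in auto)

lemma UDG_nonempty: "UDG n \<noteq> {}"
proof -
  let ?G = "intersection_graph {..<n} (\<lambda>_. ball (0 :: real^2) 1)"
  have "simple_graph ?G" by (auto simp: simple_graph_def intersection_graph_def card_2_iff)
  moreover have "realizes (\<lambda>_. ball (0 :: real^2) 1) ?G" by (simp add: realizes_def intersection_graph_def)
  ultimately have "unit_disk_graph ?G"
    by (subst unit_disk_graph_iff) (auto simp: intersection_graph_def intro!: exI[of _ "\<lambda>_. 0"] exI[of _ 1])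
  then have "?G \<in> UDG n" by (simp add: UDG_def intersection_graph_def)
  then show ?thesis by blast
qed

lemma g_UDG_le: "1 \<le> n \<Longrightarrow> g_UDG n \<le> 2 ^ (20 * n)"
  unfolding g_UDG_def using finite_g_UDG_graph_image UDG_nonempty g_UDG_graph_le by (subst Max_le_iff) auto

section \<open>A sign pattern of points and lines with a tiny cross ratio\<close>

text \<open>The point \<open>p\<close> has coordinates \<open>sgx p * exp (ptx m p)\<close>, \<open>sgy p * exp (pty m p)\<close>, and a line \<open>M\<close>
  other than the axes \<open>AX\<close>, \<open>AY\<close> has intercepts \<open>exp (lnx M)\<close>, \<open>exp (lny M)\<close> up to sign. In every
  realization of the sign pattern the points \<open>Fr i s t\<close> determine the signs of the coefficients of
  the lines. The objects with index \<open>k\<close> form a stage that leads from \<open>PA k\<close> to \<open>PA (Suc k)\<close>, and the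
  remaining ones fix the starting point \<open>PA 0\<close>.\<close>

datatype pt = Fr nat bool bool | V0 | V1 | W0 | X0 | Q0 | P0 | PA nat | PP nat | PQ nat

datatype ln = AX | AY | G0 | H0 | J0 | L0 | L1 | L2 | LC nat | LB nat | LK nat

text \<open>Solves s (k + 1) = 2 s k - 8 with s 0 = -14. The doubling squares the coordinate of
  \<open>PA k\<close>; the constant -8 is slack for the dominations by a factor e along one
  stage.\<close>

definition stage :: "nat \<Rightarrow> real" where
  "stage k = 8 - 22 * 2 ^ k"

text \<open>Exceeds |lnx M| + |lny M| + 1 for every line \<open>M\<close> but the axes, so that at
  each frame point one term of \<open>lval\<close> outweighs the other two.\<close>

definition frame_radius :: "nat \<Rightarrow> real" where
  "frame_radius m = 1000 * 2 ^ m"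

definition pm :: "bool \<Rightarrow> real" where
  "pm b = (if b then 1 else - 1)"

text \<open>The values have to satisfy the inequalities of \<open>stage_incidences\<close> and
  \<open>base_incidences\<close>. \<open>V0\<close> is shared by the lines \<open>LC k\<close> of
  all stages, hence the dependence on \<open>m\<close>.\<close>

fun ptx :: "nat \<Rightarrow> pt \<Rightarrow> real" where
  "ptx m (Fr i s t) = (if i = 0 then - frame_radius m else if i = 1 then frame_radius m else 0)"
| "ptx m V0 = stage m - 8"
| "ptx m V1 = -9"
| "ptx m W0 = 0"
| "ptx m X0 = -8"
| "ptx m Q0 = -10"
| "ptx m P0 = -12"
| "ptx m (PA k) = stage k"
| "ptx m (PP k) = stage k - 2"
| "ptx m (PQ k) = stage k - 1"

fun pty :: "nat \<Rightarrow> pt \<Rightarrow> real" where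
  "pty m (Fr i s t) = (if i = 0 then - frame_radius m else if i = 1 then 0 else frame_radius m)"
| "pty m V0 = 0"
| "pty m V1 = -2"
| "pty m W0 = 2"
| "pty m X0 = -4"
| "pty m Q0 = -5"
| "pty m P0 = -6"
| "pty m (PA k) = (if k = 0 then - 7 else stage (k - 1) - 3)"
| "pty m (PP k) = stage k - 2"
| "pty m (PQ k) = 2"

fun sgx :: "pt \<Rightarrow> real" where
  "sgx (Fr i s t) = pm s"
| "sgx V1 = -1" | "sgx (PQ k) = -1" | "sgx W0 = -1"
| "sgx V0 = 1" | "sgx X0 = 1" | "sgx P0 = 1" | "sgx Q0 = 1" | "sgx (PA k) = 1" | "sgx (PP k) = 1"

fun sgy :: "pt \<Rightarrow> real" where
  "sgy (Fr i s t) = pm t"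
| "sgy Q0 = -1" | "sgy (PA k) = -1" | "sgy W0 = -1"
| "sgy V0 = 1" | "sgy X0 = 1" | "sgy P0 = 1" | "sgy V1 = 1" | "sgy (PQ k) = 1" | "sgy (PP k) = 1"

fun lnx :: "ln \<Rightarrow> real" where
  "lnx G0 = -8" | "lnx H0 = -7" | "lnx J0 = -10" | "lnx L0 = -9" | "lnx L1 = -11" | "lnx L2 = -13"
| "lnx (LC k) = stage k - 1" | "lnx (LB k) = stage k - 3" | "lnx (LK k) = 2 * stage k - 8"
| "lnx AX = 0" | "lnx AY = 0"

fun lny :: "ln \<Rightarrow> real" where
  "lny G0 = -1" | "lny H0 = -3" | "lny J0 = -7" | "lny L0 = -4" | "lny L1 = -5" | "lny L2 = -6"
| "lny (LC k) = 1" | "lny (LB k) = stage k - 2" | "lny (LK k) = stage k - 4"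
| "lny AX = 0" | "lny AY = 0"

fun sg1 :: "ln \<Rightarrow> real" where
  "sg1 L0 = -1" | "sg1 L2 = -1" | "sg1 (LB k) = -1"
| "sg1 AX = 1" | "sg1 AY = 0" | "sg1 G0 = 1" | "sg1 H0 = 1" | "sg1 J0 = 1" | "sg1 L1 = 1"
| "sg1 (LC k) = 1" | "sg1 (LK k) = 1"

fun sg2 :: "ln \<Rightarrow> real" where
  "sg2 G0 = -1" | "sg2 J0 = -1"
| "sg2 AX = 0" | "sg2 AY = 1" | "sg2 H0 = 1" | "sg2 L0 = 1" | "sg2 L1 = 1" | "sg2 L2 = 1"
| "sg2 (LC k) = 1" | "sg2 (LB k) = 1" | "sg2 (LK k) = 1"

fun sg3 :: "ln \<Rightarrow> real" where
  "sg3 H0 = -1" | "sg3 L1 = -1" | "sg3 (LC k) = -1"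
| "sg3 AX = 0" | "sg3 AY = 0" | "sg3 G0 = 1" | "sg3 J0 = 1" | "sg3 L0 = 1" | "sg3 L2 = 1"
| "sg3 (LB k) = 1" | "sg3 (LK k) = 1"

text \<open>The affine function of \<open>M\<close>, scaled to constant term 1 or -1. For the axes
  the zero signs leave a single coordinate: \<open>AX\<close> is the function x, which vanishes on
  the y-axis.\<close>

definition lval :: "nat \<Rightarrow> ln \<Rightarrow> pt \<Rightarrow> real" where
  "lval m M p = sg1 M * exp (- lnx M) * (sgx p * exp (ptx m p)) +
     sg2 M * exp (- lny M) * (sgy p * exp (pty m p)) + sg3 M"

definition points :: "nat \<Rightarrow> pt set" where
  "points m = (\<lambda>(i, s, t). Fr i s t) ` ({..2} \<times> UNIV \<times> UNIV) \<union> {V0, V1, W0, X0, Q0, P0} \<union>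
     PA ` {..m} \<union> PP ` {..<m} \<union> PQ ` {..<m}"

definition plines :: "nat \<Rightarrow> ln set" where
  "plines m = {G0, H0, J0, L0, L1, L2} \<union> LC ` {..<m} \<union> LB ` {..<m} \<union> LK ` {..<m}"

definition lines :: "nat \<Rightarrow> ln set" where
  "lines m = {AX, AY} \<union> plines m"

text \<open>\<open>dom1\<close>, \<open>dom2\<close>, \<open>dom3\<close>: the first, second or third term of \<open>lval m M p\<close> has the opposite
  sign to the other two and exceeds each of them by a factor of at least \<open>exp 1\<close>.\<close>

definition dom1 :: "nat \<Rightarrow> pt \<Rightarrow> ln \<Rightarrow> bool" where
  "dom1 m p M \<longleftrightarrow> sg2 M * sgy p = - (sg1 M * sgx p) \<and> sg3 M = - (sg1 M * sgx p) \<and>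
     1 \<le> ptx m p - lnx M \<and> pty m p - lny M \<le> ptx m p - lnx M - 1"

definition dom2 :: "nat \<Rightarrow> pt \<Rightarrow> ln \<Rightarrow> bool" where
  "dom2 m p M \<longleftrightarrow> sg1 M * sgx p = - (sg2 M * sgy p) \<and> sg3 M = - (sg2 M * sgy p) \<and>
     1 \<le> pty m p - lny M \<and> ptx m p - lnx M \<le> pty m p - lny M - 1"

definition dom3 :: "nat \<Rightarrow> pt \<Rightarrow> ln \<Rightarrow> bool" where
  "dom3 m p M \<longleftrightarrow> sg1 M * sgx p = - sg3 M \<and> sg2 M * sgy p = - sg3 M \<and>
     ptx m p - lnx M \<le> - 1 \<and> pty m p - lny M \<le> - 1"

text \<open>The inequality e > 2 is why a margin of 1 in the exponents suffices in
  \<open>dom1\<close>, \<open>dom2\<close> and \<open>dom3\<close>.\<close>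

lemma exp_add_less:
  fixes u v w :: real
  assumes "u \<le> w - 1" "v \<le> w - 1"
  shows "exp u + exp v < exp w"
proof -
  have "exp u \<le> exp (w - 1)" "exp v \<le> exp (w - 1)" using assms by simp_all
  then have "exp u + exp v \<le> 2 * exp (w - 1)" by linarith
  also have "\<dots> < exp 1 * exp (w - 1)"
  proof (intro mult_strict_right_mono)
    have "(3 / 2 :: real) \<le> exp (1 / 2)" using exp_ge_add_one_self[of "1 / 2 :: real"] by simp
    then have "(3 / 2 :: real) * (3 / 2) \<le> exp (1 / 2) * exp (1 / 2)" by (intro mult_mono) auto
    then show "(2 :: real) < exp 1" by (simp flip: exp_add)
  qed simp
  also have "\<dots> = exp w" by (simp flip: exp_add)
  finally show ?thesis .
qed

section \<open>Signs in the model configuration\<close>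

lemma lval_exp:
  "lval m M p = sg1 M * sgx p * exp (ptx m p - lnx M) + sg2 M * sgy p * exp (pty m p - lny M) + sg3 M"
  by (simp add: lval_def exp_diff exp_minus field_simps)

lemma sg_abs: "M \<in> plines m \<Longrightarrow> \<bar>sg1 M\<bar> = 1 \<and> \<bar>sg2 M\<bar> = 1 \<and> \<bar>sg3 M\<bar> = 1"
  by (auto simp: plines_def)

lemma sgp_abs: "\<bar>sgx p\<bar> = 1" "\<bar>sgy p\<bar> = 1"
  by (cases p; simp add: pm_def)+

lemma lval_pos_dom1:
  assumes "dom1 m p M" "M \<in> plines m"
  shows "0 < (sg1 M * sgx p) * lval m M p"
proof -
  define e where "e = sg1 M * sgx p"
  have e: "e * e = 1" using sg_abs[OF assms(2)] sgp_abs[of p] unfolding e_def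
    by (auto simp: abs_if split: if_splits)
  have "e * lval m M p = e * e * (exp (ptx m p - lnx M) - exp (pty m p - lny M) - exp 0)"
    using assms(1) unfolding dom1_def lval_exp e_def[symmetric] by (simp add: algebra_simps)
  also have "0 < \<dots>" unfolding e using assms(1) exp_add_less[of "pty m p - lny M" "ptx m p - lnx M" 0]
    by (simp add: dom1_def)
  finally show ?thesis by (simp add: e_def)
qed

lemma lval_pos_dom2:
  assumes "dom2 m p M" "M \<in> plines m"
  shows "0 < (sg2 M * sgy p) * lval m M p"
proof -
  define e where "e = sg2 M * sgy p"
  have e: "e * e = 1" using sg_abs[OF assms(2)] sgp_abs[of p] unfolding e_def
    by (auto simp: abs_if split: if_splits)
  have "e * lval m M p = e * e * (exp (pty m p - lny M) - exp (ptx m p - lnx M) - exp 0)"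
    using assms(1) unfolding dom2_def lval_exp e_def[symmetric] by (simp add: algebra_simps)
  also have "0 < \<dots>" unfolding e using assms(1) exp_add_less[of "ptx m p - lnx M" "pty m p - lny M" 0]
    by (simp add: dom2_def)
  finally show ?thesis by (simp add: e_def)
qed

lemma lval_pos_dom3:
  assumes "dom3 m p M" "M \<in> plines m"
  shows "0 < sg3 M * lval m M p"
proof -
  have e: "sg3 M * sg3 M = 1" using sg_abs[OF assms(2)] by (auto simp: abs_if split: if_splits)
  have "sg3 M * lval m M p = sg3 M * sg3 M * (exp 0 - exp (ptx m p - lnx M) - exp (pty m p - lny M))"
    using assms(1) unfolding dom3_def lval_exp by (simp add: algebra_simps)
  also have "0 < \<dots>" unfolding e using assms(1) exp_add_less[of "ptx m p - lnx M" 0 "pty m p - lny M"]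
    by (simp add: dom3_def)
  finally show ?thesis .
qed

lemma stage_Suc: "stage (Suc k) = 2 * stage k - 8"
  by (simp add: stage_def)

lemma stage_0: "stage 0 = -14"
  by (simp add: stage_def)

lemma stage_mono: "k \<le> l \<Longrightarrow> stage l \<le> stage k"
  by (simp add: stage_def power_increasing)

lemma stage_le: "stage k \<le> -14"
  using stage_mono[of 0 k] by (simp add: stage_0)

lemma stage_ge_frame_radius:
  assumes "k \<le> m"
  shows "25 - frame_radius m \<le> 3 * stage k"
proof -
  define a b :: real where "a = 2 ^ k" and "b = 2 ^ m"
  have "a \<le> b" "1 \<le> b" using assms by (auto simp: a_def b_def intro: power_increasing)
  then show ?thesis unfolding stage_def frame_radius_def a_def[symmetric] b_def[symmetric] by simp
qed

lemma plines_frame_bound: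
  assumes "M \<in> plines m"
  shows "\<bar>lnx M\<bar> + \<bar>lny M\<bar> + 1 \<le> frame_radius m"
proof -
  have "1000 \<le> frame_radius m" by (simp add: frame_radius_def)
  moreover have "25 - frame_radius m \<le> 3 * stage k \<and> stage k \<le> -14" if "k < m" for k
    using stage_ge_frame_radius[of k m] stage_le[of k] that by simp
  ultimately show ?thesis using assms by (force simp: plines_def)
qed

text \<open>At \<open>Fr 0\<close> both coordinates are tiny and the constant term wins; at
  \<open>Fr 1\<close> and \<open>Fr 2\<close> the first or second coordinate is huge and its term
  wins. This holds for all four sign pairs, which \<open>signed_line_coefficients\<close> relies
  on.\<close>

lemma lval_frame0:
  assumes "M \<in> plines m"
  shows "0 < sg3 M * lval m M (Fr 0 s t)"
proof -
  have e: "sg3 M * sg3 M = 1" "\<bar>sg3 M * sg1 M * pm s\<bar> = 1" "\<bar>sg3 M * sg2 M * pm t\<bar> = 1"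
    using sg_abs[OF assms] by (auto simp: abs_mult pm_def abs_if split: if_splits)
  have "\<bar>c * x\<bar> \<le> x" if "\<bar>c\<bar> = 1" "0 \<le> x" for c x :: real using that by (simp add: abs_mult)
  from this[OF e(2), of "exp (- frame_radius m - lnx M)"] this[OF e(3), of "exp (- frame_radius m - lny M)"]
  have "- exp (- frame_radius m - lnx M) \<le> sg3 M * sg1 M * pm s * exp (- frame_radius m - lnx M)"
    "- exp (- frame_radius m - lny M) \<le> sg3 M * sg2 M * pm t * exp (- frame_radius m - lny M)"
    by (simp_all add: abs_le_iff)
  moreover have "exp (- frame_radius m - lnx M) + exp (- frame_radius m - lny M) < exp 0"
    using plines_frame_bound[OF assms] by (intro exp_add_less) auto
  moreover have "sg3 M * lval m M (Fr 0 s t) = sg3 M * sg1 M * pm s * exp (- frame_radius m - lnx M)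
    + sg3 M * sg2 M * pm t * exp (- frame_radius m - lny M) + sg3 M * sg3 M"
    by (simp add: lval_exp algebra_simps)
  ultimately show ?thesis using e(1) by simp
qed

lemma lval_frame1:
  assumes "M \<in> plines m"
  shows "0 < sg1 M * pm s * lval m M (Fr 1 s t)"
proof -
  have e: "sg1 M * pm s * (sg1 M * pm s) = 1" "\<bar>sg1 M * pm s * (sg2 M * pm t)\<bar> = 1" "\<bar>sg1 M * pm s * sg3 M\<bar> = 1"
    using sg_abs[OF assms] by (auto simp: abs_mult pm_def abs_if split: if_splits)
  have "\<bar>c * x\<bar> \<le> x" if "\<bar>c\<bar> = 1" "0 \<le> x" for c x :: real using that by (simp add: abs_mult)
  from this[OF e(2), of "exp (- lny M)"] this[OF e(3), of 1]
  have "- exp (- lny M) \<le> sg1 M * pm s * (sg2 M * pm t) * exp (- lny M)"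
    "- exp 0 \<le> sg1 M * pm s * sg3 M"
    by (simp_all add: abs_le_iff)
  moreover have "exp (- lny M) + exp 0 < exp (frame_radius m - lnx M)"
    using plines_frame_bound[OF assms] by (intro exp_add_less) auto
  moreover have "sg1 M * pm s * lval m M (Fr 1 s t) = sg1 M * pm s * (sg1 M * pm s) * exp (frame_radius m - lnx M)
    + sg1 M * pm s * (sg2 M * pm t) * exp (- lny M) + sg1 M * pm s * sg3 M"
    by (simp add: lval_exp algebra_simps)
  ultimately show ?thesis using e(1) by simp
qed

lemma lval_frame2:
  assumes "M \<in> plines m"
  shows "0 < sg2 M * pm t * lval m M (Fr 2 s t)"
proof -
  have e: "sg2 M * pm t * (sg2 M * pm t) = 1" "\<bar>sg2 M * pm t * (sg1 M * pm s)\<bar> = 1" "\<bar>sg2 M * pm t * sg3 M\<bar> = 1"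
    using sg_abs[OF assms] by (auto simp: abs_mult pm_def abs_if split: if_splits)
  have "\<bar>c * x\<bar> \<le> x" if "\<bar>c\<bar> = 1" "0 \<le> x" for c x :: real using that by (simp add: abs_mult)
  from this[OF e(2), of "exp (- lnx M)"] this[OF e(3), of 1]
  have "- exp (- lnx M) \<le> sg2 M * pm t * (sg1 M * pm s) * exp (- lnx M)"
    "- exp 0 \<le> sg2 M * pm t * sg3 M"
    by (simp_all add: abs_le_iff)
  moreover have "exp (- lnx M) + exp 0 < exp (frame_radius m - lny M)"
    using plines_frame_bound[OF assms] by (intro exp_add_less) auto
  moreover have "sg2 M * pm t * lval m M (Fr 2 s t) = sg2 M * pm t * (sg2 M * pm t) * exp (frame_radius m - lny M)
    + sg2 M * pm t * (sg1 M * pm s) * exp (- lnx M) + sg2 M * pm t * sg3 M"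
    by (simp add: lval_exp algebra_simps)
  ultimately show ?thesis using e(1) by simp
qed

lemma lval_axes:
  "lval m AX p = sgx p * exp (ptx m p)" "lval m AY p = sgy p * exp (pty m p)"
  by (simp_all add: lval_def)

lemma stage_incidences:
  assumes k: "k < m"
  shows "dom1 m (PA k) (LC k)" "dom3 m V0 (LC k)" "dom3 m (PP k) (LC k)" "dom1 m (PP k) (LB k)"
    "dom2 m W0 (LB k)" "dom2 m (PQ k) (LC k)" "dom1 m (PQ k) (LK k)"
    "dom3 m (PA (Suc k)) (LB k)" "dom2 m (PA (Suc k)) (LK k)"
  using stage_mono[of "Suc k" m] stage_le[of k] stage_le[of "k - 1"] k
  by (auto simp: dom1_def dom2_def dom3_def stage_Suc)

lemma base_incidences:
  shows "dom2 m V0 G0" "dom3 m V1 G0" "dom2 m V1 H0" "dom3 m X0 H0" "dom1 m W0 J0" "dom2 m X0 J0"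
    "dom2 m P0 J0" "dom1 m X0 L0" "dom3 m Q0 L0" "dom1 m Q0 L1" "dom2 m V1 L1" "dom3 m P0 L1"
    "dom1 m P0 L2" "dom3 m (PA 0) L2"
  using stage_le[of m] by (auto simp: dom1_def dom2_def dom3_def stage_0)

section \<open>Realizations of the sign pattern\<close>

text \<open>All that is kept of a realization: affine functions and points with the strict signs of
  the model. The function of \<open>M\<close> will be the difference of the squared distances to the
  two disk centres that encode \<open>M\<close>.\<close>

locale sign_realization =
  fixes m :: nat and g :: "ln \<Rightarrow> real^2" and h :: "ln \<Rightarrow> real" and z :: "pt \<Rightarrow> real^2"
  assumes pos: "M \<in> lines m \<Longrightarrow> p \<in> points m \<Longrightarrow> 0 < lval m M p \<Longrightarrow> 0 < g M \<bullet> z p + h M"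
    and neg: "M \<in> lines m \<Longrightarrow> p \<in> points m \<Longrightarrow> lval m M p < 0 \<Longrightarrow> g M \<bullet> z p + h M < 0"
begin

definition F :: "ln \<Rightarrow> pt \<Rightarrow> real" where "F M p = g M \<bullet> z p + h M"

definition X :: "pt \<Rightarrow> real" where "X p = F AX p"

definition Y :: "pt \<Rightarrow> real" where "Y p = F AY p"

lemma same_sign:
  assumes "M \<in> lines m" "p \<in> points m" "0 < e * lval m M p"
  shows "0 < e * F M p"
proof (cases "0 < e")
  case True
  then show ?thesis using assms pos[of M p] by (simp add: F_def zero_less_mult_iff)
next
  case False
  then have "e < 0" "lval m M p < 0" using assms(3) by (auto simp: zero_less_mult_iff)
  then show ?thesis using neg[OF assms(1,2)] by (simp add: F_def zero_less_mult_iff)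
qed

lemma Fr_in_points [simp]: "i \<le> 2 \<Longrightarrow> Fr i s t \<in> points m"
  unfolding points_def by (intro UnI1 image_eqI[of _ _ "(i, s, t)"]) auto

lemma sgx_X: "p \<in> points m \<Longrightarrow> 0 < sgx p * X p"
  unfolding X_def
proof (rule same_sign)
  have "sgx p * sgx p = 1" using sgp_abs(1)[of p] by (cases "0 \<le> sgx p") (simp_all add: abs_if split: if_splits)
  then show "0 < sgx p * lval m AX p" by (simp add: lval_axes flip: mult.assoc)
qed (simp_all add: lines_def)

lemma sgy_Y: "p \<in> points m \<Longrightarrow> 0 < sgy p * Y p"
  unfolding Y_def
proof (rule same_sign)
  have "sgy p * sgy p = 1" using sgp_abs(2)[of p] by (cases "0 \<le> sgy p") (simp_all add: abs_if split: if_splits)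
  then show "0 < sgy p * lval m AY p" by (simp add: lval_axes flip: mult.assoc)
qed (simp_all add: lines_def)

text \<open>Dependent normals would make a nontrivial combination \<alpha> X + \<beta> Y constant.
  The points \<open>Fr 0 s t\<close> show every sign pair for X and Y, so this constant would be
  positive and at most 0.\<close>

lemma axes_independent: "g AX $ 1 * g AY $ 2 - g AX $ 2 * g AY $ 1 \<noteq> 0"
proof
  assume D: "g AX $ 1 * g AY $ 2 - g AX $ 2 * g AY $ 1 = 0"
  have "\<exists>\<alpha> \<beta>. (\<alpha> \<noteq> 0 \<or> \<beta> \<noteq> 0) \<and> \<alpha> *\<^sub>R g AX + \<beta> *\<^sub>R g AY = 0"
  proof (cases "g AX = 0 \<and> g AY = 0")
    case True
    then show ?thesis by (intro exI[of _ 1] exI[of _ 0]) simp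
  next
    case False
    show ?thesis
    proof (cases "g AY $ 1 \<noteq> 0 \<or> g AX $ 1 \<noteq> 0")
      case True
      then show ?thesis using D
        by (intro exI[of _ "g AY $ 1"] exI[of _ "- g AX $ 1"]) (auto simp: vec_eq_iff forall_2 algebra_simps)
    next
      case F: False
      then have "g AY $ 2 \<noteq> 0 \<or> g AX $ 2 \<noteq> 0" using False by (auto simp: vec_eq_iff forall_2)
      then show ?thesis using F
        by (intro exI[of _ "g AY $ 2"] exI[of _ "- g AX $ 2"]) (auto simp: vec_eq_iff forall_2 algebra_simps)
    qed
  qed
  then obtain \<alpha> \<beta> where ab: "\<alpha> \<noteq> 0 \<or> \<beta> \<noteq> 0" "\<alpha> *\<^sub>R g AX + \<beta> *\<^sub>R g AY = 0" by blast
  have const: "\<alpha> * X p + \<beta> * Y p = \<alpha> * h AX + \<beta> * h AY" for p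
  proof -
    have "\<alpha> * X p + \<beta> * Y p = (\<alpha> *\<^sub>R g AX + \<beta> *\<^sub>R g AY) \<bullet> z p + (\<alpha> * h AX + \<beta> * h AY)"
      by (simp add: X_def Y_def F_def inner_add_left algebra_simps)
    then show ?thesis by (simp add: ab(2))
  qed
  define p where "p = Fr 0 (0 < \<alpha>) (0 < \<beta>)"
  define q where "q = Fr 0 (\<not> 0 < \<alpha>) (\<not> 0 < \<beta>)"
  have pq: "p \<in> points m" "q \<in> points m" by (simp_all add: p_def q_def)
  have "0 < pm (0 < \<alpha>) * X p" "0 < pm (0 < \<beta>) * Y p" "0 < pm (\<not> 0 < \<alpha>) * X q" "0 < pm (\<not> 0 < \<beta>) * Y q"
    using sgx_X[OF pq(1)] sgy_Y[OF pq(1)] sgx_X[OF pq(2)] sgy_Y[OF pq(2)] by (simp_all add: p_def q_def)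
  then have "0 \<le> \<alpha> * X p \<and> 0 \<le> \<beta> * Y p \<and> \<alpha> * X q \<le> 0 \<and> \<beta> * Y q \<le> 0 \<and>
    (\<alpha> \<noteq> 0 \<longrightarrow> 0 < \<alpha> * X p) \<and> (\<beta> \<noteq> 0 \<longrightarrow> 0 < \<beta> * Y p)"
    by (auto simp: pm_def mult_le_0_iff zero_le_mult_iff zero_less_mult_iff split: if_splits)
  then show False using const[of p] const[of q] ab(1) by force
qed

lemma line_coefficients:
  "\<exists>a b c. \<forall>p. F M p = a * X p + b * Y p + c"
proof -
  define D where "D = g AX $ 1 * g AY $ 2 - g AX $ 2 * g AY $ 1"
  have D: "D \<noteq> 0" using axes_independent by (simp add: D_def)
  define a where "a = (g M $ 1 * g AY $ 2 - g M $ 2 * g AY $ 1) / D"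
  define b where "b = (g AX $ 1 * g M $ 2 - g AX $ 2 * g M $ 1) / D"
  have 1: "a * g AX $ 1 + b * g AY $ 1 = g M $ 1"
  proof -
    have "D * (a * g AX $ 1 + b * g AY $ 1) = D * g M $ 1"
      using D by (simp add: a_def b_def distrib_left) (simp add: D_def algebra_simps)
    then show ?thesis using D by simp
  qed
  have 2: "a * g AX $ 2 + b * g AY $ 2 = g M $ 2"
  proof -
    have "D * (a * g AX $ 2 + b * g AY $ 2) = D * g M $ 2"
      using D by (simp add: a_def b_def distrib_left) (simp add: D_def algebra_simps)
    then show ?thesis using D by simp
  qed
  have gM: "g M = a *\<^sub>R g AX + b *\<^sub>R g AY" using 1 2 by (simp add: vec_eq_iff forall_2)
  have "F M p = a * X p + b * Y p + (h M - a * h AX - b * h AY)" for p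
    unfolding F_def X_def Y_def gM by (simp add: inner_add_left algebra_simps)
  then show ?thesis by blast
qed

text \<open>To isolate one coefficient, a frame point is chosen whose signs make the other two terms
  nonpositive, after multiplication by the known sign of the value. The remaining term must then be
  positive. Only signs of coordinates are used, never sizes.\<close>

lemma signed_line_coefficients:
  assumes M: "M \<in> plines m"
  shows "\<exists>a b c. (\<forall>p. F M p = a * X p + b * Y p + c) \<and> 0 < sg1 M * a \<and> 0 < sg2 M * b \<and> 0 < sg3 M * c"
proof -
  obtain a b c where abc: "\<And>p. F M p = a * X p + b * Y p + c" using line_coefficients by blast
  have Mlin: "M \<in> lines m" using M by (simp add: lines_def)
  have Xs: "0 < pm s * X (Fr i s t)" and Ys: "0 < pm t * Y (Fr i s t)" if "i \<le> 2" for i s t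
    using sgx_X[of "Fr i s t"] sgy_Y[of "Fr i s t"] that by simp_all
  have le0: "e * x \<le> 0" if "0 < pm (e < 0) * x" for e x :: real
    using that by (auto simp: pm_def mult_le_0_iff split: if_splits)
  have pm2: "pm s * (pm s * x) = x" for s x by (simp add: pm_def)
  have s1: "sg1 M * sg1 M = 1" and s2: "sg2 M * sg2 M = 1" using sg_abs[OF M] by (auto simp: abs_if split: if_splits)
  have "0 < sg3 M * c"
  proof -
    define s t where "s = (sg3 M * a < 0)" and "t = (sg3 M * b < 0)"
    have "0 < sg3 M * F M (Fr 0 s t)" using same_sign[OF Mlin _ lval_frame0[OF M]] by simp
    moreover have "sg3 M * a * X (Fr 0 s t) \<le> 0" "sg3 M * b * Y (Fr 0 s t) \<le> 0"
      using le0[of "sg3 M * a"] le0[of "sg3 M * b"] Xs[of 0 s t] Ys[of 0 t s] unfolding s_def t_def by simp_all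
    ultimately show ?thesis unfolding abc by (simp add: algebra_simps)
  qed
  moreover have "0 < sg1 M * a"
  proof -
    define s where "s = (sg1 M * c < 0)"
    define e where "e = sg1 M * pm s"
    define t where "t = (e * b < 0)"
    have "0 < e * F M (Fr 1 s t)" using same_sign[OF Mlin _ lval_frame1[OF M]] by (simp add: e_def)
    moreover have "e * b * Y (Fr 1 s t) \<le> 0" using le0[of "e * b"] Ys[of 1 t s] unfolding t_def by simp
    moreover have "e * c \<le> 0" by (auto simp: e_def s_def pm_def)
    ultimately have "0 < e * a * X (Fr 1 s t)" unfolding abc by (simp add: algebra_simps)
    then have "0 < (sg1 M * a) * (pm s * X (Fr 1 s t))" by (simp add: e_def algebra_simps)
    then show ?thesis by (rule zero_less_mult_pos2) (rule Xs, simp)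
  qed
  moreover have "0 < sg2 M * b"
  proof -
    define t where "t = (sg2 M * c < 0)"
    define e where "e = sg2 M * pm t"
    define s where "s = (e * a < 0)"
    have "0 < e * F M (Fr 2 s t)" using same_sign[OF Mlin _ lval_frame2[OF M]] by (simp add: e_def)
    moreover have "e * a * X (Fr 2 s t) \<le> 0" using le0[of "e * a"] Xs[of 2 s t] unfolding s_def by simp
    moreover have "e * c \<le> 0" by (auto simp: e_def t_def pm_def)
    ultimately have "0 < e * b * Y (Fr 2 s t)" unfolding abc by (simp add: algebra_simps)
    then have "0 < (sg2 M * b) * (pm t * Y (Fr 2 s t))" by (simp add: e_def algebra_simps)
    then show ?thesis by (rule zero_less_mult_pos2) (rule Ys, simp)
  qed
  ultimately show ?thesis using abc by blast
qed

text \<open>\<open>qx M\<close> and \<open>qy M\<close> are the logarithms of the absolute intercepts of the line \<open>M\<close> on the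
  axes \<open>AX\<close>, \<open>AY\<close> of the realization.\<close>

definition px :: "pt \<Rightarrow> real" where "px p = ln \<bar>X p\<bar>"

definition py :: "pt \<Rightarrow> real" where "py p = ln \<bar>Y p\<bar>"

definition coef :: "ln \<Rightarrow> real \<times> real \<times> real" where
  "coef M = (SOME (a, b, c). (\<forall>p. F M p = a * X p + b * Y p + c) \<and>
     0 < sg1 M * a \<and> 0 < sg2 M * b \<and> 0 < sg3 M * c)"

definition qx :: "ln \<Rightarrow> real" where "qx M = (case coef M of (a, b, c) \<Rightarrow> ln \<bar>c\<bar> - ln \<bar>a\<bar>)"

definition qy :: "ln \<Rightarrow> real" where "qy M = (case coef M of (a, b, c) \<Rightarrow> ln \<bar>c\<bar> - ln \<bar>b\<bar>)"

lemma coef_props: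
  assumes "M \<in> plines m"
  obtains a b c where "\<And>p. F M p = a * X p + b * Y p + c" "0 < sg1 M * a" "0 < sg2 M * b" "0 < sg3 M * c"
    "qx M = ln \<bar>c\<bar> - ln \<bar>a\<bar>" "qy M = ln \<bar>c\<bar> - ln \<bar>b\<bar>"
proof -
  obtain a b c where coef: "coef M = (a, b, c)" by (cases "coef M")
  have "case coef M of (a, b, c) \<Rightarrow> (\<forall>p. F M p = a * X p + b * Y p + c) \<and>
     0 < sg1 M * a \<and> 0 < sg2 M * b \<and> 0 < sg3 M * c"
    unfolding coef_def using signed_line_coefficients[OF assms]
    by (intro someI_ex[of "\<lambda>(a, b, c). (\<forall>p. F M p = a * X p + b * Y p + c) \<and>
     0 < sg1 M * a \<and> 0 < sg2 M * b \<and> 0 < sg3 M * c"]) auto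
  then show thesis using that[of a b c] by (simp add: coef qx_def qy_def)
qed

lemma terms_exp:
  assumes "p \<in> points m" "a \<noteq> 0" "b \<noteq> 0" "c \<noteq> 0" "qx M = ln \<bar>c\<bar> - ln \<bar>a\<bar>" "qy M = ln \<bar>c\<bar> - ln \<bar>b\<bar>"
  shows "\<bar>a * X p\<bar> = \<bar>c\<bar> * exp (px p - qx M)" "\<bar>b * Y p\<bar> = \<bar>c\<bar> * exp (py p - qy M)"
proof -
  have nz: "X p \<noteq> 0" "Y p \<noteq> 0" using sgx_X[OF assms(1)] sgy_Y[OF assms(1)] by auto
  have "px p - qx M = ln \<bar>X p\<bar> + ln \<bar>a\<bar> - ln \<bar>c\<bar>" "py p - qy M = ln \<bar>Y p\<bar> + ln \<bar>b\<bar> - ln \<bar>c\<bar>"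
    using assms(5,6) by (simp_all add: px_def py_def)
  then have "exp (px p - qx M) = \<bar>X p\<bar> * \<bar>a\<bar> / \<bar>c\<bar>" "exp (py p - qy M) = \<bar>Y p\<bar> * \<bar>b\<bar> / \<bar>c\<bar>"
    using nz assms(2-4) by (simp_all add: exp_add exp_diff)
  then show "\<bar>a * X p\<bar> = \<bar>c\<bar> * exp (px p - qx M)" "\<bar>b * Y p\<bar> = \<bar>c\<bar> * exp (py p - qy M)"
    using assms(4) by (simp_all add: abs_mult)
qed

lemma sign_mult_abs:
  fixes e :: real
  assumes "\<bar>e\<bar> = 1" "0 < e * x"
  shows "e * \<bar>x\<bar> = x"
proof -
  have "e = 1 \<or> e = -1" using assms(1) by linarith
  then show ?thesis using assms(2) by auto
qed

text \<open>All three terms have the same signs as in the model. Dividing by |c| and by the common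
  sign therefore turns the sign of \<open>F M p\<close> into an inequality between exponentials of
  the logarithmic coordinates.\<close>

lemma dom_exp:
  assumes p: "p \<in> points m" and M: "M \<in> plines m"
  shows "dom1 m p M \<Longrightarrow> exp (py p - qy M) + 1 < exp (px p - qx M)"
    and "dom2 m p M \<Longrightarrow> exp (px p - qx M) + 1 < exp (py p - qy M)"
    and "dom3 m p M \<Longrightarrow> exp (px p - qx M) + exp (py p - qy M) < 1"
proof -
  obtain a b c where abc: "\<And>p. F M p = a * X p + b * Y p + c"
    "0 < sg1 M * a" "0 < sg2 M * b" "0 < sg3 M * c"
    "qx M = ln \<bar>c\<bar> - ln \<bar>a\<bar>" "qy M = ln \<bar>c\<bar> - ln \<bar>b\<bar>"
    using coef_props[OF M] by blast
  have nz: "a \<noteq> 0" "b \<noteq> 0" "c \<noteq> 0" using abc by auto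
  have Mlin: "M \<in> lines m" using M by (simp add: lines_def)
  note sM = sg_abs[OF M]
  define ex ey where "ex = exp (px p - qx M)" and "ey = exp (py p - qy M)"
  have ab: "a = sg1 M * \<bar>a\<bar>" "b = sg2 M * \<bar>b\<bar>" "c = sg3 M * \<bar>c\<bar>" "X p = sgx p * \<bar>X p\<bar>" "Y p = sgy p * \<bar>Y p\<bar>"
    using sign_mult_abs[of "sg1 M" a] sign_mult_abs[of "sg2 M" b] sign_mult_abs[of "sg3 M" c]
      sign_mult_abs[of "sgx p" "X p"] sign_mult_abs[of "sgy p" "Y p"]
      sM abc sgp_abs sgx_X[OF p] sgy_Y[OF p] by auto
  have "a * X p = sg1 M * sgx p * \<bar>a * X p\<bar>" using ab(1,4) by (metis abs_mult mult.assoc mult.left_commute)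
  moreover have "b * Y p = sg2 M * sgy p * \<bar>b * Y p\<bar>" using ab(2,5) by (metis abs_mult mult.assoc mult.left_commute)
  ultimately have "F M p = sg1 M * sgx p * (\<bar>c\<bar> * ex) + sg2 M * sgy p * (\<bar>c\<bar> * ey) + sg3 M * \<bar>c\<bar>"
    unfolding abc(1) ex_def ey_def terms_exp[OF p nz abc(5,6), symmetric] using ab(3) by simp
  then have F: "F M p = \<bar>c\<bar> * (sg1 M * sgx p * ex + sg2 M * sgy p * ey + sg3 M)"
    by (simp add: algebra_simps)
  have c0: "0 < \<bar>c\<bar>" using nz by simp
  have sq: "e * e = 1" if "\<bar>e\<bar> = 1" for e :: real using that by (auto simp: abs_if split: if_splits)
  have s: "sg1 M * sgx p * (sg1 M * sgx p) = 1" "sg2 M * sgy p * (sg2 M * sgy p) = 1" "sg3 M * sg3 M = 1"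
    using sq sM sgp_abs by (auto simp: abs_mult)
  show "exp (py p - qy M) + 1 < exp (px p - qx M)" if d: "dom1 m p M"
  proof -
    define e where "e = sg1 M * sgx p"
    have "0 < e * F M p" unfolding e_def by (rule same_sign[OF Mlin p lval_pos_dom1[OF d M]])
    also have "e * F M p = \<bar>c\<bar> * (e * e * (ex - ey - 1))"
      using d unfolding F dom1_def e_def[symmetric] by (simp add: algebra_simps)
    finally show ?thesis using c0 s(1) unfolding e_def[symmetric] ex_def ey_def by (simp add: zero_less_mult_iff)
  qed
  show "exp (px p - qx M) + 1 < exp (py p - qy M)" if d: "dom2 m p M"
  proof -
    define e where "e = sg2 M * sgy p"
    have "0 < e * F M p" unfolding e_def by (rule same_sign[OF Mlin p lval_pos_dom2[OF d M]])
    also have "e * F M p = \<bar>c\<bar> * (e * e * (ey - ex - 1))"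
      using d unfolding F dom2_def e_def[symmetric] by (simp add: algebra_simps)
    finally show ?thesis using c0 s(2) unfolding e_def[symmetric] ex_def ey_def by (simp add: zero_less_mult_iff)
  qed
  show "exp (px p - qx M) + exp (py p - qy M) < 1" if d: "dom3 m p M"
  proof -
    have "0 < sg3 M * F M p" by (rule same_sign[OF Mlin p lval_pos_dom3[OF d M]])
    also have "sg3 M * F M p = \<bar>c\<bar> * (sg3 M * sg3 M * (1 - ex - ey))"
      using d unfolding F dom3_def by (simp add: algebra_simps)
    finally show ?thesis using c0 s(3) unfolding ex_def ey_def by (simp add: zero_less_mult_iff)
  qed
qed

text \<open>Domination over each other term separately is linear in the logarithms. Against the
  constant it compares a point with an intercept; between the two variable terms it compares |Y / X|
  with the ratio of the intercepts.\<close>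

lemma dom_less:
  assumes "p \<in> points m" "M \<in> plines m"
  shows "dom1 m p M \<Longrightarrow> qx M < px p \<and> py p - px p < qy M - qx M"
    and "dom2 m p M \<Longrightarrow> qy M < py p \<and> qy M - qx M < py p - px p"
    and "dom3 m p M \<Longrightarrow> px p < qx M \<and> py p < qy M"
proof -
  have e: "0 < exp (px p - qx M)" "0 < exp (py p - qy M)" by simp_all
  show "qx M < px p \<and> py p - px p < qy M - qx M" if "dom1 m p M"
  proof -
    have "1 < exp (px p - qx M)" "exp (py p - qy M) < exp (px p - qx M)"
      using dom_exp(1)[OF assms that] e by linarith+
    then show ?thesis by simp
  qed
  show "qy M < py p \<and> qy M - qx M < py p - px p" if "dom2 m p M"
  proof -
    have "1 < exp (py p - qy M)" "exp (px p - qx M) < exp (py p - qy M)"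
      using dom_exp(2)[OF assms that] e by linarith+
    then show ?thesis by simp
  qed
  show "px p < qx M \<and> py p < qy M" if "dom3 m p M"
  proof -
    have "exp (px p - qx M) < 1" "exp (py p - qy M) < 1"
      using dom_exp(3)[OF assms that] e by linarith+
    then show ?thesis by simp
  qed
qed

section \<open>The chain of dominations and its doubling\<close>

lemma in_points:
  "{V0, V1, W0, X0, Q0, P0} \<subseteq> points m" "k \<le> m \<Longrightarrow> PA k \<in> points m"
  "k < m \<Longrightarrow> PP k \<in> points m" "k < m \<Longrightarrow> PQ k \<in> points m"
  by (auto simp: points_def)

lemma in_plines:
  "{G0, H0, J0, L0, L1, L2} \<subseteq> plines m"
  "k < m \<Longrightarrow> LC k \<in> plines m" "k < m \<Longrightarrow> LB k \<in> plines m" "k < m \<Longrightarrow> LK k \<in> plines m"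
  by (auto simp: plines_def)

text \<open>A logarithm that is invariant under rescaling either axis.\<close>

definition gap :: "nat \<Rightarrow> real" where
  "gap k = px (PA k) + (py W0 - px W0) - py V0"

text \<open>All quantities are in absolute value; let r = Y W0 / X W0. \<open>LC k\<close> has its
  x-intercept below X (PA k) and its y-intercept above Y V0, and \<open>PQ k\<close> and
  \<open>LK k\<close> hand the ratio of these intercepts on: Y / X at \<open>PA (Suc k)\<close>
  exceeds Y V0 / X (PA k). \<open>PP k\<close>, \<open>LB k\<close> and \<open>W0\<close> bound Y
  (PA (Suc k)) by r X (PA k). Hence X (PA (Suc k)) < r X (PA k)^2 / Y V0, and \<open>gap\<close> is
  the normalization that makes this a doubling.\<close>

lemma gap_Suc:
  assumes k: "k < m"
  shows "gap (Suc k) \<le> 2 * gap k"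
proof -
  note P = in_points(1)[THEN subsetD] in_points(2)[of k] in_points(2)[of "Suc k"] in_points(3,4)[OF k]
  note L = in_plines(2-4)[OF k]
  note I = stage_incidences[OF k]
  have A: "PA k \<in> points m" "PA (Suc k) \<in> points m" "V0 \<in> points m" "W0 \<in> points m"
    using P k by auto
  note C = dom_less(1)[OF A(1) L(1) I(1), THEN conjunct1] dom_less(3)[OF A(3) L(1) I(2), THEN conjunct2]
  note B = dom_less(3)[OF in_points(3)[OF k] L(1) I(3), THEN conjunct1]
    dom_less(1)[OF in_points(3)[OF k] L(2) I(4), THEN conjunct1] dom_less(2)[OF A(4) L(2) I(5), THEN conjunct2]
  note K = dom_less(2)[OF in_points(4)[OF k] L(1) I(6), THEN conjunct2]
    dom_less(1)[OF in_points(4)[OF k] L(3) I(7), THEN conjunct2] dom_less(2)[OF A(2) L(3) I(9), THEN conjunct2]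
  have "qy (LB k) < px (PA k) + (py W0 - px W0)" using C(1) B by linarith
  moreover have "py V0 - px (PA k) < py (PA (Suc k)) - px (PA (Suc k))" using C K by linarith
  moreover have "py (PA (Suc k)) < qy (LB k)" using dom_less(3)[OF A(2) L(2) I(8)] by simp
  ultimately have "gap (Suc k) \<le> gap k + gap k" unfolding gap_def by linarith
  then show ?thesis by simp
qed

text \<open>Pairwise comparisons would only give a negative start, possibly very close to 0. At
  \<open>P0\<close> the constant of \<open>L1\<close> exceeds the sum of two terms, relatively at
  least e^b each, hence 2 e^b < 1.\<close>

lemma gap_0: "gap 0 \<le> - ln 2"
proof -
  have P: "V0 \<in> points m" "V1 \<in> points m" "W0 \<in> points m" "X0 \<in> points m" "Q0 \<in> points m" "P0 \<in> points m"
    "PA 0 \<in> points m"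
    using in_points(1,2) by auto
  have L: "G0 \<in> plines m" "H0 \<in> plines m" "J0 \<in> plines m" "L0 \<in> plines m" "L1 \<in> plines m" "L2 \<in> plines m"
    using in_plines(1) by auto
  note I = base_incidences[of m]
  define b where "b = px P0 + (py W0 - px W0) - py V0"
  note W = dom_less(1)[OF P(3) L(3) I(5), THEN conjunct2]
  have V1: "py V1 < py V0"
    using dom_less(2)[OF P(1) L(1) I(1), THEN conjunct1] dom_less(3)[OF P(2) L(1) I(2), THEN conjunct2] by linarith
  have "py X0 < py V0"
    using V1 dom_less(2)[OF P(2) L(2) I(3), THEN conjunct1] dom_less(3)[OF P(4) L(2) I(4), THEN conjunct2] by linarith
  moreover have "py W0 - px W0 < py X0 - px X0"
    using W dom_less(2)[OF P(4) L(3) I(6), THEN conjunct2] by linarith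
  moreover have "qx L1 < px X0"
    using dom_less(1)[OF P(4) L(4) I(8), THEN conjunct1] dom_less(3)[OF P(5) L(4) I(9), THEN conjunct1]
      dom_less(1)[OF P(5) L(5) I(10), THEN conjunct1] by linarith
  ultimately have "b \<le> px P0 - qx L1" unfolding b_def by linarith
  moreover have "b \<le> py P0 - qy L1"
    using W V1 dom_less(2)[OF P(6) L(3) I(7), THEN conjunct2] dom_less(2)[OF P(2) L(5) I(11), THEN conjunct1]
    unfolding b_def by linarith
  moreover have "gap 0 \<le> b"
    using dom_less(1)[OF P(6) L(6) I(13), THEN conjunct1] dom_less(3)[OF P(7) L(6) I(14), THEN conjunct1]
    unfolding gap_def b_def by linarith
  ultimately have b: "b \<le> px P0 - qx L1" "b \<le> py P0 - qy L1" "gap 0 \<le> b" by blast+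
  from b have "exp b \<le> exp (px P0 - qx L1)" "exp b \<le> exp (py P0 - qy L1)" by simp_all
  then have "2 * exp b < 1" using dom_exp(3)[OF P(6) L(5) I(12)] by linarith
  then have "exp b < exp (- ln 2)" by (simp add: exp_minus)
  then show ?thesis using \<open>gap 0 \<le> b\<close> by simp
qed

lemma gap_le: "k \<le> m \<Longrightarrow> gap k \<le> - (2 ^ k * ln 2)"
proof (induction k)
  case 0
  then show ?case using gap_0 by simp
next
  case (Suc k)
  then show ?case using gap_Suc[of k] by simp
qed

lemma cross_ratio_bound: "2 ^ 2 ^ m * (\<bar>X (PA m)\<bar> * \<bar>Y W0\<bar>) \<le> \<bar>X W0\<bar> * \<bar>Y V0\<bar>"
proof -
  have nz: "X (PA m) \<noteq> 0" "Y W0 \<noteq> 0" "X W0 \<noteq> 0" "Y V0 \<noteq> 0"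
    using sgx_X[of "PA m"] sgx_X[of W0] sgy_Y[of W0] sgy_Y[of V0] in_points by auto
  have "ln (2 ^ 2 ^ m * (\<bar>X (PA m)\<bar> * \<bar>Y W0\<bar>)) \<le> ln (\<bar>X W0\<bar> * \<bar>Y V0\<bar>)"
    using gap_le[of m] nz by (simp add: gap_def px_def py_def ln_mult ln_realpow)
  then show ?thesis using nz by (subst (asm) ln_le_cancel_iff) auto
qed

end

section \<open>Lower bound for unit disk graphs\<close>

text \<open>A line is encoded by two nearly tangent unit disks, one on either side. On a configuration
  shrunk by \<open>\<epsilon>\<close> their boundaries are within \<open>O(\<epsilon>\<^sup>2)\<close> of the line.\<close>

lemma lines_encoded_by_disks:
  fixes z :: "'p \<Rightarrow> 'a :: real_inner" and g :: "'l \<Rightarrow> 'a" and h :: "'l \<Rightarrow> real"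
  assumes P: "finite P" and L: "finite L" and g: "\<And>l. l \<in> L \<Longrightarrow> g l \<noteq> 0"
  shows "\<exists>(w :: 'p \<Rightarrow> 'a) a b. \<forall>p\<in>P. \<forall>l\<in>L.
    (0 < g l \<bullet> z p + h l \<longrightarrow> dist (w p) (a l) < 1 \<and> 1 \<le> dist (w p) (b l)) \<and>
    (g l \<bullet> z p + h l < 0 \<longrightarrow> dist (w p) (b l) < 1 \<and> 1 \<le> dist (w p) (a l))"
proof -
  define \<nu> where "\<nu> l = (1 / norm (g l)) *\<^sub>R g l" for l
  define d where "d l = h l / norm (g l)" for l
  define s where "s l p = z p \<bullet> \<nu> l + d l" for l p
  \<comment> \<open>The squared norm of z + d \<nu>. It is the coefficient of \<epsilon>^2 in the
    squared distance to either centre, that is, the second-order deviation of the circle from its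
    tangent.\<close>
  define T where "T l p = z p \<bullet> z p + 2 * d l * (z p \<bullet> \<nu> l) + (d l)\<^sup>2" for l p
  have unit: "\<nu> l \<bullet> \<nu> l = 1" if "l \<in> L" for l
    using g[OF that] by (simp add: \<nu>_def dot_square_norm power2_eq_square)
  have s: "g l \<bullet> z p + h l = norm (g l) * s l p" if "l \<in> L" for l p
    using g[OF that] by (simp add: s_def \<nu>_def d_def inner_commute distrib_left)
  have T0: "0 \<le> T l p" if "l \<in> L" for l p
  proof -
    have "T l p = (z p + d l *\<^sub>R \<nu> l) \<bullet> (z p + d l *\<^sub>R \<nu> l)"
      using unit[OF that] by (simp add: T_def inner_add_left inner_add_right inner_commute power2_eq_square algebra_simps)
    then show ?thesis by simp
  qed
  have "eventually (\<lambda>\<epsilon>. \<epsilon> * T l p < 2 * \<bar>s l p\<bar>) (at_right 0)" if "s l p \<noteq> 0" for l p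
  proof -
    have "((\<lambda>\<epsilon>. \<epsilon> * T l p) \<longlongrightarrow> 0) (at_right 0)" by (auto intro!: tendsto_eq_intros)
    then show ?thesis using that by (intro order_tendstoD) auto
  qed
  then have "eventually (\<lambda>\<epsilon>. \<forall>p\<in>P. \<forall>l\<in>L. s l p \<noteq> 0 \<longrightarrow> \<epsilon> * T l p < 2 * \<bar>s l p\<bar>) (at_right 0)"
    by (intro eventually_ball_finite P L ballI) (auto simp: eventually_conj_iff)
  moreover have "eventually (\<lambda>\<epsilon>::real. 0 < \<epsilon>) (at_right 0)" by (simp add: eventually_at_right_less)
  ultimately have "eventually (\<lambda>\<epsilon>. 0 < \<epsilon> \<and> (\<forall>p\<in>P. \<forall>l\<in>L. s l p \<noteq> 0 \<longrightarrow> \<epsilon> * T l p < 2 * \<bar>s l p\<bar>)) (at_right 0)"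
    by eventually_elim auto
  then obtain \<epsilon> :: real where \<epsilon>: "0 < \<epsilon>"
    "\<And>p l. p \<in> P \<Longrightarrow> l \<in> L \<Longrightarrow> s l p \<noteq> 0 \<Longrightarrow> \<epsilon> * T l p < 2 * \<bar>s l p\<bar>"
    using eventually_happens'[OF trivial_limit_at_right_real] by (metis (mono_tags, lifting))
  define w where "w p = \<epsilon> *\<^sub>R z p" for p
  \<comment> \<open>The circles of radius 1 about \<open>c 1 l\<close> and \<open>c (-1) l\<close>
    touch the shrunk line \<nu> . w + \<epsilon> d = 0 from opposite sides, both at the point
    -\<epsilon> d \<nu>.\<close>
  define c where "c \<sigma> l = (\<sigma> - \<epsilon> * d l) *\<^sub>R \<nu> l" for \<sigma> l
  have dist: "(dist (w p) (c \<sigma> l))\<^sup>2 = \<sigma>\<^sup>2 - 2 * \<sigma> * \<epsilon> * s l p + \<epsilon> * (\<epsilon> * T l p)" if "l \<in> L" for \<sigma> p l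
  proof -
    have "(dist (w p) (c \<sigma> l))\<^sup>2 = \<epsilon>\<^sup>2 * (z p \<bullet> z p) - 2 * \<epsilon> * (\<sigma> - \<epsilon> * d l) * (z p \<bullet> \<nu> l) + (\<sigma> - \<epsilon> * d l)\<^sup>2"
      unfolding w_def c_def dist_norm power2_norm_eq_inner using unit[OF that]
      by (simp add: inner_diff_left inner_diff_right inner_commute power2_eq_square algebra_simps)
    then show ?thesis by (simp add: s_def T_def power2_eq_square algebra_simps)
  qed
  have key: "dist (w p) (c \<sigma> l) < 1 \<and> 1 \<le> dist (w p) (c (- \<sigma>) l)"
    if pl: "p \<in> P" "l \<in> L" and \<sigma>: "\<sigma>\<^sup>2 = 1" "0 < \<sigma> * s l p" for p l \<sigma>
  proof -
    have "\<sigma> = 1 \<or> \<sigma> = -1" using \<sigma>(1) by (simp add: power2_eq_1_iff)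
    then have abs: "\<bar>s l p\<bar> = \<sigma> * s l p" using \<sigma>(2) by auto
    then have "\<epsilon> * T l p < 2 * (\<sigma> * s l p)" using \<epsilon>(2)[OF pl] \<sigma>(2) by auto
    then have "\<epsilon> * (\<epsilon> * T l p) < \<epsilon> * (2 * (\<sigma> * s l p))" using \<epsilon>(1) by simp
    then have "(dist (w p) (c \<sigma> l))\<^sup>2 < 1\<^sup>2" unfolding dist[OF pl(2)] \<sigma>(1) by (simp add: algebra_simps)
    then have "dist (w p) (c \<sigma> l) < 1" by (rule power_less_imp_less_base) simp
    moreover have "0 \<le> \<epsilon> * (2 * (\<sigma> * s l p))" "0 \<le> \<epsilon> * (\<epsilon> * T l p)" using \<epsilon>(1) \<sigma>(2) T0[OF pl(2)] by simp_all
    then have "1\<^sup>2 \<le> (dist (w p) (c (- \<sigma>) l))\<^sup>2"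
      unfolding dist[OF pl(2)] power2_minus \<sigma>(1) by (simp add: algebra_simps)
    then have "1 \<le> dist (w p) (c (- \<sigma>) l)" by (rule power2_le_imp_le) simp
    ultimately show ?thesis by simp
  qed
  have "\<forall>p\<in>P. \<forall>l\<in>L.
    (0 < g l \<bullet> z p + h l \<longrightarrow> dist (w p) (c 1 l) < 1 \<and> 1 \<le> dist (w p) (c (-1) l)) \<and>
    (g l \<bullet> z p + h l < 0 \<longrightarrow> dist (w p) (c (-1) l) < 1 \<and> 1 \<le> dist (w p) (c 1 l))"
  proof (intro ballI conjI impI)
    fix p l assume pl: "p \<in> P" "l \<in> L"
    have n0: "0 < norm (g l)" using g[OF pl(2)] by simp
    show "dist (w p) (c 1 l) < 1" "1 \<le> dist (w p) (c (-1) l)" if "0 < g l \<bullet> z p + h l"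
      using key[OF pl, of 1] that n0 unfolding s[OF pl(2)] by (simp_all add: zero_less_mult_iff)
    show "dist (w p) (c (-1) l) < 1" "1 \<le> dist (w p) (c 1 l)" if "g l \<bullet> z p + h l < 0"
      using key[OF pl, of "-1"] that n0 unfolding s[OF pl(2)] by (simp_all add: mult_less_0_iff)
  qed
  then show ?thesis
    by (intro exI[of _ w] exI[of _ "c 1"] exI[of _ "c (-1)"])
qed

section \<open>Distances in a realization of small bit size\<close>

lemma bitsize_int_bound: "\<bar>k\<bar> < 2 ^ bitsize_int k"
proof -
  have "log 2 (real_of_int \<bar>k\<bar> + 1) \<le> real (nat \<lceil>log 2 (real_of_int \<bar>k\<bar> + 1)\<rceil>)"
    by (rule real_nat_ceiling_ge)
  also have "\<dots> \<le> real (bitsize_int k)" by (simp add: bitsize_int_def)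
  finally have "real_of_int \<bar>k\<bar> + 1 \<le> 2 powr real (bitsize_int k)"
    by (simp add: log_le_iff)
  then have "real_of_int \<bar>k\<bar> < real_of_int (2 ^ bitsize_int k)" by (simp add: powr_realpow)
  then show ?thesis by (simp only: of_int_less_iff)
qed

lemma bitsize_rat_bounds:
  assumes "bitsize_rat q \<le> B"
  obtains d :: nat where "0 < d" "d \<le> 2 ^ B" "of_rat q * real d \<in> \<int>" "\<bar>of_rat q :: real\<bar> \<le> 2 ^ B"
proof -
  obtain a b where q: "quotient_of q = (a, b)" by fastforce
  have b: "0 < b" by (rule quotient_of_denom_pos[OF q])
  have ab: "q = of_int a / of_int b" by (rule quotient_of_div[OF q])
  have sz: "bitsize_int a \<le> B" "bitsize_int b \<le> B" using assms q by (simp_all add: bitsize_rat_def)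
  have p: "\<bar>k\<bar> \<le> 2 ^ B" if "bitsize_int k \<le> B" for k :: int
  proof -
    have "(2::int) ^ bitsize_int k \<le> 2 ^ B" using that by (intro power_increasing) auto
    then show ?thesis using bitsize_int_bound[of k] by linarith
  qed
  have r: "of_rat q = real_of_int a / real_of_int b" by (simp add: ab of_rat_divide)
  have "real_of_int \<bar>a\<bar> \<le> real_of_int (2 ^ B)" using p[OF sz(1)] by (simp only: of_int_le_iff)
  then have a2: "\<bar>real_of_int a\<bar> \<le> 2 ^ B" by simp
  have "\<bar>of_rat q :: real\<bar> \<le> \<bar>real_of_int a\<bar> / 1"
    unfolding r abs_divide using b by (intro divide_left_mono) auto
  then have "\<bar>of_rat q :: real\<bar> \<le> 2 ^ B" using a2 by simp
  moreover have "of_rat q * real (nat b) \<in> \<int>" using b by (simp add: r)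
  moreover have "nat b \<le> 2 ^ B" using p[OF sz(2)] b by (simp add: nat_le_iff)
  ultimately show thesis using that[of "nat b"] b by simp
qed

text \<open>The six rational coordinates have a common denominator \<open>N\<close> of at most 2^(6
  B), and x N^2 is an integer, so a nonzero x is at least 1 / N^2 in absolute value. The upper bound
  is for a difference of two sums of two squares, each square at most (2 * 2^B)^2.\<close>

lemma dist_square_diff_bounds:
  fixes p a b :: "rat^2"
  defines "R \<equiv> \<lambda>c :: rat^2. (\<chi> i. of_rat (c $ i)) :: real^2"
  defines "x \<equiv> (dist (R p) (R b))\<^sup>2 - (dist (R p) (R a))\<^sup>2"
  assumes B: "\<And>c i. c \<in> {p, a, b} \<Longrightarrow> bitsize_rat (c $ i) \<le> B"
  shows "\<bar>x\<bar> \<le> 2 ^ (2 * B + 3)" and "x \<noteq> 0 \<Longrightarrow> 1 / 2 ^ (12 * B) \<le> \<bar>x\<bar>"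
proof -
  have "\<exists>d :: nat. 0 < d \<and> d \<le> 2 ^ B \<and> of_rat (c $ i) * real d \<in> \<int> \<and> \<bar>of_rat (c $ i) :: real\<bar> \<le> 2 ^ B"
    if "c \<in> {p, a, b}" for c i
    by (rule bitsize_rat_bounds[OF B[OF that]]) blast
  then obtain d :: "rat^2 \<Rightarrow> 2 \<Rightarrow> nat" where d: "\<And>c i. c \<in> {p, a, b} \<Longrightarrow> 0 < d c i \<and> d c i \<le> 2 ^ B \<and>
      of_rat (c $ i) * real (d c i) \<in> \<int> \<and> \<bar>of_rat (c $ i) :: real\<bar> \<le> 2 ^ B"
    by metis
  have sq: "(u - v)\<^sup>2 \<le> 4 * (2 ^ B)\<^sup>2" if "\<bar>u\<bar> \<le> 2 ^ B" "\<bar>v\<bar> \<le> 2 ^ B" for u v :: real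
  proof -
    have "\<bar>u - v\<bar> \<le> 2 * 2 ^ B" using that by linarith
    then have "\<bar>u - v\<bar>\<^sup>2 \<le> (2 * 2 ^ B)\<^sup>2" by (intro power_mono) auto
    then show ?thesis by (simp add: power_mult_distrib)
  qed
  have x: "x = (of_rat (p $ 1) - of_rat (b $ 1))\<^sup>2 + (of_rat (p $ 2) - of_rat (b $ 2))\<^sup>2
      - ((of_rat (p $ 1) - of_rat (a $ 1))\<^sup>2 + (of_rat (p $ 2) - of_rat (a $ 2))\<^sup>2)"
    unfolding x_def R_def dist_real2_square by simp
  have le: "\<bar>of_rat (c $ i) :: real\<bar> \<le> 2 ^ B" if "c \<in> {p, a, b}" for c i using d[OF that] by blast
  have sum4: "\<bar>s + t - (u + v)\<bar> \<le> 8 * m"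
    if "0 \<le> s" "0 \<le> t" "0 \<le> u" "0 \<le> v" "s \<le> 4 * m" "t \<le> 4 * m" "u \<le> 4 * m" "v \<le> 4 * m"
    for s t u v m :: real using that by linarith
  have "\<bar>x\<bar> \<le> 8 * (2 ^ B)\<^sup>2" unfolding x by (rule sum4) (auto intro!: sq le)
  then show "\<bar>x\<bar> \<le> 2 ^ (2 * B + 3)" unfolding power_add mult.commute[of 2 B] power_mult by simp
  define N where "N = (\<Prod>c\<in>{p, a, b}. d c 1 * d c 2)"
  have dvd: "d c i dvd N" if "c \<in> {p, a, b}" for c i
  proof -
    have "d c 1 * d c 2 dvd N" unfolding N_def using that by (intro dvd_prodI) auto
    moreover have "d c i dvd d c 1 * d c 2" using exhaust_2[of i] by auto
    ultimately show ?thesis by (rule dvd_trans[rotated])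
  qed
  have int: "of_rat (c $ i) * real N \<in> \<int>" if c: "c \<in> {p, a, b}" for c i
  proof -
    obtain l where "N = d c i * l" using dvd[OF c] by blast
    then have "of_rat (c $ i) * real N = of_rat (c $ i) * real (d c i) * real l" by simp
    also have "\<dots> \<in> \<int>" by (rule Ints_mult) (use d[OF c, of i] in simp_all)
    finally show ?thesis .
  qed
  show "1 / 2 ^ (12 * B) \<le> \<bar>x\<bar>" if "x \<noteq> 0"
  proof -
    have N0: "0 < N" unfolding N_def using d by (intro prod_pos) auto
    have eq: "x * (real N)\<^sup>2 = (of_rat (p $ 1) * real N - of_rat (b $ 1) * real N)\<^sup>2 + (of_rat (p $ 2) * real N - of_rat (b $ 2) * real N)\<^sup>2
      - ((of_rat (p $ 1) * real N - of_rat (a $ 1) * real N)\<^sup>2 + (of_rat (p $ 2) * real N - of_rat (a $ 2) * real N)\<^sup>2)"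
      unfolding x left_diff_distrib[symmetric] power_mult_distrib
      by (simp only: left_diff_distrib distrib_right)
    have "x * (real N)\<^sup>2 \<in> \<int>" unfolding eq using int by (intro Ints_add Ints_diff Ints_power) auto
    moreover have "x * (real N)\<^sup>2 \<noteq> 0" using that N0 by simp
    ultimately have "1 \<le> \<bar>x * (real N)\<^sup>2\<bar>" by (rule Ints_nonzero_abs_ge1)
    then have ge: "1 \<le> \<bar>x\<bar> * (real N)\<^sup>2" by (simp add: abs_mult)
    have "N \<le> (\<Prod>c\<in>{p, a, b}. 2 ^ B * 2 ^ B)"
      unfolding N_def using d by (intro prod_mono conjI mult_le_mono) auto
    also have "\<dots> = (2 ^ B * 2 ^ B) ^ card {p, a, b}" by simp
    also have "\<dots> \<le> (2 ^ B * 2 ^ B) ^ 3" by (intro power_increasing) (auto simp: card_insert_if)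
    also have "\<dots> = 2 ^ (6 * B)" by (simp flip: power_add power_mult)
    finally have "real N \<le> real (2 ^ (6 * B))" by (rule of_nat_mono)
    then have "(real N)\<^sup>2 \<le> (2 ^ (6 * B))\<^sup>2" by (intro power_mono) simp_all
    also have "\<dots> = 2 ^ (12 * B)" by (simp flip: power_mult)
    finally have "\<bar>x\<bar> * (real N)\<^sup>2 \<le> \<bar>x\<bar> * 2 ^ (12 * B)" by (intro mult_left_mono) auto
    then have "1 \<le> \<bar>x\<bar> * 2 ^ (12 * B)" using ge by linarith
    then show ?thesis by (simp add: field_simps)
  qed
qed

section \<open>The hard graph and the final count\<close>

datatype vertex = VP pt | VA ln | VB ln

definition vertices :: "nat \<Rightarrow> vertex set" where
  "vertices m = VP ` points m \<union> VA ` lines m \<union> VB ` lines m"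

lemma finite_points: "finite (points m)" and card_points: "card (points m) \<le> 19 + 3 * m"
proof -
  show "finite (points m)" by (simp add: points_def)
  have "card ((\<lambda>(i, s, t). Fr i s t) ` ({..2::nat} \<times> (UNIV :: bool set) \<times> (UNIV :: bool set))) \<le> 12"
    by (rule order_trans[OF card_image_le]) (simp_all add: card_cartesian_product)
  moreover have "card {V0, V1, W0, X0, Q0, P0} \<le> 6" by (simp add: card_insert_if)
  moreover have "card (PA ` {..m}) \<le> m + 1" "card (PP ` {..<m}) \<le> m" "card (PQ ` {..<m}) \<le> m"
    using card_image_le[of "{..m}" PA] card_image_le[of "{..<m}" PP] card_image_le[of "{..<m}" PQ] by simp_all
  moreover have "card (A \<union> S \<union> T \<union> U \<union> V) \<le> card A + card S + card T + card U + card V" for A S T U V :: "pt set"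
    using card_Un_le[of A S] card_Un_le[of "A \<union> S" T] card_Un_le[of "A \<union> S \<union> T" U]
      card_Un_le[of "A \<union> S \<union> T \<union> U" V] by linarith
  ultimately show "card (points m) \<le> 19 + 3 * m"
    unfolding points_def by (rule_tac order_trans) (assumption, linarith)
qed

lemma finite_lines: "finite (lines m)" and card_lines: "card (lines m) \<le> 8 + 3 * m"
proof -
  show "finite (lines m)" by (simp add: lines_def plines_def)
  have c: "card {AX, AY} \<le> 2" "card {G0, H0, J0, L0, L1, L2} \<le> 6" by (simp_all add: card_insert_if)
  have i: "card (LC ` {..<m}) \<le> m" "card (LB ` {..<m}) \<le> m" "card (LK ` {..<m}) \<le> m"
    using card_image_le[of "{..<m}" LC] card_image_le[of "{..<m}" LB] card_image_le[of "{..<m}" LK] by simp_all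
  have "card (plines m) \<le> card ({G0, H0, J0, L0, L1, L2} \<union> LC ` {..<m} \<union> LB ` {..<m}) + card (LK ` {..<m})"
    unfolding plines_def by (rule card_Un_le)
  moreover have "card ({G0, H0, J0, L0, L1, L2} \<union> LC ` {..<m} \<union> LB ` {..<m})
    \<le> card ({G0, H0, J0, L0, L1, L2} \<union> LC ` {..<m}) + card (LB ` {..<m})" by (rule card_Un_le)
  moreover have "card ({G0, H0, J0, L0, L1, L2} \<union> LC ` {..<m})
    \<le> card {G0, H0, J0, L0, L1, L2} + card (LC ` {..<m})" by (rule card_Un_le)
  moreover have "card (lines m) \<le> card {AX, AY} + card (plines m)"
    unfolding lines_def by (rule card_Un_le)
  ultimately show "card (lines m) \<le> 8 + 3 * m" using c i by linarith
qed

text \<open>A stage adds nine vertices: three points, and two disks for each of three lines. Of the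
  35 others, 19 are points, 12 of them in the frame, and 16 encode eight lines.\<close>

lemma finite_vertices: "finite (vertices m)" and card_vertices: "card (vertices m) \<le> 35 + 9 * m"
proof -
  show "finite (vertices m)" by (simp add: vertices_def finite_points finite_lines)
  have "card (vertices m) \<le> card (VP ` points m \<union> VA ` lines m) + card (VB ` lines m)"
    unfolding vertices_def by (rule card_Un_le)
  moreover have "card (VP ` points m \<union> VA ` lines m) \<le> card (VP ` points m) + card (VA ` lines m)"
    by (rule card_Un_le)
  ultimately show "card (vertices m) \<le> 35 + 9 * m"
    using card_image_le[OF finite_points, of VP m] card_image_le[OF finite_lines, of VA m]
      card_image_le[OF finite_lines, of VB m] card_points[of m] card_lines[of m] by linarith
qed

lemma vertices_positions:
  obtains pos :: "vertex \<Rightarrow> real^2" where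
    "\<And>p M. p \<in> points m \<Longrightarrow> M \<in> lines m \<Longrightarrow> 0 < lval m M p \<Longrightarrow>
      dist (pos (VP p)) (pos (VA M)) < 1 \<and> 1 \<le> dist (pos (VP p)) (pos (VB M))"
    "\<And>p M. p \<in> points m \<Longrightarrow> M \<in> lines m \<Longrightarrow> lval m M p < 0 \<Longrightarrow>
      dist (pos (VP p)) (pos (VB M)) < 1 \<and> 1 \<le> dist (pos (VP p)) (pos (VA M))"
proof -
  define z :: "pt \<Rightarrow> real^2" where "z p = vector [sgx p * exp (ptx m p), sgy p * exp (pty m p)]" for p
  define g :: "ln \<Rightarrow> real^2" where "g M = vector [sg1 M * exp (- lnx M), sg2 M * exp (- lny M)]" for M
  have lv: "g M \<bullet> z p + sg3 M = lval m M p" for M p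
    by (simp add: g_def z_def lval_def inner_vec_def sum_2)
  have "g M \<noteq> 0" for M
    by (cases M) (simp_all add: g_def vec_eq_iff forall_2)
  from lines_encoded_by_disks[of "points m" "lines m" g z sg3, OF finite_points finite_lines this]
  obtain w :: "pt \<Rightarrow> real^2" and a b where wab: "\<forall>p\<in>points m. \<forall>M\<in>lines m.
    (0 < g M \<bullet> z p + sg3 M \<longrightarrow> dist (w p) (a M) < 1 \<and> 1 \<le> dist (w p) (b M)) \<and>
    (g M \<bullet> z p + sg3 M < 0 \<longrightarrow> dist (w p) (b M) < 1 \<and> 1 \<le> dist (w p) (a M))" by blast
  show thesis
    by (rule that[of "case_vertex w a b"]) (use wab in \<open>simp_all add: lv\<close>)
qed

lemma hard_unit_disk_graph:
  assumes n: "35 + 9 * m \<le> n"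
  obtains G where "G \<in> UDG n"
    "\<And>c r. 0 < r \<Longrightarrow> realizes (\<lambda>v. rat_disk (c v) r) G \<Longrightarrow> 2 ^ m \<le> 34 * realization_size (verts G) c r"
proof -
  obtain pos :: "vertex \<Rightarrow> real^2" where pos:
    "\<And>p M. p \<in> points m \<Longrightarrow> M \<in> lines m \<Longrightarrow> 0 < lval m M p \<Longrightarrow>
      dist (pos (VP p)) (pos (VA M)) < 1 \<and> 1 \<le> dist (pos (VP p)) (pos (VB M))"
    "\<And>p M. p \<in> points m \<Longrightarrow> M \<in> lines m \<Longrightarrow> lval m M p < 0 \<Longrightarrow>
      dist (pos (VP p)) (pos (VB M)) < 1 \<and> 1 \<le> dist (pos (VP p)) (pos (VA M))"
    using vertices_positions[of m] by blast
  have "card (vertices m) \<le> card {..<n}" using card_vertices[of m] n by simp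
  then obtain f where f: "f ` vertices m \<subseteq> {..<n}" "inj_on f (vertices m)"
    using card_le_inj[OF finite_vertices] by blast
  \<comment> \<open>Numbers outside the image of \<open>f\<close> receive an unspecified centre.
    They pad the graph to exactly \<open>n\<close> vertices, and their adjacencies are
    irrelevant.\<close>
  define cen where "cen i = pos (inv_into (vertices m) f i)" for i
  have cen: "cen (f v) = pos v" if "v \<in> vertices m" for v
    using f(2) that by (simp add: cen_def)
  define G where "G = intersection_graph {..<n} (\<lambda>i. ball (cen i) (1 / 2))"
  have vG: "verts G = {..<n}" by (simp add: G_def intersection_graph_def)
  have simple: "simple_graph G" by (auto simp: G_def simple_graph_def intersection_graph_def card_2_iff)
  have reG: "realizes (\<lambda>i. ball (cen i) (1 / 2)) G" by (simp add: realizes_def G_def intersection_graph_def)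
  have "unit_disk_graph G"
  proof (subst unit_disk_graph_iff)
    show "simple_graph G \<and> (\<exists>(c :: nat \<Rightarrow> real^2) r. 0 < r \<and> realizes (\<lambda>v. ball (c v) r) G)"
      using simple reG by (intro conjI exI[of _ cen] exI[of _ "1 / 2"]) simp_all
  qed (simp add: vG)
  then have "G \<in> UDG n" by (simp add: UDG_def vG)
  moreover have "2 ^ m \<le> 34 * realization_size (verts G) c r"
    if r: "0 < r" and re: "realizes (\<lambda>v. rat_disk (c v) r) G" for c r
  proof -
    define R :: "rat^2 \<Rightarrow> real^2" where "R q = (\<chi> i. of_rat (q $ i))" for q
    have r': "0 < (of_rat r :: real)" using r by simp
    define C :: "vertex \<Rightarrow> real^2" where "C v = R (c (f v))" for v
    have adj: "dist (pos u) (pos v) < 1 \<longleftrightarrow> dist (C u) (C v) < 2 * of_rat r"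
      if uv: "u \<in> vertices m" "v \<in> vertices m" "u \<noteq> v" for u v
    proof -
      have fuv: "f u \<in> verts G" "f v \<in> verts G" "f u \<noteq> f v"
        using f uv unfolding vG by (auto simp: inj_on_def)
      have "{f u, f v} \<in> edges G \<longleftrightarrow> dist (cen (f u)) (cen (f v)) < 2 * (1 / 2)"
        using reG[unfolded realizes_balls_iff[OF simple half_gt_zero[OF zero_less_one]]] fuv by blast
      moreover have "{f u, f v} \<in> edges G \<longleftrightarrow> dist (C u) (C v) < 2 * of_rat r"
        using re[unfolded rat_disk_def realizes_balls_iff[OF simple r']] fuv
        unfolding C_def R_def by blast
      ultimately show ?thesis using cen uv by simp
    qed
    \<comment> \<open>The difference of the squared distances to two fixed centres is affine in the
      point. As all radii agree, a disk that meets \<open>VA M\<close> but not \<open>VB M\<close>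
      has its centre nearer to that of \<open>VA M\<close>; this gives the sign required by the
      locale.\<close>
    define g where "g M = 2 *\<^sub>R (C (VA M) - C (VB M))" for M
    define h where "h M = C (VB M) \<bullet> C (VB M) - C (VA M) \<bullet> C (VA M)" for M
    define z where "z p = C (VP p)" for p
    have F: "g M \<bullet> z p + h M = (dist (C (VP p)) (C (VB M)))\<^sup>2 - (dist (C (VP p)) (C (VA M)))\<^sup>2" for M p
      by (simp add: g_def h_def z_def dist_norm power2_norm_eq_inner inner_diff_left inner_diff_right inner_commute)
    have less: "(dist x y)\<^sup>2 < (dist x y')\<^sup>2" if "dist x y < t" "\<not> dist x y' < t" for x y y' :: "real^2" and t
      using that by (intro power_strict_mono) auto
    interpret sign_realization m g h z
    proof
      fix M p assume Mp: "M \<in> lines m" "p \<in> points m"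
      then have v: "VP p \<in> vertices m" "VA M \<in> vertices m" "VB M \<in> vertices m" by (auto simp: vertices_def)
      show "0 < g M \<bullet> z p + h M" if "0 < lval m M p"
        using pos(1)[OF Mp(2,1) that] adj[OF v(1,2)] adj[OF v(1,3)]
          less[of "C (VP p)" "C (VA M)" "2 * of_rat r" "C (VB M)"] unfolding F by simp
      show "g M \<bullet> z p + h M < 0" if "lval m M p < 0"
        using pos(2)[OF Mp(2,1) that] adj[OF v(1,2)] adj[OF v(1,3)]
          less[of "C (VP p)" "C (VB M)" "2 * of_rat r" "C (VA M)"] unfolding F by simp
    qed
    define B where "B = realization_size (verts G) c r"
    have bs: "bitsize_rat (c (f v) $ i) \<le> B" if "v \<in> vertices m" for v i
    proof -
      have "bitsize_rat (c (f v) $ i) \<le> (\<Sum>i\<in>UNIV. bitsize_rat (c (f v) $ i))" by (intro member_le_sum) auto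
      also have "\<dots> \<le> (\<Sum>v\<in>verts G. \<Sum>i\<in>UNIV. bitsize_rat (c v $ i))"
        using f(1) that unfolding vG by (intro member_le_sum[of "f v" _ "\<lambda>v. \<Sum>i\<in>UNIV. bitsize_rat (c v $ i)"]) auto
      finally show ?thesis by (simp add: B_def realization_size_def)
    qed
    have B1: "1 \<le> B" by (simp add: B_def realization_size_def bitsize_rat_def bitsize_int_def split: prod.split)
    have bounds: "\<bar>F M p\<bar> \<le> 2 ^ (2 * B + 3)" "F M p \<noteq> 0 \<Longrightarrow> 1 / 2 ^ (12 * B) \<le> \<bar>F M p\<bar>"
      if "M \<in> lines m" "p \<in> points m" for M p
    proof -
      have "VP p \<in> vertices m" "VA M \<in> vertices m" "VB M \<in> vertices m" using that by (auto simp: vertices_def)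
      then have "bitsize_rat (q $ i) \<le> B" if "q \<in> {c (f (VP p)), c (f (VA M)), c (f (VB M))}" for q i
        using that bs by auto
      from dist_square_diff_bounds[OF this]
      show "\<bar>F M p\<bar> \<le> 2 ^ (2 * B + 3)" "F M p \<noteq> 0 \<Longrightarrow> 1 / 2 ^ (12 * B) \<le> \<bar>F M p\<bar>"
        unfolding F_def F C_def R_def by simp_all
    qed
    have P: "PA m \<in> points m" "W0 \<in> points m" "V0 \<in> points m" using in_points by auto
    have A: "AX \<in> lines m" "AY \<in> lines m" by (simp_all add: lines_def)
    have "X (PA m) \<noteq> 0" "Y W0 \<noteq> 0" using sgx_X[OF P(1)] sgy_Y[OF P(2)] by auto
    then have low: "1 / 2 ^ (12 * B) \<le> \<bar>X (PA m)\<bar>" "1 / 2 ^ (12 * B) \<le> \<bar>Y W0\<bar>"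
      using bounds(2)[OF A(1) P(1)] bounds(2)[OF A(2) P(2)] by (simp_all add: X_def Y_def)
    have up: "\<bar>X W0\<bar> \<le> 2 ^ (2 * B + 3)" "\<bar>Y V0\<bar> \<le> 2 ^ (2 * B + 3)"
      using bounds(1)[OF A(1) P(2)] bounds(1)[OF A(2) P(3)] by (simp_all add: X_def Y_def)
    have "2 ^ 2 ^ m * (1 / 2 ^ (12 * B) * (1 / 2 ^ (12 * B))) \<le> 2 ^ 2 ^ m * (\<bar>X (PA m)\<bar> * \<bar>Y W0\<bar>)"
      using low by (intro mult_left_mono mult_mono) auto
    also have "\<dots> \<le> \<bar>X W0\<bar> * \<bar>Y V0\<bar>" by (rule cross_ratio_bound)
    also have "\<dots> \<le> 2 ^ (2 * B + 3) * 2 ^ (2 * B + 3)" using up by (intro mult_mono) auto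
    finally have "(2::real) ^ 2 ^ m \<le> 2 ^ (2 * B + 3) * 2 ^ (2 * B + 3) * (2 ^ (12 * B) * 2 ^ (12 * B))"
      by (simp add: field_simps)
    also have "\<dots> = 2 ^ (28 * B + 6)" by (simp flip: power_add)
    \<comment> \<open>Two lower bounds contribute 12 B each and two upper bounds 2 B + 3 each; B
      \<ge> 1 then gives 34 B.\<close>
    finally have "2 ^ m \<le> 28 * B + 6" by (simp add: power_le_imp_le_exp)
    then show ?thesis using B1 unfolding B_def by linarith
  qed
  ultimately show thesis by (rule that)
qed

theorem corollary1p5:
  shows "\<exists>(c1::real) (c2::real) (n0::nat). c1 > 0 \<and> c2 > 0 \<and>
    (\<forall>n\<ge>n0. 2 powr (c1 * real n) \<le> real (g_UDG n) \<and>
             real (g_UDG n) \<le> 2 powr (c2 * real n))"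
proof (rule exI[of _ "1 / 18"], rule exI[of _ 20], rule exI[of _ 194], intro conjI allI impI)
  \<comment> \<open>As \<open>m\<close> is about n / 9, the rate n / 18 leaves room for a factor 64
    = 2^6: the condition n / 18 + 6 \<le> (n - 43) / 9 means n \<ge> 194.\<close>
  fix n :: nat assume n: "194 \<le> n"
  then have n1: "1 \<le> n" by simp
  have "real (g_UDG n) \<le> real (2 ^ (20 * n))" using g_UDG_le[OF n1] by (rule of_nat_mono)
  also have "\<dots> = 2 powr (20 * real n)" by (simp add: powr_realpow[symmetric])
  finally show "real (g_UDG n) \<le> 2 powr (20 * real n)" .
  define m where "m = (n - 35) div 9"
  have m: "35 + 9 * m \<le> n" "n \<le> 43 + 9 * m" using n unfolding m_def by linarith+
  obtain G where G: "G \<in> UDG n"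
    "\<And>c r. 0 < r \<Longrightarrow> realizes (\<lambda>v. rat_disk (c v) r) G \<Longrightarrow> 2 ^ m \<le> 34 * realization_size (verts G) c r"
    using hard_unit_disk_graph[OF m(1)] by blast
  \<comment> \<open>The infimum needs a natural number as lower bound, so the quotient is rounded
    down; the lost remainder of at most 33 is absorbed when 34 is replaced by 64.\<close>
  have "2 ^ m div 34 \<le> g_UDG_graph G"
    using G(2) by (intro g_UDG_graph_ge[OF n1 G(1)]) fastforce
  also have "\<dots> \<le> g_UDG n"
    unfolding g_UDG_def using finite_g_UDG_graph_image[OF n1] G(1) by (intro Max_ge) auto
  finally have "2 ^ m div 34 \<le> g_UDG n" .
  then have "2 ^ m \<le> 34 * g_UDG n + 33" by linarith
  then have "real (2 ^ m) \<le> real (34 * g_UDG n + 33)" by (rule of_nat_mono)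
  then have g: "2 ^ m \<le> 34 * real (g_UDG n) + 33" by simp
  have "16 \<le> m" using n m(2) by linarith
  then have "(2::real) ^ 16 \<le> 2 ^ m" by (intro power_increasing) auto
  then have "2 ^ m \<le> 64 * real (g_UDG n)" using g by simp
  moreover have "2 powr (1 / 18 * real n) * 64 = 2 powr (1 / 18 * real n + 6)" by (simp add: powr_add)
  moreover have "1 / 18 * real n + 6 \<le> real m"
  proof -
    have "real n \<le> 43 + 9 * real m" "194 \<le> real n" using m(2) n by linarith+
    then show ?thesis by simp
  qed
  then have "2 powr (1 / 18 * real n + 6) \<le> 2 powr real m" by (intro powr_mono) auto
  moreover have "2 powr real m = 2 ^ m" by (simp add: powr_realpow)
  ultimately show "2 powr (1 / 18 * real n) \<le> real (g_UDG n)" by simp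
qed simp_all

end
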